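(* Let $G$ be a countable abelian group with exponent $q$. Let $d\in\mathbb N$ with $d\ge 3$, and let $c_1,\dots,c_d\in\mathbb Z$ satisfy: (1) $c_iG$ has finite index in $G$ for each $i=1,\dots,d$; (2) $(c_{d-1}+c_d)G$ has finite index in $G$; (3) $q$ divides $\sum_{i=1}^d c_i$. If $A\subset G$ has $d^*(A)>0$, then $\vec c\cdot A$ contains a Bohr neighborhood of $0$ in $G$.
   Context: $G$ is a countable discrete abelian group. The exponent $q$ of $G$ is the least $m\in\mathbb N$ with $mg=0$ for all $g\in G$; if no such $m$ exists, $q=0$ (so condition (3) then means $\sum c_i=0$). For $c\in\mathbb Z$, $cG=\{cg:g\in G\}$. A Følner sequence is a sequence $(F_n)_{n\in\mathbb N}$ of finite nonempty subsets of $G$ with $\lim_{n\to\infty}|F_n\triangle(g+F_n)|/|F_n|=0$ for every $g\in G$. The upper Banach density of $A\subset G$ is $d^*(A)=\sup\{\limsup_{n\to\infty}|A\cap F_n|/|F_n| : (F_n) \text{ a Følner sequence}\}$. A character of $G$ is a homomorphism $\chi:G\to\mathcal S^1=\{z\in\mathbb C:|z|=1\}$. A Bohr neighborhood of $0$ is a set of the form $\mathrm{Bohr}(\chi_1,\dots,\chi_r;\varepsilon)=\{g\in G:|\chi_i(g)-1|<\varepsilon \text{ for } 1\le i\le r\}$ for some $r\in\mathbb N$, characters $\chi_1,\dots,\chi_r$, and $\varepsilon>0$. For $\vec c=(c_1,\dots,c_d)\in\mathbb Z^d$ and $A\subset G$, $\vec c\cdot A:=\{\sum_{i=1}^d c_ia_i: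 a_1,\dots,a_d\in A \text{ mutually distinct}\}\cup\{0\}$. *)

theory Defs
  imports "HOL-Analysis.Analysis" "HOL-Library.Countable"
begin

definition zmul :: "int \<Rightarrow> 'a::ab_group_add \<Rightarrow> 'a" where
  "zmul c g = (if 0 \<le> c then (((+) g) ^^ nat c) 0 else - ((((+) g) ^^ nat (- c)) 0))"

definition group_exponent :: "'a::ab_group_add itself \<Rightarrow> nat" where
  "group_exponent _ =
     (if \<exists>m::nat. m > 0 \<and> (\<forall>g::'a. zmul (int m) g = 0)
      then (LEAST m::nat. m > 0 \<and> (\<forall>g::'a. zmul (int m) g = 0)) else 0)"

definition mult_set :: "int \<Rightarrow> 'a::ab_group_add set" where
  "mult_set c = range (zmul c)"

definition finite_index :: "'a::ab_group_add set \<Rightarrow> bool" where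
  "finite_index H \<longleftrightarrow> finite {(\<lambda>h. g + h) ` H | g. True}"

definition symdiff :: "'a set \<Rightarrow> 'a set \<Rightarrow> 'a set" where
  "symdiff X Y = (X - Y) \<union> (Y - X)"

definition folner :: "(nat \<Rightarrow> 'a::ab_group_add set) \<Rightarrow> bool" where
  "folner F \<longleftrightarrow> (\<forall>n. finite (F n) \<and> F n \<noteq> {}) \<and>
     (\<forall>g. (\<lambda>n. real (card (symdiff (F n) ((\<lambda>x. g + x) ` F n))) / real (card (F n)))
            \<longlonglongrightarrow> 0)"

definition upper_banach_density :: "'a::ab_group_add set \<Rightarrow> ereal" where
  "upper_banach_density A =
     (SUP F \<in> {F. folner F}. limsup (\<lambda>n. ereal (real (card (A \<inter> F n)) / real (card (F n)))))"

definition character :: "('a::ab_group_add \<Rightarrow> complex) \<Rightarrow> bool" where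
  "character chi \<longleftrightarrow> (\<forall>x. norm (chi x) = 1) \<and> (\<forall>x y. chi (x + y) = chi x * chi y)"

definition Bohr :: "(nat \<Rightarrow> 'a::ab_group_add \<Rightarrow> complex) \<Rightarrow> nat \<Rightarrow> real \<Rightarrow> 'a set" where
  "Bohr chi r eps = {g. \<forall>i<r. cmod (chi i g - 1) < eps}"

definition bohr_nbhd_zero :: "'a::ab_group_add set \<Rightarrow> bool" where
  "bohr_nbhd_zero B \<longleftrightarrow>
     (\<exists>r chi eps. (\<forall>i<r. character (chi i)) \<and> eps > 0 \<and> B = Bohr chi r eps)"

definition lin_comb_set :: "nat \<Rightarrow> (nat \<Rightarrow> int) \<Rightarrow> 'a::ab_group_add set \<Rightarrow> 'a set" where
  "lin_comb_set d c A =
     {(\<Sum>i<d. zmul (c i) (a i)) | a. (\<forall>i<d. a i \<in> A) \<and> inj_on a {..<d}} \<union> {0}"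

end

theory Submission
  imports Defs
begin

text \<open>
  Let \<open>r\<close> be the sum of all but the last two coefficients, \<open>s\<close> and \<open>t\<close> the last two, so that
  \<open>r + s + t\<close> annihilates the group, and let \<open>f\<close> be the indicator function of \<open>A\<close>. Choose an invariant
  mean \<open>m\<close> that is extreme among those maximising \<open>m f > 0\<close>; being extreme, it is ergodic. For \<open>f0\<close> a product
  of translates of \<open>f\<close> by small elements \<open>p\<^sub>i\<close>, consider the mean over \<open>y\<close> and \<open>z\<close> of
  \<open>f0 (z + s y + x) f (z - r y) f z\<close>. If it is positive, then there is a solution with entries
  \<open>z + s y + x + p\<^sub>i\<close>, \<open>z - r y\<close> and \<open>z\<close>, and these are distinct for almost all \<open>y\<close>. The van der Corput inequality
  bounds the effect of the part of \<open>f\<close> that is orthogonal to all Bohr almost periodic functions: by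
  ergodicity such a part has small box norm, because otherwise Bochner's theorem would produce a character, and an
  eigenfunction for it, with which it correlates. The almost periodic part is nearly unchanged under
  translations from a Bohr neighbourhood of 0, which makes the mean positive when \<open>x\<close> and the \<open>p\<^sub>i\<close> lie in such a
  neighbourhood. Finally multiplication by \<open>r\<close> maps Bohr neighbourhoods onto Bohr neighbourhoods, as \<open>r\<close> has an
  image of finite index.
\<close>

subsection \<open>Integer multiples\<close>

text \<open>The entries satisfy r(z + sy + x) + s(z - ry) + tz = rx because r + s + t kills the
  group. Only multiples of r are reached in this way, which is why openness of multiplication by r
  is needed. The p_i make the first entries distinct; they are taken of the form r q_i, so that
  their contribution is again a multiple of r and can be cancelled through x. Hence the p_i depend
  on the Bohr neighbourhood, and the lower bound for the mean of \<open>f0\<close> must be known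
  before that neighbourhood is chosen. The mean is only finitely additive and bounded functions are
  incomplete in its seminorm, so projections to eigenspaces or to almost periodic functions are not
  at hand. Each is replaced by an almost minimiser of a quadratic functional, with the parallelogram
  law doing the work of completeness, and almost periodicity is graded by an error.\<close>

lemma zmul_0 [simp]: "zmul 0 g = 0"
  by (simp add: zmul_def)

lemma zmul_1 [simp]: "zmul 1 g = g"
  by (simp add: zmul_def)

lemma zmul_add_1: "zmul (c + 1) g = zmul c g + g"
proof (cases "0 \<le> c")
  case True
  then have "nat (c + 1) = Suc (nat c)" by simp
  then show ?thesis using True by (simp add: zmul_def add.commute)
next
  case False
  define n where "n = nat (- c - 1)"
  have n: "- c = int (Suc n)" and n': "- c - 1 = int n" using False by (auto simp: n_def)
  have "zmul c g = - (((+) g ^^ Suc n) 0)"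
    using False n by (simp only: zmul_def if_False nat_int)
  moreover have "zmul (c + 1) g = - (((+) g ^^ n) 0)"
  \<comment> \<open>At -1 the successor leaves the negative branch of \<open>zmul\<close>.\<close>
  proof (cases "c = -1")
    case True
    then show ?thesis using n' by (simp add: zmul_def)
  next
    case F: False
    then have "\<not> 0 \<le> c + 1" using False by simp
    moreover have "nat (- (c + 1)) = n" using n' by simp
    ultimately show ?thesis by (simp only: zmul_def if_False)
  qed
  moreover have "((+) g ^^ Suc n) 0 = g + ((+) g ^^ n) 0" by simp
  ultimately show ?thesis by (simp only: minus_add_distrib) simp
qed

lemma zmul_add_left: "zmul (c + d) g = zmul c g + zmul d g"
proof (induction d rule: int_induct[where k = 0])
  case (step1 i)
  then show ?case using zmul_add_1[of "c + i" g] zmul_add_1[of i g] by (simp add: algebra_simps)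
next
  case (step2 i)
  then show ?case using zmul_add_1[of "c + i - 1" g] zmul_add_1[of "i - 1" g] by (simp add: algebra_simps)
qed simp

lemma zmul_minus_left: "zmul (- c) g = - zmul c g"
  using zmul_add_left[of c "- c" g] by (simp add: eq_neg_iff_add_eq_0 add.commute)

lemma zmul_diff_left: "zmul (c - d) g = zmul c g - zmul d g"
  using zmul_add_left[of c "- d" g] by (simp add: zmul_minus_left)

lemma zmul_add_right: "zmul c (g + h) = zmul c g + zmul c h"
proof (induction c rule: int_induct[where k = 0])
  case (step1 i)
  then show ?case by (simp add: zmul_add_1)
next
  case (step2 i)
  then show ?case by (simp add: zmul_diff_left)
qed simp

lemma zmul_0_right [simp]: "zmul c 0 = 0"
  using zmul_add_right[of c 0 0] by simp

lemma zmul_minus_right: "zmul c (- g) = - zmul c g"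
  using zmul_add_right[of c g "- g"] by (simp add: eq_neg_iff_add_eq_0 add.commute)

lemma zmul_diff_right: "zmul c (g - h) = zmul c g - zmul c h"
  using zmul_add_right[of c g "- h"] by (simp add: zmul_minus_right)

lemma zmul_zmul: "zmul c (zmul d g) = zmul (c * d) g"
proof (induction c rule: int_induct[where k = 0])
  case (step1 i)
  then show ?case by (simp add: zmul_add_1 zmul_add_left distrib_right)
next
  case (step2 i)
  then show ?case by (simp add: zmul_diff_left left_diff_distrib)
qed simp

lemma zmul_sum_left: "zmul (\<Sum>i\<in>I. c i) g = (\<Sum>i\<in>I. zmul (c i) g)"
  by (induction I rule: infinite_finite_induct) (auto simp: zmul_add_left)

lemma zmul_sum_right: "zmul c (\<Sum>i\<in>I. g i) = (\<Sum>i\<in>I. zmul c (g i))"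
  by (induction I rule: infinite_finite_induct) (auto simp: zmul_add_right)

lemma zmul_group_exponent: "zmul (int (group_exponent TYPE('a))) (g :: 'a::ab_group_add) = 0"
proof (cases "\<exists>m::nat. m > 0 \<and> (\<forall>g::'a. zmul (int m) g = 0)")
  case True
  then show ?thesis unfolding group_exponent_def
    by (simp only: if_True) (use LeastI_ex[OF True] in blast)
next
  case False
  then show ?thesis unfolding group_exponent_def by (simp only: if_False) simp
qed

text \<open>Exponent 0 makes the divisibility say that \<open>c\<close> is 0, so both readings of
  the condition on the coefficients are covered.\<close>

lemma zmul_eq_0_if_group_exponent_dvd:
  assumes "int (group_exponent TYPE('a)) dvd c"
  shows "zmul c (g :: 'a::ab_group_add) = 0"
proof -
  obtain k where "c = k * int (group_exponent TYPE('a))" using assms by (metis dvd_def mult.commute)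
  then show ?thesis by (simp add: zmul_zmul[symmetric] zmul_group_exponent)
qed

lemma mult_set_uminus: "mult_set (- c) = (mult_set c :: 'a::ab_group_add set)"
proof -
  have "zmul (- c) g \<in> range (zmul c)" for c and g :: 'a
    by (metis rangeI zmul_minus_left zmul_minus_right)
  from this[of c] this[of "- c"] show ?thesis by (auto simp: mult_set_def)
qed

text \<open>Finitely many translates of a finite set cannot cover an infinite group. Infinite images
  are what makes the fibres of \<open>zmul c\<close> negligible later.\<close>

lemma infinite_mult_set:
  assumes "finite_index (mult_set c :: 'a::ab_group_add set)" "infinite (UNIV :: 'a set)"
  shows "infinite (mult_set c :: 'a set)"
proof
  assume fin: "finite (mult_set c :: 'a set)"
  let ?C = "{(\<lambda>h. g + h) ` (mult_set c :: 'a set) | g. True}"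
  have "finite (\<Union> ?C)"
    using assms(1) fin unfolding finite_index_def by (intro finite_Union) auto
  moreover have "(0 :: 'a) \<in> mult_set c" unfolding mult_set_def by (metis rangeI zmul_0_right)
  then have "g \<in> (\<lambda>h. g + h) ` (mult_set c :: 'a set)" for g :: 'a by (auto simp: image_iff intro!: bexI[of _ 0])
  then have "UNIV \<subseteq> \<Union> ?C" by blast
  ultimately show False using assms(2) finite_subset by blast
qed

subsection \<open>Averages over lists and bounded functions\<close>

text \<open>Lists instead of sets: repetitions act as integer weights, and translating or adding
  lists needs no injectivity. The empty list has average 0.\<close>

definition avg :: "'a list \<Rightarrow> ('a \<Rightarrow> 'b::real_vector) \<Rightarrow> 'b" where
  "avg xs \<phi> = (\<Sum>x\<leftarrow>xs. \<phi> x) /\<^sub>R real (length xs)"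

text \<open>Averaging over \<open>conv xs ys\<close> is averaging over both lists in turn, a
  convolution of the two distributions. It serves to merge several lists into one.\<close>

definition conv :: "'a list \<Rightarrow> 'a list \<Rightarrow> 'a::ab_group_add list" where
  "conv xs ys = concat (map (\<lambda>x. map (\<lambda>y. x + y) ys) xs)"

lemma conv_eq_Nil_iff [simp]: "conv xs ys = [] \<longleftrightarrow> xs = [] \<or> ys = []"
  by (cases xs; cases ys) (auto simp: conv_def)

lemma avg_const [simp]: "xs \<noteq> [] \<Longrightarrow> avg xs (\<lambda>_. c) = c"
proof -
  assume "xs \<noteq> []"
  moreover have "(\<Sum>x\<leftarrow>xs. c) = real (length xs) *\<^sub>R c"
    by (induction xs) (auto simp: algebra_simps)
  ultimately show ?thesis by (simp add: avg_def)
qed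

lemma avg_cong: "(\<And>x. x \<in> set xs \<Longrightarrow> \<phi> x = \<psi> x) \<Longrightarrow> avg xs \<phi> = avg xs \<psi>"
  by (simp add: avg_def cong: map_cong)

lemma avg_add: "avg xs (\<lambda>x. \<phi> x + \<psi> x) = avg xs \<phi> + avg xs \<psi>"
  by (simp add: avg_def sum_list_addf algebra_simps)

lemma avg_linear: assumes "linear L" shows "L (avg xs \<phi>) = avg xs (\<lambda>x. L (\<phi> x))"
proof -
  interpret linear L by fact
  have "L (\<Sum>x\<leftarrow>xs. \<phi> x) = (\<Sum>x\<leftarrow>xs. L (\<phi> x))" by (induction xs) (auto simp: add)
  then show ?thesis by (simp add: avg_def scale)
qed

lemma avg_diff: "avg xs (\<lambda>x. \<phi> x - \<psi> x) = avg xs \<phi> - avg xs \<psi>"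
  using avg_add[of xs "\<lambda>x. \<phi> x - \<psi> x" \<psi>] by (simp add: algebra_simps)

lemma avg_mult_left: "avg xs (\<lambda>x. c * \<phi> x) = c * avg xs (\<phi> :: 'a \<Rightarrow> 'b::real_algebra)"
  by (rule avg_linear[symmetric]) (auto intro!: linearI simp: algebra_simps)

lemma avg_mult_right: "avg xs (\<lambda>x. \<phi> x * c) = avg xs (\<phi> :: 'a \<Rightarrow> 'b::real_algebra) * c"
  by (rule avg_linear[symmetric]) (auto intro!: linearI simp: algebra_simps)

lemma avg_avg_swap: "avg xs (\<lambda>x. avg ys (\<lambda>y. \<phi> x y)) = avg ys (\<lambda>y. avg xs (\<lambda>x. \<phi> x y))"
proof -
  have "(\<Sum>x\<leftarrow>xs. avg ys (\<lambda>y. \<phi> x y)) = avg ys (\<lambda>y. \<Sum>x\<leftarrow>xs. \<phi> x y)"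
    by (induction xs) (auto simp: avg_add avg_def)
  also have "\<dots> /\<^sub>R real (length xs) = avg ys (\<lambda>y. avg xs (\<lambda>x. \<phi> x y))"
    unfolding avg_def[of xs] by (rule avg_linear) (auto intro!: linearI simp: algebra_simps)
  finally show ?thesis by (simp add: avg_def[of xs])
qed

lemma avg_mono:
  "(\<And>x. x \<in> set xs \<Longrightarrow> \<phi> x \<le> (\<psi> x :: real)) \<Longrightarrow> avg xs \<phi> \<le> avg xs \<psi>"
  by (auto simp: avg_def intro!: mult_left_mono sum_list_mono)

lemma avg_nonneg: "(\<And>x. x \<in> set xs \<Longrightarrow> 0 \<le> (\<phi> x :: real)) \<Longrightarrow> 0 \<le> avg xs \<phi>"
  by (auto simp: avg_def intro!: mult_nonneg_nonneg sum_list_nonneg)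

lemma avg_le_const: "xs \<noteq> [] \<Longrightarrow> (\<And>x. x \<in> set xs \<Longrightarrow> \<phi> x \<le> (c :: real)) \<Longrightarrow> avg xs \<phi> \<le> c"
  using avg_mono[of xs \<phi> "\<lambda>_. c"] by simp

lemma norm_avg_le: "norm (avg xs \<phi>) \<le> avg xs (\<lambda>x. norm (\<phi> x :: 'b::real_normed_vector))"
proof -
  have "norm (\<Sum>x\<leftarrow>xs. \<phi> x) \<le> (\<Sum>x\<leftarrow>xs. norm (\<phi> x))"
    by (induction xs) (auto intro: order_trans[OF norm_triangle_ineq])
  then show ?thesis by (auto simp: avg_def intro!: mult_left_mono)
qed

lemma norm_avg_le_const:
  "(\<And>x. norm (\<phi> x :: 'b::real_normed_vector) \<le> c) \<Longrightarrow> 0 \<le> c \<Longrightarrow> norm (avg xs \<phi>) \<le> c"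
  by (cases "xs = []") (auto simp: avg_def[of "[]"] intro: order_trans[OF norm_avg_le] avg_le_const)

lemma power2_norm_avg_le:
  "(norm (avg xs \<phi>))\<^sup>2 \<le> avg xs (\<lambda>x. (norm (\<phi> x :: 'b::real_normed_vector))\<^sup>2)"
proof (cases "xs = []")
  case False
  define a where "a = avg xs (\<lambda>x. norm (\<phi> x))"
  have "0 \<le> avg xs (\<lambda>x. (norm (\<phi> x) - a)\<^sup>2)" by (rule avg_nonneg) simp
  also have "\<dots> = avg xs (\<lambda>x. (norm (\<phi> x))\<^sup>2) - 2 * a * a + a\<^sup>2"
    using False
    by (simp add: power2_diff avg_add avg_diff avg_mult_left avg_mult_right a_def)
  finally have "a\<^sup>2 \<le> avg xs (\<lambda>x. (norm (\<phi> x))\<^sup>2)" by (simp add: power2_eq_square)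
  moreover have "(norm (avg xs \<phi>))\<^sup>2 \<le> a\<^sup>2"
    unfolding a_def by (intro power_mono norm_avg_le) auto
  ultimately show ?thesis by linarith
qed (simp add: avg_def)

lemma power2_avg_le: "(avg xs \<phi>)\<^sup>2 \<le> avg xs (\<lambda>x. (\<phi> x :: real)\<^sup>2)"
  using power2_norm_avg_le[of xs \<phi>] by simp

lemma avg_conv: "avg (conv xs ys) \<phi> = avg xs (\<lambda>x. avg ys (\<lambda>y. \<phi> (x + y)))"
proof -
  have "(\<Sum>z\<leftarrow>conv xs ys. \<phi> z) = (\<Sum>x\<leftarrow>xs. \<Sum>y\<leftarrow>ys. \<phi> (x + y))"
    by (induction xs) (auto simp: conv_def o_def)
  moreover have "length (conv xs ys) = length xs * length ys"
    by (induction xs) (auto simp: conv_def)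
  moreover have "(\<Sum>x\<leftarrow>xs. avg ys (\<lambda>y. \<phi> (x + y))) = (\<Sum>x\<leftarrow>xs. \<Sum>y\<leftarrow>ys. \<phi> (x + y)) /\<^sub>R real (length ys)"
    unfolding avg_def by (induction xs) (auto simp: algebra_simps)
  ultimately show ?thesis by (simp add: avg_def[of "conv xs ys"] avg_def[of xs])
qed

lemma avg_map: "avg (map g xs) \<phi> = avg xs (\<lambda>x. \<phi> (g x))"
  by (simp add: avg_def o_def)

lemma avg_append:
  "length xs = length ys \<Longrightarrow> avg (xs @ ys) \<phi> = (1 / 2) *\<^sub>R (avg xs \<phi> + avg ys \<phi>)"
  by (simp add: avg_def algebra_simps)

definition bfun :: "('a \<Rightarrow> real) \<Rightarrow> bool" where
  "bfun \<phi> \<longleftrightarrow> (\<exists>B. \<forall>x. \<bar>\<phi> x\<bar> \<le> B)"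

lemma bfunI: "(\<And>x. \<bar>\<phi> x\<bar> \<le> B) \<Longrightarrow> bfun \<phi>"
  by (auto simp: bfun_def)

lemma bfun_const [intro, simp]: "bfun (\<lambda>_. c)"
  by (auto simp: bfun_def)

lemma bfun_add [intro]: assumes "bfun \<phi>" "bfun \<psi>" shows "bfun (\<lambda>x. \<phi> x + \<psi> x)"
proof -
  obtain B C where "\<And>x. \<bar>\<phi> x\<bar> \<le> B" "\<And>x. \<bar>\<psi> x\<bar> \<le> C" using assms by (auto simp: bfun_def)
  then show ?thesis by (intro bfunI[of _ "B + C"]) (meson abs_triangle_ineq add_mono order_trans)
qed

lemma bfun_mult [intro]: assumes "bfun \<phi>" "bfun \<psi>" shows "bfun (\<lambda>x. \<phi> x * \<psi> x)"
proof -
  obtain B C where B: "\<And>x. \<bar>\<phi> x\<bar> \<le> B" "\<And>x. \<bar>\<psi> x\<bar> \<le> C" using assms by (auto simp: bfun_def)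
  have "0 \<le> B" using B(1)[of undefined] by linarith
  then show ?thesis using B by (intro bfunI[of _ "B * C"]) (simp add: abs_mult mult_mono)
qed

lemma bfun_uminus [intro]: "bfun \<phi> \<Longrightarrow> bfun (\<lambda>x. - \<phi> x)"
  by (auto simp: bfun_def)

lemma bfun_abs [intro]: "bfun \<phi> \<Longrightarrow> bfun (\<lambda>x. \<bar>\<phi> x\<bar>)"
  by (auto simp: bfun_def)

lemma bfun_diff [intro]: "bfun \<phi> \<Longrightarrow> bfun \<psi> \<Longrightarrow> bfun (\<lambda>x. \<phi> x - \<psi> x)"
  using bfun_add[of \<phi> "\<lambda>x. - \<psi> x"] by auto

lemma bfun_comp: "bfun \<phi> \<Longrightarrow> bfun (\<lambda>x. \<phi> (g x))"
  by (auto simp: bfun_def)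

lemma bfun_power2 [intro]: "bfun \<phi> \<Longrightarrow> bfun (\<lambda>x. (\<phi> x)\<^sup>2)"
  unfolding power2_eq_square by (rule bfun_mult)

lemma bfun_divide [intro]: "bfun \<phi> \<Longrightarrow> bfun (\<lambda>x. \<phi> x / c)"
  using bfun_mult[of \<phi> "\<lambda>_. inverse c"] by (simp add: field_simps)

lemma bfun_sum [intro]: "(\<And>i. i \<in> I \<Longrightarrow> bfun (\<phi> i)) \<Longrightarrow> bfun (\<lambda>x. \<Sum>i\<in>I. \<phi> i x)"
  by (induction I rule: infinite_finite_induct) auto

lemma bfun_prod [intro]: "(\<And>i. i \<in> I \<Longrightarrow> bfun (\<phi> i)) \<Longrightarrow> bfun (\<lambda>x. \<Prod>i\<in>I. \<phi> i x)"
  by (induction I rule: infinite_finite_induct) auto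

lemma bfun_avg [intro]:
  assumes "\<And>y. bfun (\<phi> y)" shows "bfun (\<lambda>x. avg xs (\<lambda>y. \<phi> y x))"
proof -
  have "bfun (\<lambda>x. \<Sum>y\<leftarrow>xs. \<phi> y x)" by (induction xs) (auto intro: assms)
  then have "bfun (\<lambda>x. inverse (real (length xs)) * (\<Sum>y\<leftarrow>xs. \<phi> y x))" by (intro bfun_mult bfun_const)
  then show ?thesis by (simp add: avg_def)
qed

lemma bfun_max [intro]: assumes "bfun \<phi>" "bfun \<psi>" shows "bfun (\<lambda>x. max (\<phi> x) (\<psi> x))"
proof -
  have "max a b = (a + b + \<bar>a - b\<bar>) * (1/2)" for a b :: real by (simp add: max_def)
  moreover have "bfun (\<lambda>x. (\<phi> x + \<psi> x + \<bar>\<phi> x - \<psi> x\<bar>) * (1/2))"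
    by (intro bfun_mult bfun_diff bfun_add bfun_abs bfun_const assms)
  ultimately show ?thesis by (simp only:)
qed

lemma bfun_min [intro]: assumes "bfun \<phi>" "bfun \<psi>" shows "bfun (\<lambda>x. min (\<phi> x) (\<psi> x))"
proof -
  have "min a b = (a + b - \<bar>a - b\<bar>) * (1/2)" for a b :: real by (simp add: min_def)
  moreover have "bfun (\<lambda>x. (\<phi> x + \<psi> x - \<bar>\<phi> x - \<psi> x\<bar>) * (1/2))"
    by (intro bfun_mult bfun_diff bfun_add bfun_abs bfun_const assms)
  ultimately show ?thesis by (simp only:)
qed

subsection \<open>Extreme points\<close>

text \<open>A minimal closed face is a single point, because maximising any of the functionals in
  \<open>Ls\<close> cuts out a smaller face. Vector space structure enters only through the values of these
  functionals.\<close>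

lemma exists_extreme_point:
  fixes K :: "'b::topological_space set" and Ls :: "('b \<Rightarrow> real) set"
  assumes K: "compact K" and cont: "\<And>l. l \<in> Ls \<Longrightarrow> continuous_on UNIV l"
    and sep: "\<And>x y. x \<in> K \<Longrightarrow> y \<in> K \<Longrightarrow> (\<And>l. l \<in> Ls \<Longrightarrow> l x = l y) \<Longrightarrow> x = y"
    and K0: "K0 \<subseteq> K" "closed K0" "K0 \<noteq> {}"
    and face: "\<And>x y z t. x \<in> K0 \<Longrightarrow> y \<in> K \<Longrightarrow> z \<in> K \<Longrightarrow> 0 < t \<Longrightarrow> t < 1 \<Longrightarrow>
       (\<And>l. l \<in> Ls \<Longrightarrow> l x = t * l y + (1 - t) * l z) \<Longrightarrow> y \<in> K0 \<and> z \<in> K0"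
    and L: "L \<in> Ls"
  obtains x where "x \<in> K0" "\<And>y. y \<in> K0 \<Longrightarrow> L y \<le> L x"
    "\<And>y z t. y \<in> K \<Longrightarrow> z \<in> K \<Longrightarrow> 0 < t \<Longrightarrow> t < 1 \<Longrightarrow>
       (\<And>l. l \<in> Ls \<Longrightarrow> l x = t * l y + (1 - t) * l z) \<Longrightarrow> y = x"
proof -
  define isface where "isface E \<longleftrightarrow> E \<subseteq> K \<and> closed E \<and> E \<noteq> {} \<and>
    (\<forall>x y z t. x \<in> E \<longrightarrow> y \<in> K \<longrightarrow> z \<in> K \<longrightarrow> 0 < t \<longrightarrow> t < 1 \<longrightarrow>
       (\<forall>l\<in>Ls. l x = t * l y + (1 - t) * l z) \<longrightarrow> y \<in> E \<and> z \<in> E)" for E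
  have isfaceD: "E \<subseteq> K" "closed E" "E \<noteq> {}" if "isface E" for E
    using that unfolding isface_def by blast+
  define top where "top l E = {x \<in> E. \<forall>y\<in>E. l y \<le> l x}" for l :: "'b \<Rightarrow> real" and E
  have top_face: "isface (top l E)" if E: "isface E" and l: "l \<in> Ls" for l E
  proof -
    have cE: "compact E" using isfaceD(1,2)[OF E] K
      by (metis compact_Int_closed inf.absorb_iff2)
    have "continuous_on E l" by (rule continuous_on_subset[OF cont[OF l]]) simp
    then obtain x0 where x0: "x0 \<in> E" "\<And>y. y \<in> E \<Longrightarrow> l y \<le> l x0"
      using continuous_attains_sup[OF cE, of l] isfaceD(3)[OF E] by metis
    have eq: "top l E = E \<inter> {x. l x0 \<le> l x}" using x0 by (auto simp: top_def intro: order_trans)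
    have "closed (top l E)" unfolding eq using isfaceD(2)[OF E] cont[OF l]
      by (intro closed_Int closed_Collect_le) auto
    moreover have "y \<in> top l E \<and> z \<in> top l E"
      if "x \<in> top l E" "y \<in> K" "z \<in> K" "0 < t" "t < 1"
        "\<forall>l\<in>Ls. l x = t * l y + (1 - t) * l z" for x y z t
    proof -
      have yz: "y \<in> E" "z \<in> E" using E that unfolding isface_def top_def by blast+
      have a: "l y \<le> l x" "l z \<le> l x" using that(1) yz by (auto simp: top_def)
      have b: "l x = t * l y + (1 - t) * l z" using that l by auto
      have "0 \<le> t * (l x - l y)" "0 \<le> (1 - t) * (l x - l z)" using a that by auto
      moreover have "t * (l x - l y) + (1 - t) * (l x - l z) = 0" using b by (simp add: algebra_simps)
      ultimately have "t * (l x - l y) = 0" "(1 - t) * (l x - l z) = 0" by linarith+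
      then have "l y = l x" "l z = l x" using that by auto
      then show ?thesis using yz that(1) by (auto simp: top_def)
    qed
    ultimately show ?thesis using E x0 unfolding isface_def eq
      by (smt (verit, del_insts) IntI Int_iff empty_iff mem_Collect_eq order_refl subset_iff)
  qed
  \<comment> \<open>Starting the descent inside the face where \<open>L\<close> is maximal makes the
    final point a maximiser of \<open>L\<close>.\<close>
  define K1 where "K1 = top L K0"
  have "isface K0" using K0 face unfolding isface_def by metis
  then have K1: "isface K1" using top_face L by (simp add: K1_def)
  define \<F> where "\<F> = {E. isface E \<and> E \<subseteq> K1}"
  have "\<exists>m\<in>\<F>. \<forall>a\<in>\<F>. m \<supseteq> a \<longrightarrow> a = m"
  proof (rule predicate_Zorn)
    show "partial_order_on \<F> (relation_of (\<lambda>x y. y \<subseteq> x) \<F>)"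
      by (auto simp: partial_order_on_def preorder_on_def refl_on_def trans_def antisym_def relation_of_def)
    fix C assume C: "C \<in> Chains (relation_of (\<lambda>x y. y \<subseteq> x) \<F>)"
    show "\<exists>u\<in>\<F>. \<forall>a\<in>C. u \<subseteq> a"
    proof (cases "C = {}")
      case True
      then show ?thesis using K1 by (auto simp: \<F>_def)
    next
      case False
      have CF: "C \<subseteq> \<F>" using C by (auto simp: Chains_def relation_of_def)
      have chain: "X \<subseteq> Y \<or> Y \<subseteq> X" if "X \<in> C" "Y \<in> C" for X Y
        using C that by (auto simp: Chains_def relation_of_def)
      have "K \<inter> \<Inter>C \<noteq> {}"
      proof (rule compact_imp_fip[OF K])
        show "closed T" if "T \<in> C" for T using that CF isfaceD(2) by (auto simp: \<F>_def)
        fix F' assume F': "finite F'" "F' \<subseteq> C"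
        \<comment> \<open>A finite non-empty part of a chain has a least member, and that member is
          a non-empty face.\<close>
        have "F' = {} \<or> (\<exists>X\<in>F'. \<forall>Y\<in>F'. X \<subseteq> Y)" using F'
        proof (induction F' rule: finite_induct)
          case (insert X F)
          show ?case
          proof (cases "F = {}")
            case False
            then obtain Z where Z: "Z \<in> F" "\<forall>Y\<in>F. Z \<subseteq> Y" using insert by blast
            have "X \<subseteq> Z \<or> Z \<subseteq> X" using chain insert.prems Z(1) by blast
            then show ?thesis using Z by (metis insert_iff order_trans subset_refl)
          qed auto
        qed auto
        then show "K \<inter> \<Inter>F' \<noteq> {}"
        proof
          assume "F' = {}"
          then show ?thesis using K0 by auto
        next
          assume "\<exists>X\<in>F'. \<forall>Y\<in>F'. X \<subseteq> Y"
          then obtain X where X: "X \<in> F'" "\<forall>Y\<in>F'. X \<subseteq> Y" by blast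
          then have "isface X" using CF F' by (auto simp: \<F>_def)
          then have "X \<subseteq> K" "X \<noteq> {}" using isfaceD by auto
          moreover have "X \<subseteq> \<Inter>F'" using X by auto
          ultimately show ?thesis by blast
        qed
      qed
      moreover have "\<Inter>C \<subseteq> K1" using CF False by (auto simp: \<F>_def)
      moreover have "K1 \<subseteq> K" using isfaceD(1)[OF K1] .
      ultimately have ne: "\<Inter>C \<noteq> {}" by auto
      have "isface (\<Inter>C)" unfolding isface_def
      proof (intro conjI allI impI)
        show "\<Inter>C \<subseteq> K" using \<open>\<Inter>C \<subseteq> K1\<close> \<open>K1 \<subseteq> K\<close> by auto
        show "closed (\<Inter>C)" using CF isfaceD(2) by (intro closed_Inter) (auto simp: \<F>_def)
        show "\<Inter>C \<noteq> {}" by (fact ne)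
        fix x y z t
        assume h: "x \<in> \<Inter>C" "y \<in> K" "z \<in> K" "(0::real) < t" "t < 1"
          "\<forall>l\<in>Ls. l x = t * l y + (1 - t) * l z"
        have "y \<in> X \<and> z \<in> X" if "X \<in> C" for X
        proof -
          have "isface X" "x \<in> X" using that CF h by (auto simp: \<F>_def)
          then show ?thesis using h unfolding isface_def by blast
        qed
        then show "y \<in> \<Inter>C" "z \<in> \<Inter>C" by auto
      qed
      then show ?thesis using \<open>\<Inter>C \<subseteq> K1\<close> by (auto simp: \<F>_def intro!: bexI[of _ "\<Inter>C"])
    qed
  qed
  then obtain m where m: "m \<in> \<F>" "\<And>a. a \<in> \<F> \<Longrightarrow> a \<subseteq> m \<Longrightarrow> a = m" by blast
  then have mf: "isface m" "m \<subseteq> K1" by (auto simp: \<F>_def)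
  obtain x where x: "x \<in> m" using isfaceD(3)[OF mf(1)] by blast
  have const: "l y = l z" if "l \<in> Ls" "y \<in> m" "z \<in> m" for l y z
  proof -
    have "top l m \<in> \<F>" using top_face[OF mf(1) that(1)] mf(2) by (auto simp: \<F>_def top_def)
    then have "top l m = m" using m(2) by (auto simp: top_def)
    then have "y \<in> top l m" "z \<in> top l m" using that by auto
    then show ?thesis using that by (auto simp: top_def intro: antisym)
  qed
  show thesis
  proof
    show "x \<in> K0" using x mf(2) by (auto simp: K1_def top_def)
    show "L y \<le> L x" if "y \<in> K0" for y using x mf(2) that by (auto simp: K1_def top_def)
    fix y z t
    assume h: "y \<in> K" "z \<in> K" "(0::real) < t" "t < 1" "\<And>l. l \<in> Ls \<Longrightarrow> l x = t * l y + (1 - t) * l z"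
    then have "y \<in> m" using mf(1) x unfolding isface_def by blast
    moreover have "m \<subseteq> K" using isfaceD(1)[OF mf(1)] .
    ultimately show "y = x" using sep const x by (metis subsetD)
  qed
qed

text \<open>Stated for filters, because the product space of functionals is not metrizable and
  subsequences need not converge. The last two properties carry closed conditions and limits over to
  the cluster point.\<close>

lemma cluster_point:
  assumes "compact K" "F \<noteq> bot" "eventually (\<lambda>n. a n \<in> K) F"
  obtains x where "x \<in> K"
    "\<And>C. closed C \<Longrightarrow> eventually (\<lambda>n. a n \<in> C) F \<Longrightarrow> x \<in> C"
    "\<And>f c. continuous_on UNIV f \<Longrightarrow> ((\<lambda>n. f (a n)) \<longlongrightarrow> (c::'d::t2_space)) F \<Longrightarrow> f x = c"
proof -
  have nb: "filtermap a F \<noteq> bot" using assms(2) by (simp add: filtermap_bot_iff)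
  obtain x where x: "x \<in> K" "inf (nhds x) (filtermap a F) \<noteq> bot"
    using assms nb unfolding compact_filter by (auto simp: eventually_filtermap)
  show thesis
  proof
    show "x \<in> K" by fact
    show "x \<in> C" if C: "closed C" "eventually (\<lambda>n. a n \<in> C) F" for C
    proof (rule ccontr)
      assume "x \<notin> C"
      then have "eventually (\<lambda>y. y \<in> - C) (nhds x)" using C by (intro eventually_nhds_in_open) auto
      moreover have "eventually (\<lambda>y. y \<in> C) (filtermap a F)" using C by (simp add: eventually_filtermap)
      ultimately have "eventually (\<lambda>_. False) (inf (nhds x) (filtermap a F))"
        unfolding eventually_inf by force
      then show False using x(2) by (simp add: trivial_limit_def)
    qed
    show "f x = c" if f: "continuous_on UNIV f" "((\<lambda>n. f (a n)) \<longlongrightarrow> (c::'d))  F" for f and c :: 'd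
    proof -
      have "(f \<longlongrightarrow> f x) (nhds x)"
        using f(1) by (metis continuous_on_def tendsto_at_iff_tendsto_nhds UNIV_I)
      then have 1: "(f \<longlongrightarrow> f x) (inf (nhds x) (filtermap a F))"
        by (rule tendsto_mono[rotated]) simp
      have "(f \<longlongrightarrow> c) (filtermap a F)" using f(2) by (simp add: filterlim_filtermap)
      then have 2: "(f \<longlongrightarrow> c) (inf (nhds x) (filtermap a F))"
        by (rule tendsto_mono[rotated]) simp
      show ?thesis using tendsto_unique[OF x(2) 1 2] .
    qed
  qed
qed

text \<open>Tychonoff's theorem for the topology of pointwise convergence on the function
  type.\<close>

lemma compact_PiE_UNIV:
  fixes S :: "'i \<Rightarrow> 'b::topological_space set"
  assumes "\<And>i. compact (S i)" shows "compact {m. \<forall>i. m i \<in> S i}"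
proof -
  have "compactin (product_topology (\<lambda>_. euclidean) UNIV) (PiE UNIV S)"
    unfolding compactin_PiE using assms by simp
  then have "compact (PiE UNIV S)" by (simp add: euclidean_product_topology)
  moreover have "PiE UNIV S = {m. \<forall>i. m i \<in> S i}" by auto
  ultimately show ?thesis by (simp only:)
qed

section \<open>Elementary properties of characters\<close>

lemma character_norm [simp]: "character \<gamma> \<Longrightarrow> cmod (\<gamma> x) = 1"
  by (simp add: character_def)

lemma character_add: "character \<gamma> \<Longrightarrow> \<gamma> (x + y) = \<gamma> x * \<gamma> y"
  by (simp add: character_def)

lemma character_0 [simp]: "character \<gamma> \<Longrightarrow> \<gamma> 0 = 1"
  by (metis add_0 character_add character_norm mult_cancel_left1 norm_zero zero_neq_one)

lemma character_minus: assumes "character \<gamma>" shows "\<gamma> (- x) = cnj (\<gamma> x)"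
proof -
  have "\<gamma> x * \<gamma> (- x) = 1" using assms character_add[of \<gamma> x "- x"] by simp
  moreover have "\<gamma> x * cnj (\<gamma> x) = 1" using assms complex_norm_square[of "\<gamma> x"] by simp
  moreover have "\<gamma> x \<noteq> 0" using assms by (metis character_norm norm_zero zero_neq_one)
  ultimately show ?thesis by (metis mult_left_cancel)
qed

lemma character_diff: "character \<gamma> \<Longrightarrow> \<gamma> (x - y) = \<gamma> x * cnj (\<gamma> y)"
  using character_add[of \<gamma> x "- y"] by (simp add: character_minus)

subsection \<open>Invariant means\<close>

text \<open>Fixing the value 0 on unbounded functions makes \<open>inv_means\<close> a closed subset of a product
  of compact intervals.\<close>

definition inv_means :: "(('a::ab_group_add \<Rightarrow> real) \<Rightarrow> real) set" where
  "inv_means = {m. (\<forall>\<phi>. \<not> bfun \<phi> \<longrightarrow> m \<phi> = 0) \<and>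
     (\<forall>\<phi> \<psi>. bfun \<phi> \<longrightarrow> bfun \<psi> \<longrightarrow> m (\<lambda>x. \<phi> x + \<psi> x) = m \<phi> + m \<psi>) \<and>
     (\<forall>c \<phi>. bfun \<phi> \<longrightarrow> m (\<lambda>x. c * \<phi> x) = c * m \<phi>) \<and>
     (\<forall>\<phi>. bfun \<phi> \<longrightarrow> (\<forall>x. 0 \<le> \<phi> x) \<longrightarrow> 0 \<le> m \<phi>) \<and>
     m (\<lambda>_. 1) = 1 \<and>
     (\<forall>g \<phi>. bfun \<phi> \<longrightarrow> m (\<lambda>x. \<phi> (x + g)) = m \<phi>)}"

locale mean =
  fixes m :: "('a::ab_group_add \<Rightarrow> real) \<Rightarrow> real"
  assumes m_inv: "m \<in> inv_means"
begin

lemma m_unbounded: "\<not> bfun \<phi> \<Longrightarrow> m \<phi> = 0"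
  and m_add: "bfun \<phi> \<Longrightarrow> bfun \<psi> \<Longrightarrow> m (\<lambda>x. \<phi> x + \<psi> x) = m \<phi> + m \<psi>"
  and m_cmult: "bfun \<phi> \<Longrightarrow> m (\<lambda>x. c * \<phi> x) = c * m \<phi>"
  and m_nonneg: "bfun \<phi> \<Longrightarrow> (\<And>x. 0 \<le> \<phi> x) \<Longrightarrow> 0 \<le> m \<phi>"
  and m_one: "m (\<lambda>_. 1) = 1"
  and m_shift: "bfun \<phi> \<Longrightarrow> m (\<lambda>x. \<phi> (x + g)) = m \<phi>"
  using m_inv unfolding inv_means_def mem_Collect_eq by (elim conjE; metis)+

lemma m_const [simp]: "m (\<lambda>_. c) = c"
  using m_cmult[of "\<lambda>_. 1" c] m_one by simp

lemma m_uminus: "bfun \<phi> \<Longrightarrow> m (\<lambda>x. - \<phi> x) = - m \<phi>"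
  using m_cmult[of \<phi> "-1"] by simp

lemma m_diff: "bfun \<phi> \<Longrightarrow> bfun \<psi> \<Longrightarrow> m (\<lambda>x. \<phi> x - \<psi> x) = m \<phi> - m \<psi>"
  using m_add[of \<phi> "\<lambda>x. - \<psi> x"] m_uminus[of \<psi>] bfun_uminus by force

lemma m_mono: "bfun \<phi> \<Longrightarrow> bfun \<psi> \<Longrightarrow> (\<And>x. \<phi> x \<le> \<psi> x) \<Longrightarrow> m \<phi> \<le> m \<psi>"
  using m_nonneg[of "\<lambda>x. \<psi> x - \<phi> x"] m_diff[of \<psi> \<phi>] by (simp add: bfun_diff)

lemma m_le_const: "bfun \<phi> \<Longrightarrow> (\<And>x. \<phi> x \<le> c) \<Longrightarrow> m \<phi> \<le> c"
  using m_mono[of \<phi> "\<lambda>_. c"] by simp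

lemma m_ge_const: "bfun \<phi> \<Longrightarrow> (\<And>x. c \<le> \<phi> x) \<Longrightarrow> c \<le> m \<phi>"
  using m_mono[of "\<lambda>_. c" \<phi>] by simp

lemma m_abs_le: assumes "\<And>x. \<bar>\<phi> x\<bar> \<le> c" shows "\<bar>m \<phi>\<bar> \<le> c"
proof -
  have b: "bfun \<phi>" using assms by (rule bfunI)
  have ab: "\<phi> x \<le> c" "- c \<le> \<phi> x" for x using assms[of x] by linarith+
  show ?thesis using m_le_const[OF b ab(1)] m_ge_const[OF b ab(2)] by linarith
qed

lemma m_sum: "(\<And>i. i \<in> I \<Longrightarrow> bfun (\<phi> i)) \<Longrightarrow> m (\<lambda>x. \<Sum>i\<in>I. \<phi> i x) = (\<Sum>i\<in>I. m (\<phi> i))"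
  by (induction I rule: infinite_finite_induct) (auto simp: m_add bfun_sum)

lemma m_avg:
  assumes "\<And>y. bfun (\<phi> y)"
  shows "m (\<lambda>x. avg ys (\<lambda>y. \<phi> y x)) = avg ys (\<lambda>y. m (\<phi> y))"
proof -
  have b: "bfun (\<lambda>x. \<Sum>y\<leftarrow>ys. \<phi> y x)" for ys by (induction ys) (auto simp: assms)
  have "m (\<lambda>x. \<Sum>y\<leftarrow>ys. \<phi> y x) = (\<Sum>y\<leftarrow>ys. m (\<phi> y))"
    by (induction ys) (auto simp: m_add assms b)
  then show ?thesis unfolding avg_def using m_cmult[OF b[of ys], of "inverse (real (length ys))"] by simp
qed

lemma bfun_m:
  assumes "\<And>y x. \<bar>\<phi> y x\<bar> \<le> c" shows "bfun (\<lambda>y. m (\<phi> y))"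
  by (rule bfunI[of _ c]) (rule m_abs_le, rule assms)

lemma Cauchy_Schwarz_power2:
  assumes "bfun \<phi>" "bfun \<psi>"
  shows "(m (\<lambda>x. \<phi> x * \<psi> x))\<^sup>2 \<le> m (\<lambda>x. (\<phi> x)\<^sup>2) * m (\<lambda>x. (\<psi> x)\<^sup>2)"
proof -
  define a b c where "a = m (\<lambda>x. (\<phi> x)\<^sup>2)" and "b = m (\<lambda>x. \<phi> x * \<psi> x)" and "c = m (\<lambda>x. (\<psi> x)\<^sup>2)"
  have pos: "0 \<le> a * t\<^sup>2 + 2 * b * t + c" for t
  proof -
    have "0 \<le> m (\<lambda>x. (t * \<phi> x + \<psi> x)\<^sup>2)"
      by (intro m_nonneg bfun_power2 bfun_add bfun_mult bfun_const assms) simp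
    also have "(\<lambda>x. (t * \<phi> x + \<psi> x)\<^sup>2) = (\<lambda>x. t\<^sup>2 * (\<phi> x)\<^sup>2 + (2 * t) * (\<phi> x * \<psi> x) + (\<psi> x)\<^sup>2)"
      by (auto simp: fun_eq_iff power2_eq_square algebra_simps)
    also have "m \<dots> = t\<^sup>2 * a + 2 * t * b + c"
      unfolding a_def b_def c_def
      by (subst m_add m_cmult, (intro bfun_power2 bfun_add bfun_mult bfun_const assms)+)+ simp
    finally show ?thesis by (simp add: algebra_simps)
  qed
  have "0 \<le> a" unfolding a_def by (intro m_nonneg bfun_power2 assms) simp
  have "b\<^sup>2 \<le> a * c"
  proof (cases "a = 0")
    case True
    have "b = 0"
    proof (rule ccontr)
      assume "b \<noteq> 0"
      \<comment> \<open>With \<open>a = 0\<close> the quadratic is affine in \<open>t\<close>, and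
        this \<open>t\<close> gives it the value -1.\<close>
      then show False using pos[of "- (c + 1) / (2 * b)"] True by (simp add: field_simps)
    qed
    then show ?thesis using True by simp
  next
    case False
    then have "a > 0" using \<open>0 \<le> a\<close> by simp
    have "0 \<le> a * (a * (- b / a)\<^sup>2 + 2 * b * (- b / a) + c)" using pos \<open>0 \<le> a\<close> by (intro mult_nonneg_nonneg)
    also have "\<dots> = a * c - b\<^sup>2" using False by (simp add: field_simps power2_eq_square)
    finally show ?thesis by simp
  qed
  then show ?thesis by (simp add: a_def b_def c_def)
qed

definition nrm :: "('a \<Rightarrow> real) \<Rightarrow> real" where "nrm \<phi> = sqrt (m (\<lambda>x. (\<phi> x)\<^sup>2))"

lemma power2_nrm: "bfun \<phi> \<Longrightarrow> (nrm \<phi>)\<^sup>2 = m (\<lambda>x. (\<phi> x)\<^sup>2)"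
  unfolding nrm_def by (intro real_sqrt_pow2 m_nonneg bfun_power2) auto

lemma nrm_nonneg: "bfun \<phi> \<Longrightarrow> 0 \<le> nrm \<phi>"
  unfolding nrm_def by (intro real_sqrt_ge_zero m_nonneg bfun_power2) auto

lemma nrm_le_const: "0 \<le> c \<Longrightarrow> (\<And>x. \<bar>\<phi> x\<bar> \<le> c) \<Longrightarrow> nrm \<phi> \<le> c"
  unfolding nrm_def
  by (intro real_le_lsqrt m_le_const bfun_power2) (auto intro: bfunI simp: abs_le_square_iff[symmetric])

lemma Cauchy_Schwarz: assumes "bfun \<phi>" "bfun \<psi>" shows "\<bar>m (\<lambda>x. \<phi> x * \<psi> x)\<bar> \<le> nrm \<phi> * nrm \<psi>"
  using real_sqrt_le_mono[OF Cauchy_Schwarz_power2[OF assms]] by (simp add: nrm_def real_sqrt_mult)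

lemma abs_m_mult_le:
  assumes "bfun \<phi>" "\<And>x. \<bar>\<psi> x\<bar> \<le> 1"
  shows "\<bar>m (\<lambda>x. \<psi> x * \<phi> x)\<bar> \<le> nrm \<phi>"
proof -
  have b: "bfun \<psi>" by (rule bfunI[OF assms(2)])
  have "\<bar>m (\<lambda>x. \<psi> x * \<phi> x)\<bar> \<le> nrm \<psi> * nrm \<phi>" by (intro Cauchy_Schwarz b assms(1))
  also have "\<dots> \<le> 1 * nrm \<phi>" by (intro mult_right_mono nrm_le_const nrm_nonneg assms) simp
  finally show ?thesis by simp
qed

lemma power2_m_le: "bfun \<phi> \<Longrightarrow> (m \<phi>)\<^sup>2 \<le> m (\<lambda>x. (\<phi> x)\<^sup>2)"
  using Cauchy_Schwarz_power2[of "\<lambda>_. 1" \<phi>] by simp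

lemma nrm_triangle: assumes "bfun \<phi>" "bfun \<psi>" shows "nrm (\<lambda>x. \<phi> x + \<psi> x) \<le> nrm \<phi> + nrm \<psi>"
proof (rule power2_le_imp_le)
  have "(nrm (\<lambda>x. \<phi> x + \<psi> x))\<^sup>2 = m (\<lambda>x. (\<phi> x)\<^sup>2 + 2 * (\<phi> x * \<psi> x) + (\<psi> x)\<^sup>2)"
    by (subst power2_nrm) (auto intro: assms bfun_add simp: power2_sum algebra_simps)
  also have "\<dots> = (nrm \<phi>)\<^sup>2 + 2 * m (\<lambda>x. \<phi> x * \<psi> x) + (nrm \<psi>)\<^sup>2"
    using assms by (subst m_add m_cmult, (intro bfun_power2 bfun_add bfun_mult bfun_const assms)+)+
       (simp add: power2_nrm)
  also have "\<dots> \<le> (nrm \<phi> + nrm \<psi>)\<^sup>2"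
    using Cauchy_Schwarz[OF assms] by (simp add: power2_sum)
  finally show "(nrm (\<lambda>x. \<phi> x + \<psi> x))\<^sup>2 \<le> (nrm \<phi> + nrm \<psi>)\<^sup>2" .
  show "0 \<le> nrm \<phi> + nrm \<psi>" using assms nrm_nonneg by simp
qed

lemma nrm_shift: "bfun \<phi> \<Longrightarrow> nrm (\<lambda>x. \<phi> (x + u)) = nrm \<phi>"
  unfolding nrm_def using m_shift[of "\<lambda>x. (\<phi> x)\<^sup>2" u] bfun_power2[of \<phi>] by simp

lemma nrm_minus_commute: "nrm (\<lambda>x. \<phi> x - \<psi> x) = nrm (\<lambda>x. \<psi> x - \<phi> x)"
  unfolding nrm_def by (simp add: power2_commute)

lemma nrm_diff_triangle:
  assumes "bfun \<phi>" "bfun \<psi>" "bfun \<xi>"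
  shows "nrm (\<lambda>x. \<phi> x - \<xi> x) \<le> nrm (\<lambda>x. \<phi> x - \<psi> x) + nrm (\<lambda>x. \<psi> x - \<xi> x)"
  using nrm_triangle[of "\<lambda>x. \<phi> x - \<psi> x" "\<lambda>x. \<psi> x - \<xi> x"] assms by (simp add: bfun_diff)

lemma nrm_mono: "bfun \<phi> \<Longrightarrow> bfun \<psi> \<Longrightarrow> (\<And>x. \<bar>\<phi> x\<bar> \<le> \<bar>\<psi> x\<bar>) \<Longrightarrow> nrm \<phi> \<le> nrm \<psi>"
  unfolding nrm_def by (intro real_sqrt_le_mono m_mono bfun_power2) (auto simp: abs_le_square_iff)

section \<open>Averages twisted by a character and their energy\<close>

definition wavg :: "('a \<Rightarrow> complex) \<Rightarrow> ('a \<Rightarrow> real) \<Rightarrow> 'a list \<Rightarrow> 'a \<Rightarrow> complex" where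
  "wavg \<gamma> h xs z = avg xs (\<lambda>v. \<gamma> v * of_real (h (z + v)))"

text \<open>In a Hilbert space the infimum over all lists would be the squared norm of the
  projection of \<open>h\<close> to the functions with eigenvalue \<open>cnj (\<gamma> u)\<close>
  under translation by \<open>u\<close>.\<close>

definition energy :: "('a \<Rightarrow> complex) \<Rightarrow> ('a \<Rightarrow> real) \<Rightarrow> 'a list \<Rightarrow> real" where
  "energy \<gamma> h xs = m (\<lambda>z. (cmod (wavg \<gamma> h xs z))\<^sup>2)"

context
  fixes \<gamma> :: "'a \<Rightarrow> complex" and h :: "'a \<Rightarrow> real"
  assumes \<gamma>: "character \<gamma>" and h: "\<And>z. \<bar>h z\<bar> \<le> 1"
begin

lemma cmod_wavg_le: "cmod (wavg \<gamma> h xs z) \<le> 1"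
  unfolding wavg_def by (rule norm_avg_le_const) (auto simp: norm_mult \<gamma> h)

lemma wavg_shift: "wavg \<gamma> h (map (\<lambda>v. v + u) xs) z = \<gamma> u * wavg \<gamma> h xs (z + u)"
proof -
  have "wavg \<gamma> h (map (\<lambda>v. v + u) xs) z = avg xs (\<lambda>v. \<gamma> u * (\<gamma> v * of_real (h (z + u + v))))"
    unfolding wavg_def avg_map by (simp add: character_add[OF \<gamma>] algebra_simps)
  then show ?thesis by (simp add: avg_mult_left wavg_def)
qed

lemma bfun_cmod2:
  fixes f :: "'b \<Rightarrow> complex"
  assumes "\<And>z. cmod (f z) \<le> B" shows "bfun (\<lambda>z. (cmod (f z))\<^sup>2)"
  using assms by (intro bfun_power2 bfunI[of _ B]) auto

lemma bfun_energy: "bfun (\<lambda>z. (cmod (wavg \<gamma> h xs z))\<^sup>2)"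
  by (rule bfun_cmod2[OF cmod_wavg_le])

lemma energy_shift: "energy \<gamma> h (map (\<lambda>v. v + u) xs) = energy \<gamma> h xs"
proof -
  have "energy \<gamma> h (map (\<lambda>v. v + u) xs) = m (\<lambda>z. (cmod (wavg \<gamma> h xs (z + u)))\<^sup>2)"
    unfolding energy_def wavg_shift by (simp add: norm_mult \<gamma>)
  also have "\<dots> = energy \<gamma> h xs" unfolding energy_def by (rule m_shift[OF bfun_energy])
  finally show ?thesis .
qed

text \<open>Parallelogram law: the midpoint of two averages is the average over a mixed list, so its
  energy is at least \<open>I\<close>. Almost minimisers are therefore close to each other.\<close>

lemma energy_mix:
  assumes I: "\<And>zs. zs \<noteq> [] \<Longrightarrow> I \<le> energy \<gamma> h zs"
    and ne: "xs \<noteq> []" "ys \<noteq> []" and le: "energy \<gamma> h xs \<le> I + \<kappa>" "energy \<gamma> h ys \<le> I + \<kappa>"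
  shows "m (\<lambda>z. (cmod (wavg \<gamma> h xs z - wavg \<gamma> h ys z))\<^sup>2) \<le> 4 * \<kappa>"
proof -
  have sl: "(\<Sum>x\<leftarrow>concat (replicate n xs). \<phi> x) = of_nat n * (\<Sum>x\<leftarrow>xs. \<phi> x)" 
    and ll: "length (concat (replicate n xs)) = n * length xs"
    for n and xs :: "'a list" and \<phi> :: "'a \<Rightarrow> complex"
    by (induction n) (auto simp: algebra_simps)
  have ar: "avg (concat (replicate n xs)) \<phi> = avg xs \<phi>" if "n > 0"
    for n and xs :: "'a list" and \<phi> :: "'a \<Rightarrow> complex"
    unfolding avg_def sl ll using that by (simp add: scaleR_conv_of_real field_simps)
  \<comment> \<open>Repeating each list as often as the other is long gives the two equal
    weight.\<close>
  define zs where "zs = concat (replicate (length ys) xs) @ concat (replicate (length xs) ys)"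
  have zs: "zs \<noteq> []" using ne by (auto simp: zs_def neq_Nil_conv)
  have w: "wavg \<gamma> h zs z = (wavg \<gamma> h xs z + wavg \<gamma> h ys z) / 2" for z
    unfolding wavg_def zs_def
    by (subst avg_append) (use ne in \<open>simp_all add: ll ar scaleR_conv_of_real\<close>)
  let ?a = "wavg \<gamma> h xs" and ?b = "wavg \<gamma> h ys"
  have par: "(cmod (?a z - ?b z))\<^sup>2 = 2 * (cmod (?a z))\<^sup>2 + 2 * (cmod (?b z))\<^sup>2 + (- 4) * (cmod (wavg \<gamma> h zs z))\<^sup>2" for z
  proof -
    have "(cmod (?a z - ?b z))\<^sup>2 + (cmod (?a z + ?b z))\<^sup>2 = 2 * (cmod (?a z))\<^sup>2 + 2 * (cmod (?b z))\<^sup>2"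
      by (simp only: cmod_power2) (simp add: power2_eq_square algebra_simps)
    then show ?thesis by (simp add: w norm_divide power_divide)
  qed
  have "m (\<lambda>z. (cmod (?a z - ?b z))\<^sup>2) = 2 * energy \<gamma> h xs + 2 * energy \<gamma> h ys + (- 4) * energy \<gamma> h zs"
    unfolding par energy_def
    by (subst m_add m_cmult, (intro bfun_add bfun_mult bfun_const bfun_energy)+)+ simp
  then show ?thesis using I[OF zs] le by linarith
qed

text \<open>Averages of almost minimal energy are almost eigenfunctions for the character
  \<open>cnj \<circ> \<gamma>\<close>, uniformly in the translation. This replaces the projection onto an
  eigenspace, which need not exist because bounded functions are not complete in the seminorm of the mean.\<close>

lemma near_minimal_shift:
  assumes I: "\<And>zs. zs \<noteq> [] \<Longrightarrow> I \<le> energy \<gamma> h zs"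
    and ne: "xs \<noteq> []" and le: "energy \<gamma> h xs \<le> I + \<kappa>"
  shows "m (\<lambda>z. (cmod (\<gamma> u * wavg \<gamma> h xs (z + u) - wavg \<gamma> h xs z))\<^sup>2) \<le> 4 * \<kappa>"
  using energy_mix[OF I, of "map (\<lambda>v. v + u) xs" xs \<kappa>] ne le
  by (simp add: wavg_shift energy_shift)

text \<open>For a true projection the inner product with \<open>h\<close> is the squared norm. Here
  each translation in the average is moved from \<open>h\<close> to the almost eigenfunction, at a
  cost of at most \<open>2 * sqrt \<kappa>\<close>.\<close>

lemma near_minimal_corr:
  assumes I: "\<And>zs. zs \<noteq> [] \<Longrightarrow> I \<le> energy \<gamma> h zs"
    and ne: "xs \<noteq> []" and le: "energy \<gamma> h xs \<le> I + \<kappa>"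
  shows "energy \<gamma> h xs - 2 * sqrt \<kappa> \<le> m (\<lambda>z. h z * Re (wavg \<gamma> h xs z))"
proof -
  let ?a = "wavg \<gamma> h xs"
  have bh: "bfun h" by (rule bfunI[OF h])
  have bR: "bfun (\<lambda>z. Re (\<gamma> v * cnj (?a (g z))))" for v g
  proof (rule bfunI[of _ 1])
    show "\<bar>Re (\<gamma> v * cnj (?a (g z)))\<bar> \<le> 1" for z
      using abs_Re_le_cmod[of "\<gamma> v * cnj (?a (g z))"] cmod_wavg_le[of xs "g z"] by (simp add: norm_mult \<gamma>)
  qed
  have "energy \<gamma> h xs = m (\<lambda>z. avg xs (\<lambda>v. h (z + v) * Re (\<gamma> v * cnj (?a z))))"
  proof -
    have "(cmod (?a z))\<^sup>2 = avg xs (\<lambda>v. h (z + v) * Re (\<gamma> v * cnj (?a z)))" for z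
    proof -
      have "(cmod (?a z))\<^sup>2 = Re (?a z * cnj (?a z))" by (simp add: complex_mult_cnj cmod_power2)
      also have "?a z * cnj (?a z) = avg xs (\<lambda>v. \<gamma> v * of_real (h (z + v)) * cnj (?a z))"
        by (simp add: wavg_def avg_mult_right)
      also have "Re \<dots> = avg xs (\<lambda>v. Re (\<gamma> v * of_real (h (z + v)) * cnj (?a z)))"
        by (rule avg_linear) (simp add: bounded_linear.linear bounded_linear_Re)
      also have "\<dots> = avg xs (\<lambda>v. h (z + v) * Re (\<gamma> v * cnj (?a z)))"
        by (rule avg_cong) (simp add: algebra_simps)
      finally show ?thesis .
    qed
    then show ?thesis by (simp add: energy_def)
  qed
  also have "\<dots> = avg xs (\<lambda>v. m (\<lambda>z. h (z + v) * Re (\<gamma> v * cnj (?a z))))"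
    by (rule m_avg) (intro bfun_mult bfun_comp[OF bh] bR)
  also have "\<dots> \<le> avg xs (\<lambda>v. m (\<lambda>z. h z * Re (?a z)) + 2 * sqrt \<kappa>)"
  proof (rule avg_mono)
    fix v
    have eq: "m (\<lambda>z. h (z + v) * Re (\<gamma> v * cnj (?a z))) = m (\<lambda>z. h z * Re (\<gamma> v * cnj (?a (z - v))))"
    proof -
      have "bfun (\<lambda>z. h z * Re (\<gamma> v * cnj (?a (z - v))))" by (intro bfun_mult bh bR)
      from m_shift[OF this, of v] show ?thesis by simp
    qed
    let ?d = "\<lambda>z. \<gamma> (- v) * ?a (z + - v) - ?a z"
    have Re_d: "Re (\<gamma> v * cnj (?a (z - v))) - Re (?a z) = Re (?d z)" for z
      by (simp add: character_minus[OF \<gamma>])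
    have bd: "cmod (?d z) \<le> 2" for z
      using norm_triangle_ineq4[of "\<gamma> (- v) * ?a (z + - v)" "?a z"]
        cmod_wavg_le[of xs z] cmod_wavg_le[of xs "z + - v"] by (simp add: norm_mult \<gamma>)
    have bRd: "bfun (\<lambda>z. Re (?d z))"
      by (rule bfunI[of _ 2]) (use bd abs_Re_le_cmod order_trans in blast)
    have bRa: "bfun (\<lambda>z. Re (?a z))"
      by (rule bfunI[of _ 1]) (use cmod_wavg_le abs_Re_le_cmod order_trans in blast)
    have "m (\<lambda>z. h z * Re (\<gamma> v * cnj (?a (z - v)))) - m (\<lambda>z. h z * Re (?a z)) = m (\<lambda>z. h z * Re (?d z))"
      unfolding Re_d[symmetric] right_diff_distrib
      by (rule m_diff[symmetric]) (intro bfun_mult bh bR bRa)+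
    also have "\<dots> \<le> nrm (\<lambda>z. Re (?d z))" by (rule order_trans[OF abs_ge_self abs_m_mult_le[OF bRd h]])
    also have "\<dots> \<le> sqrt (4 * \<kappa>)" unfolding nrm_def
    proof (intro real_sqrt_le_mono)
      have "m (\<lambda>z. (Re (?d z))\<^sup>2) \<le> m (\<lambda>z. (cmod (?d z))\<^sup>2)"
        by (intro m_mono bfun_power2 bRd bfun_cmod2[OF bd]) (simp add: cmod_power2)
      also have "\<dots> \<le> 4 * \<kappa>" by (rule near_minimal_shift[OF I ne le])
      finally show "m (\<lambda>z. (Re (?d z))\<^sup>2) \<le> 4 * \<kappa>" .
    qed
    also have "\<dots> = 2 * sqrt \<kappa>" by (simp add: real_sqrt_mult)
    finally show "m (\<lambda>z. h (z + v) * Re (\<gamma> v * cnj (?a z))) \<le> m (\<lambda>z. h z * Re (?a z)) + 2 * sqrt \<kappa>"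
      unfolding eq by simp
  qed
  also have "\<dots> = m (\<lambda>z. h z * Re (?a z)) + 2 * sqrt \<kappa>" using ne by simp
  finally show ?thesis by simp
qed

end

end

section \<open>Compactness of the set of invariant means and choice of an extreme one\<close>

lemma closed_Collect_imp_const: "(P \<Longrightarrow> closed {x. Q x}) \<Longrightarrow> closed {x. P \<longrightarrow> Q x}"
  by (cases P) auto

text \<open>A compact set that also contains the averages over finite sets, which need not be
  invariant; the cluster point is formed in it.\<close>

definition mean_box :: "(('a \<Rightarrow> real) \<Rightarrow> real) set" where
  "mean_box = {m. \<forall>\<phi>. m \<phi> \<in> (if bfun \<phi> then {- (SUP x. \<bar>\<phi> x\<bar>)..(SUP x. \<bar>\<phi> x\<bar>)} else {0})}"

lemma compact_mean_box: "compact mean_box"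
  unfolding mean_box_def by (rule compact_PiE_UNIV) auto

lemma bfun_abs_le_SUP: "bfun \<phi> \<Longrightarrow> \<bar>\<phi> x\<bar> \<le> (SUP x. \<bar>\<phi> x\<bar>)"
  by (rule cSUP_upper) (auto simp: bfun_def)

lemma inv_means_subset_box: "inv_means \<subseteq> mean_box"
proof
  fix m :: "('a \<Rightarrow> real) \<Rightarrow> real" assume "m \<in> inv_means"
  then interpret mean m by unfold_locales
  have "\<bar>m \<phi>\<bar> \<le> (SUP x. \<bar>\<phi> x\<bar>)" if "bfun \<phi>" for \<phi>
    by (rule m_abs_le) (rule bfun_abs_le_SUP[OF that])
  then show "m \<in> mean_box" unfolding mean_box_def using m_unbounded by (auto simp: abs_le_iff minus_le_iff)
qed

lemma closed_inv_means: "closed inv_means"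
  unfolding inv_means_def
  by (intro closed_Collect_conj closed_Collect_all closed_Collect_imp_const closed_Collect_eq closed_Collect_le
      continuous_on_add continuous_on_mult continuous_on_const continuous_on_product_coordinates)

lemma compact_inv_means: "compact (inv_means :: (('a::ab_group_add \<Rightarrow> real) \<Rightarrow> real) set)"
proof -
  have "compact (mean_box \<inter> (inv_means :: (('a \<Rightarrow> real) \<Rightarrow> real) set))"
    by (rule compact_Int_closed[OF compact_mean_box closed_inv_means])
  moreover have "mean_box \<inter> inv_means = (inv_means :: (('a \<Rightarrow> real) \<Rightarrow> real) set)"
    using inv_means_subset_box by blast
  ultimately show ?thesis by simp
qed

definition set_mean :: "'a set \<Rightarrow> ('a \<Rightarrow> real) \<Rightarrow> real" where
  "set_mean S \<phi> = (if bfun \<phi> then (\<Sum>x\<in>S. \<phi> x) / card S else 0)"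

lemma set_mean_in_box: "set_mean S \<in> mean_box"
proof -
  have "\<bar>(\<Sum>x\<in>S. \<phi> x) / card S\<bar> \<le> (SUP x. \<bar>\<phi> x\<bar>)" if b: "bfun \<phi>" for \<phi> :: "'a \<Rightarrow> real"
  proof -
    define B where "B = (SUP x. \<bar>\<phi> x\<bar>)"
    have B: "\<bar>\<phi> x\<bar> \<le> B" for x unfolding B_def by (rule bfun_abs_le_SUP[OF b])
    then have "0 \<le> B" by (meson abs_ge_zero order_trans)
    have "\<bar>\<Sum>x\<in>S. \<phi> x\<bar> \<le> (\<Sum>x\<in>S. B)" by (rule order_trans[OF sum_abs sum_mono]) (rule B)
    then have "\<bar>\<Sum>x\<in>S. \<phi> x\<bar> \<le> B * card S" by (simp add: mult.commute)
    then show ?thesis unfolding B_def[symmetric] using \<open>0 \<le> B\<close>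
      by (cases "card S = 0") (auto simp: divide_le_eq)
  qed
  then have "(\<Sum>x\<in>S. \<phi> x) / card S \<in> {- (SUP x. \<bar>\<phi> x\<bar>)..(SUP x. \<bar>\<phi> x\<bar>)}" if "bfun \<phi>" for \<phi> :: "'a \<Rightarrow> real"
    using that unfolding atLeastAtMost_iff abs_le_iff by (metis minus_le_iff)
  then show ?thesis unfolding mean_box_def set_mean_def by simp
qed

text \<open>After reindexing, the two sums differ only on the symmetric difference of
  \<open>S\<close> and its translate.\<close>

lemma set_mean_shift:
  fixes S :: "'a::ab_group_add set"
  assumes "finite S" "\<And>x. \<bar>\<phi> x\<bar> \<le> B"
  shows "\<bar>set_mean S (\<lambda>x. \<phi> (x + g)) - set_mean S \<phi>\<bar>
    \<le> B * (real (card (symdiff S ((\<lambda>x. g + x) ` S))) / real (card S))"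
proof -
  have b: "bfun \<phi>" using assms(2) by (rule bfunI)
  define T where "T = (\<lambda>x. g + x) ` S"
  have fT: "finite T" using assms by (simp add: T_def)
  have "(\<Sum>x\<in>S. \<phi> (x + g)) = sum \<phi> T"
    unfolding T_def by (subst sum.reindex) (auto simp: add.commute inj_on_def)
  moreover have "sum \<phi> T = sum \<phi> (T \<inter> S) + sum \<phi> (T - S)" by (rule sum.Int_Diff[OF fT])
  moreover have "sum \<phi> S = sum \<phi> (S \<inter> T) + sum \<phi> (S - T)" by (rule sum.Int_Diff[OF assms(1)])
  ultimately have eq: "(\<Sum>x\<in>S. \<phi> (x + g)) - sum \<phi> S = sum \<phi> (T - S) - sum \<phi> (S - T)"
    by (simp add: Int_commute)
  have le: "\<bar>sum \<phi> X\<bar> \<le> B * card X" for X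
  proof -
    have "\<bar>sum \<phi> X\<bar> \<le> (\<Sum>x\<in>X. B)" by (rule order_trans[OF sum_abs sum_mono]) (rule assms)
    then show ?thesis by (simp add: mult.commute)
  qed
  have "card (symdiff S T) = card (S - T) + card (T - S)"
    unfolding symdiff_def using assms fT by (intro card_Un_disjoint) auto
  then have "\<bar>(\<Sum>x\<in>S. \<phi> (x + g)) - sum \<phi> S\<bar> \<le> B * card (symdiff S T)"
    unfolding eq using le[of "T - S"] le[of "S - T"] by (simp add: algebra_simps)
  then have "\<bar>(\<Sum>x\<in>S. \<phi> (x + g)) - sum \<phi> S\<bar> / card S \<le> B * card (symdiff S T) / card S"
    by (rule divide_right_mono) simp
  then show ?thesis
    using bfun_comp[OF b, of "\<lambda>x. x + g"] b
    by (simp add: set_mean_def T_def diff_divide_distrib[symmetric])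
qed

lemma inv_mean_of_folner:
  fixes F :: "nat \<Rightarrow> 'a::ab_group_add set"
  assumes F: "folner F" and freq: "\<exists>\<^sub>F n in sequentially. \<rho> \<le> real (card (A \<inter> F n)) / real (card (F n))"
  obtains m where "m \<in> inv_means" "\<rho> \<le> m (\<lambda>x. of_bool (x \<in> A))"
proof -
  define N where "N = {n. \<rho> \<le> real (card (A \<inter> F n)) / real (card (F n))}"
  \<comment> \<open>Restricting to the indices of large density makes the bound hold eventually, so
    that it passes to the cluster point. The filter is proper because these indices occur
    frequently.\<close>
  define G where "G = inf sequentially (principal N)"
  have nb: "G \<noteq> bot"
    using freq by (simp add: G_def N_def trivial_limit_def eventually_inf_principal frequently_def)
  have fin: "finite (F n)" "F n \<noteq> {}" for n using F by (auto simp: folner_def)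
  obtain m where m: "m \<in> (mean_box :: (('a \<Rightarrow> real) \<Rightarrow> real) set)"
    and cl: "\<And>C. closed C \<Longrightarrow> eventually (\<lambda>n. set_mean (F n) \<in> C) G \<Longrightarrow> m \<in> C"
    and lim: "\<And>f c. continuous_on UNIV f \<Longrightarrow> ((\<lambda>n. f (set_mean (F n))) \<longlongrightarrow> (c::real)) G \<Longrightarrow> f m = c"
    by (rule cluster_point[OF compact_mean_box nb, of "\<lambda>n. set_mean (F n)"])
      (auto simp: set_mean_in_box)
  show thesis
  proof
    show "m \<in> inv_means" unfolding inv_means_def mem_Collect_eq
    proof (intro conjI allI impI)
      show "m \<phi> = 0" if "\<not> bfun \<phi>" for \<phi>
        using cl[of "{m. m \<phi> = 0}"] that
        by (simp add: set_mean_def closed_Collect_eq)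
      show "m (\<lambda>x. \<phi> x + \<psi> x) = m \<phi> + m \<psi>" if "bfun \<phi>" "bfun \<psi>" for \<phi> \<psi>
        using cl[of "{m. m (\<lambda>x. \<phi> x + \<psi> x) = m \<phi> + m \<psi>}"] that bfun_add[OF that]
        by (simp add: set_mean_def closed_Collect_eq continuous_on_add sum.distrib add_divide_distrib)
      show "m (\<lambda>x. c * \<phi> x) = c * m \<phi>" if "bfun \<phi>" for \<phi> c
        using cl[of "{m. m (\<lambda>x. c * \<phi> x) = c * m \<phi>}"] that bfun_mult[OF bfun_const that, of c]
        by (simp add: set_mean_def closed_Collect_eq continuous_on_mult sum_distrib_left)
      show "0 \<le> m \<phi>" if "bfun \<phi>" "\<forall>x. 0 \<le> \<phi> x" for \<phi>
        using cl[of "{m. 0 \<le> m \<phi>}"] that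
        by (simp add: set_mean_def closed_Collect_le sum_nonneg)
      show "m (\<lambda>_. 1) = 1"
        using cl[of "{m. m (\<lambda>_. 1) = 1}"] fin
        by (simp add: set_mean_def closed_Collect_eq)
      \<comment> \<open>The averages over \<open>F n\<close> are only nearly invariant, so this
        property is obtained from a limit instead of a closed condition.\<close>
      show "m (\<lambda>x. \<phi> (x + g)) = m \<phi>" if b: "bfun \<phi>" for g \<phi>
      proof -
        obtain B where B: "\<And>x. \<bar>\<phi> x\<bar> \<le> B" using b by (auto simp: bfun_def)
        have "(\<lambda>n. real (card (symdiff (F n) ((\<lambda>x. g + x) ` F n))) / real (card (F n))) \<longlonglongrightarrow> 0"
          using F by (simp add: folner_def)
        from tendsto_mult_left[OF this, of B]
        have "(\<lambda>n. B * (real (card (symdiff (F n) ((\<lambda>x. g + x) ` F n))) / real (card (F n)))) \<longlonglongrightarrow> 0"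
          by simp
        then have "(\<lambda>n. set_mean (F n) (\<lambda>x. \<phi> (x + g)) - set_mean (F n) \<phi>) \<longlonglongrightarrow> 0"
          by (rule Lim_null_comparison[rotated])
            (intro always_eventually allI, simp only: real_norm_def, rule set_mean_shift[OF fin(1) B])
        then have "((\<lambda>n. set_mean (F n) (\<lambda>x. \<phi> (x + g)) - set_mean (F n) \<phi>) \<longlongrightarrow> 0) G"
          unfolding G_def by (rule tendsto_mono[rotated]) simp
        then have "m (\<lambda>x. \<phi> (x + g)) - m \<phi> = 0"
          by (rule lim[rotated]) (intro continuous_on_diff continuous_on_product_coordinates)
        then show ?thesis by simp
      qed
    qed
    have "set_mean (F n) (\<lambda>x. of_bool (x \<in> A)) = real (card (A \<inter> F n)) / real (card (F n))" for n
    proof -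
      have "bfun (\<lambda>x. of_bool (x \<in> A))" by (rule bfunI[of _ 1]) auto
      moreover have "(\<Sum>x\<in>F n. of_bool (x \<in> A)) = real (card (A \<inter> F n))"
        using fin by (simp add: of_bool_def sum.If_cases Int_commute)
      ultimately show ?thesis by (simp add: set_mean_def)
    qed
    then have "eventually (\<lambda>n. set_mean (F n) \<in> {m. \<rho> \<le> m (\<lambda>x. of_bool (x \<in> A))}) G"
      by (simp add: G_def N_def eventually_inf_principal)
    then have "m \<in> {m. \<rho> \<le> m (\<lambda>x. of_bool (x \<in> A))}"
      by (rule cl[rotated]) (intro closed_Collect_le continuous_on_const continuous_on_product_coordinates)
    then show "\<rho> \<le> m (\<lambda>x. of_bool (x \<in> A))" by simp
  qed
qed

lemma extreme_inv_mean:
  fixes A :: "'a::ab_group_add set"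
  assumes "upper_banach_density A > 0"
  obtains m where "m \<in> inv_means" "0 < m (\<lambda>x. of_bool (x \<in> A))"
    "\<And>y z. y \<in> inv_means \<Longrightarrow> z \<in> inv_means \<Longrightarrow> (\<And>\<phi>. m \<phi> = (y \<phi> + z \<phi>) / 2) \<Longrightarrow> y = m"
proof -
  obtain F where F: "folner F" "0 < limsup (\<lambda>n. ereal (real (card (A \<inter> F n)) / real (card (F n))))"
    using assms unfolding upper_banach_density_def by (auto simp: less_SUP_iff)
  then obtain \<rho> where \<rho>: "0 < ereal \<rho>" "ereal \<rho> < limsup (\<lambda>n. ereal (real (card (A \<inter> F n)) / real (card (F n))))"
    using ereal_dense2 by blast
  have "\<exists>\<^sub>F n in sequentially. \<rho> \<le> real (card (A \<inter> F n)) / real (card (F n))"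
  proof (rule ccontr)
    assume "\<not> ?thesis"
    then have "\<forall>\<^sub>F n in sequentially. ereal (real (card (A \<inter> F n)) / real (card (F n))) \<le> ereal \<rho>"
      by (auto simp: not_frequently elim: eventually_mono)
    then have "limsup (\<lambda>n. ereal (real (card (A \<inter> F n)) / real (card (F n)))) \<le> ereal \<rho>"
      by (rule Limsup_bounded)
    then show False using \<rho>(2) by simp
  qed
  from inv_mean_of_folner[OF F(1) this] obtain m0
    where m0: "m0 \<in> inv_means" "\<rho> \<le> m0 (\<lambda>x. of_bool (x \<in> A))" .
  define ev where "ev = (\<lambda>\<phi> (m :: ('a \<Rightarrow> real) \<Rightarrow> real). m \<phi>)"
  obtain m where m: "m \<in> inv_means" "\<And>y. y \<in> inv_means \<Longrightarrow> ev (\<lambda>x. of_bool (x \<in> A)) y \<le> ev (\<lambda>x. of_bool (x \<in> A)) m"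
    and ext: "\<And>y z t. y \<in> inv_means \<Longrightarrow> z \<in> inv_means \<Longrightarrow> 0 < t \<Longrightarrow> t < 1 \<Longrightarrow>
       (\<And>l. l \<in> range ev \<Longrightarrow> l m = t * l y + (1 - t) * l z) \<Longrightarrow> y = m"
  \<comment> \<open>The face is the whole set of invariant means, so the face condition is trivial;
    the density of \<open>A\<close> enters as the functional to be maximised.\<close>
  proof (rule exists_extreme_point[OF compact_inv_means, of "range ev" inv_means "ev (\<lambda>x. of_bool (x \<in> A))"])
    show "continuous_on UNIV l" if "l \<in> range ev" for l using that by (auto simp: ev_def)
    show "x = y" if "\<And>l. l \<in> range ev \<Longrightarrow> l x = l y" for x y
      using that[OF rangeI] by (auto simp: ev_def)
  qed (use m0 closed_inv_means in auto)
  show thesis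
  proof
    show "m \<in> inv_means" by fact
    show "0 < m (\<lambda>x. of_bool (x \<in> A))" using m(2)[OF m0(1)] m0(2) \<rho> by (simp add: ev_def)
    show "y = m" if "y \<in> inv_means" "z \<in> inv_means" "\<And>\<phi>. m \<phi> = (y \<phi> + z \<phi>) / 2" for y z
    proof (rule ext[of y z "1/2"])
      show "l m = 1 / 2 * l y + (1 - 1 / 2) * l z" if "l \<in> range ev" for l
        using that by (auto simp: ev_def \<open>\<And>\<phi>. m \<phi> = (y \<phi> + z \<phi>) / 2\<close> add_divide_distrib)
    qed (use that in auto)
  qed
qed

section \<open>Extreme invariant means are ergodic\<close>

context mean
begin

lemma character_one: "character (\<lambda>_. 1)"
  by (simp add: character_def)

text \<open>If the averages of \<open>V\<close> stay away from 0, then \<open>L \<phi>\<close>, the limit of \<open>m (\<phi> * a n)\<close>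
  along averages \<open>a n\<close> of almost minimal energy, is a nonzero invariant functional, and \<open>m\<close> is the midpoint of
  the means \<open>m + L\<close> and \<open>m - L\<close>.\<close>

lemma ergodic_normalized:
  assumes ext: "\<And>y z. y \<in> inv_means \<Longrightarrow> z \<in> inv_means \<Longrightarrow> (\<And>\<phi>. m \<phi> = (y \<phi> + z \<phi>) / 2) \<Longrightarrow> y = m"
    and V: "\<And>x. \<bar>V x\<bar> \<le> 1" and mV: "m V = 0" and \<epsilon>: "\<epsilon> > 0"
  shows "\<exists>xs. xs \<noteq> [] \<and> m (\<lambda>z. (avg xs (\<lambda>x. V (z + x)))\<^sup>2) < \<epsilon>"
proof (rule ccontr)
  let ?a = "\<lambda>xs z. avg xs (\<lambda>x. V (z + x))"
  have bV: "bfun V" by (rule bfunI[OF V])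
  have w: "wavg (\<lambda>_. 1) V xs z = complex_of_real (?a xs z)" for xs z
    unfolding wavg_def by (subst avg_linear[where L = complex_of_real])
      (auto intro!: linearI simp: scaleR_conv_of_real)
  have E: "energy (\<lambda>_. 1) V xs = m (\<lambda>z. (?a xs z)\<^sup>2)" for xs
    unfolding energy_def w by simp
  assume "\<not> ?thesis"
  then have lb: "\<epsilon> \<le> energy (\<lambda>_. 1) V xs" if "xs \<noteq> []" for xs using that E by force
  define I where "I = Inf (energy (\<lambda>_. 1) V ` {xs. xs \<noteq> []})"
  have bdd: "bdd_below (energy (\<lambda>_. 1) V ` {xs. xs \<noteq> []})" using lb by (auto intro!: bdd_belowI2)
  have I: "I \<le> energy (\<lambda>_. 1) V xs" if "xs \<noteq> []" for xs
    unfolding I_def using that by (intro cInf_lower bdd) auto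
  have "\<epsilon> \<le> I" unfolding I_def by (rule cInf_greatest) (auto intro: lb)
  define \<kappa> where "\<kappa> n = inverse (real (Suc n))" for n
  have "\<exists>xs. xs \<noteq> [] \<and> energy (\<lambda>_. 1) V xs < I + \<kappa> n" for n
    using cInf_lessD[of "energy (\<lambda>_. 1) V ` {xs. xs \<noteq> []}" "I + \<kappa> n"]
    by (auto simp: I_def \<kappa>_def)
  then obtain X where X: "\<And>n. X n \<noteq> []" "\<And>n. energy (\<lambda>_. 1) V (X n) < I + \<kappa> n" by metis
  define a where "a n = ?a (X n)" for n
  have a_le: "\<bar>a n z\<bar> \<le> 1" for n z
    unfolding a_def using norm_avg_le_const[of "\<lambda>x. V (z + x)" 1 "X n"] V by simp
  have ba: "bfun (a n)" for n by (rule bfunI[OF a_le])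
  have \<kappa>_mono: "\<kappa> k \<le> \<kappa> n" if "n \<le> k" for n k using that by (simp add: \<kappa>_def field_simps)
  have \<kappa>_0: "\<kappa> \<longlonglongrightarrow> 0" unfolding \<kappa>_def by (rule LIMSEQ_inverse_real_of_nat)
  have bd: "bfun (\<lambda>z. a n z - a k z)" for n k by (intro bfun_diff ba)
  have near: "nrm (\<lambda>z. a n z - a k z) \<le> 2 * sqrt (\<kappa> N)" if "N \<le> n" "N \<le> k" for n k N
  proof -
    have "m (\<lambda>z. (cmod (wavg (\<lambda>_. 1) V (X n) z - wavg (\<lambda>_. 1) V (X k) z))\<^sup>2) \<le> 4 * \<kappa> N"
      by (rule energy_mix[OF character_one V I])
        (use X[of n] X[of k] \<kappa>_mono[OF that(1)] \<kappa>_mono[OF that(2)] in auto)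
    then have "m (\<lambda>z. (a n z - a k z)\<^sup>2) \<le> 4 * \<kappa> N"
      unfolding w of_real_diff[symmetric] norm_of_real power2_abs a_def .
    then show ?thesis using real_sqrt_le_mono[of _ "4 * \<kappa> N"] by (simp add: nrm_def real_sqrt_mult)
  qed
  have shift: "nrm (\<lambda>z. a n (z + u) - a n z) \<le> 2 * sqrt (\<kappa> n)" for n u
  proof -
    have "m (\<lambda>z. (cmod (1 * wavg (\<lambda>_. 1) V (X n) (z + u) - wavg (\<lambda>_. 1) V (X n) z))\<^sup>2) \<le> 4 * \<kappa> n"
      by (rule near_minimal_shift[OF character_one V I]) (use X[of n] in auto)
    then have "m (\<lambda>z. (a n (z + u) - a n z)\<^sup>2) \<le> 4 * \<kappa> n"
      unfolding w of_real_diff[symmetric] norm_of_real power2_abs a_def mult_1 .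
    then show ?thesis using real_sqrt_le_mono[of _ "4 * \<kappa> n"] by (simp add: nrm_def real_sqrt_mult)
  qed
  have \<kappa>s_0: "(\<lambda>n. c * (2 * sqrt (\<kappa> n))) \<longlonglongrightarrow> 0" for c
    using tendsto_mult[OF tendsto_const[of c] tendsto_mult[OF tendsto_const[of 2] tendsto_real_sqrt[OF \<kappa>_0]]]
    by simp
  \<comment> \<open>The averages \<open>a n\<close> need not converge to a bounded function, but
    being Cauchy in \<open>nrm\<close> they have convergent pairings with every bounded
    function.\<close>
  define L where "L \<phi> = lim (\<lambda>n. m (\<lambda>z. \<phi> z * a n z))" for \<phi>
  have L: "(\<lambda>n. m (\<lambda>z. \<phi> z * a n z)) \<longlonglongrightarrow> L \<phi>" if \<phi>: "bfun \<phi>" for \<phi>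
  proof -
    have "Cauchy (\<lambda>n. m (\<lambda>z. \<phi> z * a n z))"
    proof (rule metric_CauchyI)
      fix e :: real assume "e > 0"
      have "eventually (\<lambda>n. nrm \<phi> * (2 * sqrt (\<kappa> n)) < e) sequentially"
        using order_tendstoD(2)[OF \<kappa>s_0 \<open>e > 0\<close>] .
      then obtain N where N: "nrm \<phi> * (2 * sqrt (\<kappa> N)) < e" by (auto simp: eventually_sequentially)
      have "dist (m (\<lambda>z. \<phi> z * a n z)) (m (\<lambda>z. \<phi> z * a k z)) < e" if "n \<ge> N" "k \<ge> N" for n k
      proof -
        have "m (\<lambda>z. \<phi> z * a n z) - m (\<lambda>z. \<phi> z * a k z) = m (\<lambda>z. \<phi> z * (a n z - a k z))"
          unfolding right_diff_distrib by (rule m_diff[symmetric]) (intro bfun_mult \<phi> ba)+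
        also have "\<bar>\<dots>\<bar> \<le> nrm \<phi> * nrm (\<lambda>z. a n z - a k z)"
          by (intro Cauchy_Schwarz \<phi> bd)
        also have "\<dots> \<le> nrm \<phi> * (2 * sqrt (\<kappa> N))"
          by (intro mult_left_mono near that nrm_nonneg \<phi>)
        also have "\<dots> < e" by (rule N)
        finally show ?thesis by (simp add: dist_real_def)
      qed
      then show "\<exists>M. \<forall>n\<ge>M. \<forall>k\<ge>M. dist (m (\<lambda>z. \<phi> z * a n z)) (m (\<lambda>z. \<phi> z * a k z)) < e" by blast
    qed
    then show ?thesis unfolding L_def by (simp add: Cauchy_convergent convergent_LIMSEQ_iff[symmetric])
  qed
  define M where "M s \<phi> = (if bfun \<phi> then m \<phi> + s * L \<phi> else 0)" for s :: real and \<phi>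
  have M_inv: "M s \<in> inv_means" if s: "\<bar>s\<bar> = 1" for s
  proof -
    have L_add: "L (\<lambda>x. \<phi> x + \<psi> x) = L \<phi> + L \<psi>" if b: "bfun \<phi>" "bfun \<psi>" for \<phi> \<psi>
    proof (rule LIMSEQ_unique[OF L[OF bfun_add[OF b]]])
      have "m (\<lambda>z. (\<phi> z + \<psi> z) * a n z) = m (\<lambda>z. \<phi> z * a n z) + m (\<lambda>z. \<psi> z * a n z)" for n
        unfolding distrib_right by (rule m_add) (intro bfun_mult b ba)+
      then show "(\<lambda>n. m (\<lambda>z. (\<phi> z + \<psi> z) * a n z)) \<longlonglongrightarrow> L \<phi> + L \<psi>"
        using tendsto_add[OF L[OF b(1)] L[OF b(2)]] by simp
    qed
    have L_cmult: "L (\<lambda>x. c * \<phi> x) = c * L \<phi>" if b: "bfun \<phi>" for \<phi> c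
    proof (rule LIMSEQ_unique[OF L[OF bfun_mult[OF bfun_const b]]])
      have "m (\<lambda>z. (c * \<phi> z) * a n z) = c * m (\<lambda>z. \<phi> z * a n z)" for n
        unfolding mult.assoc by (rule m_cmult) (intro bfun_mult b ba)
      then show "(\<lambda>n. m (\<lambda>z. (c * \<phi> z) * a n z)) \<longlonglongrightarrow> c * L \<phi>"
        using tendsto_mult_left[OF L[OF b]] by simp
    qed
    \<comment> \<open>This keeps \<open>M s\<close> normalised and rests on
      \<open>m V = 0\<close>.\<close>
    have L_one: "L (\<lambda>_. 1) = 0"
    proof (rule LIMSEQ_unique[OF L[OF bfun_const]])
      have "m (\<lambda>z. 1 * a n z) = 0" for n
      proof -
        have "m (\<lambda>z. 1 * a n z) = avg (X n) (\<lambda>x. m (\<lambda>z. V (z + x)))"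
          unfolding a_def mult_1 by (rule m_avg) (rule bfun_comp[OF bV])
        also have "\<dots> = avg (X n) (\<lambda>x. 0)" by (simp add: m_shift[OF bV] mV)
        finally show ?thesis using X by simp
      qed
      then show "(\<lambda>n. m (\<lambda>z. 1 * a n z)) \<longlonglongrightarrow> 0" by simp
    qed
    have L_shift: "L (\<lambda>x. \<phi> (x + g)) = L \<phi>" if b: "bfun \<phi>" for \<phi> g
    proof (rule LIMSEQ_unique[OF L[OF bfun_comp[OF b]]])
      have "norm (m (\<lambda>z. \<phi> (z + g) * a n z) - m (\<lambda>z. \<phi> z * a n z)) \<le> nrm \<phi> * (2 * sqrt (\<kappa> n))" for n
      proof -
        have "bfun (\<lambda>z. \<phi> z * a n (z + - g))" by (intro bfun_mult b bfun_comp[OF ba])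
        from m_shift[OF this, of g]
        have "m (\<lambda>z. \<phi> (z + g) * a n z) = m (\<lambda>z. \<phi> z * a n (z + - g))" by simp
        then have "m (\<lambda>z. \<phi> (z + g) * a n z) - m (\<lambda>z. \<phi> z * a n z) = m (\<lambda>z. \<phi> z * (a n (z + - g) - a n z))"
          unfolding right_diff_distrib
          by (simp only:) (rule m_diff[symmetric]; intro bfun_mult b bfun_comp[OF ba] ba)
        also have "\<bar>\<dots>\<bar> \<le> nrm \<phi> * nrm (\<lambda>z. a n (z + - g) - a n z)"
          by (intro Cauchy_Schwarz b bfun_diff bfun_comp[OF ba] ba)
        also have "\<dots> \<le> nrm \<phi> * (2 * sqrt (\<kappa> n))" by (intro mult_left_mono shift nrm_nonneg b)
        finally show ?thesis by simp
      qed
      then have "(\<lambda>n. m (\<lambda>z. \<phi> (z + g) * a n z) - m (\<lambda>z. \<phi> z * a n z)) \<longlonglongrightarrow> 0"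
        by (intro Lim_null_comparison[OF _ \<kappa>s_0[of "nrm \<phi>"]] always_eventually) simp
      from tendsto_add[OF this L[OF b]] show "(\<lambda>n. m (\<lambda>z. \<phi> (z + g) * a n z)) \<longlonglongrightarrow> L \<phi>" by simp
    qed
    \<comment> \<open>The weight \<open>1 + s * a n z\<close> is nonnegative, since the bound 1 on
      \<open>V\<close> passes to its averages.\<close>
    have pos: "0 \<le> m \<phi> + s * L \<phi>" if b: "bfun \<phi>" and p: "\<forall>x. 0 \<le> \<phi> x" for \<phi>
    proof (rule LIMSEQ_le_const)
      show "(\<lambda>n. m \<phi> + s * m (\<lambda>z. \<phi> z * a n z)) \<longlonglongrightarrow> m \<phi> + s * L \<phi>"
        by (intro tendsto_add tendsto_const tendsto_mult L b)
      have "0 \<le> m \<phi> + s * m (\<lambda>z. \<phi> z * a n z)" for n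
      proof -
        have "0 \<le> m (\<lambda>z. \<phi> z + s * (\<phi> z * a n z))"
        proof (rule m_nonneg)
          show "bfun (\<lambda>z. \<phi> z + s * (\<phi> z * a n z))" by (intro bfun_add bfun_mult bfun_const b ba)
          fix z
          have "\<bar>s * a n z\<bar> \<le> 1" using s a_le by (simp add: abs_mult)
          then have "0 \<le> \<phi> z * (1 + s * a n z)" using p by (intro mult_nonneg_nonneg) auto
          then show "0 \<le> \<phi> z + s * (\<phi> z * a n z)" by (simp add: algebra_simps)
        qed
        also have "\<dots> = m \<phi> + m (\<lambda>z. s * (\<phi> z * a n z))"
          by (rule m_add) (intro bfun_mult bfun_const b ba)+
        also have "m (\<lambda>z. s * (\<phi> z * a n z)) = s * m (\<lambda>z. \<phi> z * a n z)"
          by (rule m_cmult) (intro bfun_mult b ba)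
        finally show ?thesis .
      qed
      then show "\<exists>N. \<forall>n\<ge>N. 0 \<le> m \<phi> + s * m (\<lambda>z. \<phi> z * a n z)" by blast
    qed
    show ?thesis unfolding inv_means_def mem_Collect_eq
    proof (intro conjI allI impI)
      show "M s \<phi> = 0" if "\<not> bfun \<phi>" for \<phi> using that by (simp add: M_def)
      show "M s (\<lambda>x. \<phi> x + \<psi> x) = M s \<phi> + M s \<psi>" if "bfun \<phi>" "bfun \<psi>" for \<phi> \<psi>
        using that by (simp add: M_def bfun_add m_add L_add algebra_simps)
      show "M s (\<lambda>x. c * \<phi> x) = c * M s \<phi>" if "bfun \<phi>" for c \<phi>
        using that bfun_mult[OF bfun_const that, of c] by (simp add: M_def m_cmult L_cmult algebra_simps)
      show "0 \<le> M s \<phi>" if "bfun \<phi>" "\<forall>x. 0 \<le> \<phi> x" for \<phi> using pos that by (simp add: M_def)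
      show "M s (\<lambda>_. 1) = 1" by (simp add: M_def L_one)
      show "M s (\<lambda>x. \<phi> (x + g)) = M s \<phi>" if "bfun \<phi>" for g \<phi>
        using that bfun_comp[OF that, of "\<lambda>x. x + g"] by (simp add: M_def m_shift L_shift)
    qed
  qed
  have "m \<phi> = (M 1 \<phi> + M (- 1) \<phi>) / 2" for \<phi> by (simp add: M_def m_unbounded)
  then have "M 1 = m" by (intro ext[of "M 1" "M (- 1)"] M_inv) auto
  then have "M 1 V = m V" by simp
  then have LV: "L V = 0" using bV by (simp add: M_def)
  \<comment> \<open>Extremality forces \<open>L V = 0\<close>, whereas pairing \<open>V\<close> with
    its own averages of almost minimal energy gives at least \<open>I\<close> in the limit.\<close>
  have "I - 1 * (2 * sqrt (\<kappa> n)) \<le> m (\<lambda>z. V z * a n z)" for n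
    using near_minimal_corr[OF character_one V I, of "X n" "\<kappa> n"] X[of n] I[of "X n"]
    unfolding w a_def by simp
  moreover have "(\<lambda>n. I - 1 * (2 * sqrt (\<kappa> n))) \<longlonglongrightarrow> I - 0" by (intro tendsto_diff tendsto_const \<kappa>s_0)
  ultimately have "I - 0 \<le> L V" using L[OF bV] by (intro LIMSEQ_le) auto
  then show False using LV \<open>\<epsilon> \<le> I\<close> \<epsilon> by simp
qed

lemma ergodic_if_extreme:
  assumes ext: "\<And>y z. y \<in> inv_means \<Longrightarrow> z \<in> inv_means \<Longrightarrow> (\<And>\<phi>. m \<phi> = (y \<phi> + z \<phi>) / 2) \<Longrightarrow> y = m"
    and V: "bfun V" and \<epsilon>: "\<epsilon> > 0"
  shows "\<exists>xs. xs \<noteq> [] \<and> m (\<lambda>z. (avg xs (\<lambda>x. V (z + x)) - m V)\<^sup>2) < \<epsilon>"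
proof -
  obtain B where B: "\<And>x. \<bar>V x\<bar> \<le> B" using V by (auto simp: bfun_def)
  \<comment> \<open>Dividing by \<open>C\<close> brings \<open>V - m V\<close> into [-1, 1]; the
    summand 1 keeps \<open>C\<close> positive.\<close>
  define C where "C = 2 * \<bar>B\<bar> + 1"
  define W where "W x = (V x - m V) * inverse C" for x
  have C: "C > 0" by (simp add: C_def)
  have "\<bar>m V\<bar> \<le> B" by (rule m_abs_le[OF B])
  then have W1: "\<bar>W x\<bar> \<le> 1" for x using B[of x] C by (simp add: W_def C_def field_simps abs_mult)
  have "m W = m (\<lambda>x. inverse C * (V x - m V))" by (simp add: W_def[abs_def] mult.commute)
  also have "\<dots> = inverse C * m (\<lambda>x. V x - m V)" by (intro m_cmult bfun_diff V bfun_const)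
  also have "m (\<lambda>x. V x - m V) = 0" using m_diff[OF V bfun_const, of "m V"] by simp
  finally have "m W = 0" by simp
  have "0 < \<epsilon> / C\<^sup>2" using C \<epsilon> by simp
  have "\<exists>xs. xs \<noteq> [] \<and> m (\<lambda>z. (avg xs (\<lambda>x. W (z + x)))\<^sup>2) < \<epsilon> / C\<^sup>2"
    by (rule ergodic_normalized[OF _ W1 \<open>m W = 0\<close> \<open>0 < \<epsilon> / C\<^sup>2\<close>]) (rule ext)
  then obtain xs where xs: "xs \<noteq> []" "m (\<lambda>z. (avg xs (\<lambda>x. W (z + x)))\<^sup>2) < \<epsilon> / C\<^sup>2" by blast
  have "avg xs (\<lambda>x. V (z + x)) - m V = C * avg xs (\<lambda>x. W (z + x))" for z
    using xs(1) C by (simp add: W_def avg_mult_right avg_diff)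
  then have "m (\<lambda>z. (avg xs (\<lambda>x. V (z + x)) - m V)\<^sup>2) = m (\<lambda>z. C\<^sup>2 * (avg xs (\<lambda>x. W (z + x)))\<^sup>2)"
    by (simp add: power_mult_distrib)
  also have "\<dots> = C\<^sup>2 * m (\<lambda>z. (avg xs (\<lambda>x. W (z + x)))\<^sup>2)"
    by (intro m_cmult bfun_power2 bfun_avg bfun_comp[OF bfunI[OF W1]])
  also have "\<dots> < \<epsilon>" using xs(2) C by (simp add: field_simps)
  finally show ?thesis using xs(1) by blast
qed

end

subsection \<open>Positive definite functions and characters\<close>

text \<open>Points may repeat in the lists, so that concatenation of lists is addition of the
  corresponding finitely supported functions.\<close>

definition hform :: "('a::ab_group_add \<Rightarrow> complex) \<Rightarrow> (complex \<times> 'a) list \<Rightarrow> (complex \<times> 'a) list \<Rightarrow> complex" where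
  "hform \<sigma> L L' = (\<Sum>p\<leftarrow>L. \<Sum>q\<leftarrow>L'. fst p * cnj (fst q) * \<sigma> (snd p - snd q))"

text \<open>The real part of the form sees only the Hermitian part of \<open>\<sigma>\<close>, so
  Hermitian symmetry is required separately.\<close>

definition pos_def :: "('a::ab_group_add \<Rightarrow> complex) set" where
  "pos_def = {\<sigma>. \<sigma> 0 = 1 \<and> (\<forall>g. \<sigma> (- g) = cnj (\<sigma> g)) \<and> (\<forall>L. 0 \<le> Re (hform \<sigma> L L))}"

lemma hform_append:
  "hform \<sigma> (L @ M) L' = hform \<sigma> L L' + hform \<sigma> M L'"
  "hform \<sigma> L (L' @ M') = hform \<sigma> L L' + hform \<sigma> L M'"
  by (simp_all add: hform_def sum_list_addf)

lemma hform_pair: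
  assumes "\<And>g. \<sigma> (- g) = cnj (\<sigma> g)"
  shows "hform \<sigma> [(1, g), (b, 0)] [(1, g), (b, 0)] = (1 + cnj b * b) * \<sigma> 0 + cnj b * \<sigma> g + b * cnj (\<sigma> g)"
  using assms[of g] by (simp add: hform_def algebra_simps)

lemma pos_def_cmod_le: assumes "\<sigma> \<in> pos_def" shows "cmod (\<sigma> g) \<le> 1"
proof -
  \<comment> \<open>The coefficient \<open>- \<sigma> g\<close> at the point 0 is the one that
    minimises the form.\<close>
  have "0 \<le> Re (hform \<sigma> [(1, g), (- \<sigma> g, 0)] [(1, g), (- \<sigma> g, 0)])"
    using assms by (simp add: pos_def_def)
  also have "\<dots> = 1 - ((Re (\<sigma> g))\<^sup>2 + (Im (\<sigma> g))\<^sup>2)"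
    using assms by (subst hform_pair) (auto simp: pos_def_def power2_eq_square algebra_simps)
  also have "\<dots> = 1 - (cmod (\<sigma> g))\<^sup>2" by (simp only: cmod_power2)
  finally show ?thesis by (simp add: power2_le_imp_le abs_square_le_1[symmetric])
qed

text \<open>The same test pair as for the bound by 1, now without diagonal terms. It settles the
  degenerate case in which one part of a splitting has weight 0.\<close>

lemma hform_0_imp_0:
  assumes "\<And>g. \<sigma> (- g) = cnj (\<sigma> g)" "\<And>L. 0 \<le> Re (hform \<sigma> L L)" "\<sigma> 0 = 0"
  shows "\<sigma> g = 0"
proof -
  have "0 \<le> Re (hform \<sigma> [(1, g), (- \<sigma> g, 0)] [(1, g), (- \<sigma> g, 0)])" by (rule assms)
  also have "\<dots> = - 2 * ((Re (\<sigma> g))\<^sup>2 + (Im (\<sigma> g))\<^sup>2)"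
    by (subst hform_pair[where \<sigma> = \<sigma>, OF assms(1)]) (simp add: assms(3) power2_eq_square algebra_simps)
  also have "\<dots> = - 2 * (cmod (\<sigma> g))\<^sup>2" by (simp only: cmod_power2)
  finally show ?thesis by (simp add: zero_le_mult_iff)
qed

lemma continuous_on_sum_list:
  fixes f :: "'p \<Rightarrow> 'b::topological_space \<Rightarrow> 'c::real_normed_vector"
  shows "(\<And>p. continuous_on S (f p)) \<Longrightarrow> continuous_on S (\<lambda>x. \<Sum>p\<leftarrow>L. f p x)"
  by (induction L) (auto intro: continuous_on_add)

lemma closed_pos_def: "closed (pos_def :: ('a::ab_group_add \<Rightarrow> complex) set)"
  unfolding pos_def_def hform_def
  by (intro closed_Collect_conj closed_Collect_all closed_Collect_eq closed_Collect_le
      continuous_on_const continuous_on_product_coordinates continuous_on_cnj continuous_on_Re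
      continuous_on_sum_list continuous_on_mult)

lemma compact_pos_def: "compact (pos_def :: ('a::ab_group_add \<Rightarrow> complex) set)"
proof -
  have "compact ({\<sigma>. \<forall>g. \<sigma> g \<in> cball 0 1} \<inter> (pos_def :: ('a \<Rightarrow> complex) set))"
    by (rule compact_Int_closed[OF compact_PiE_UNIV closed_pos_def]) auto
  moreover have "{\<sigma>. \<forall>g. \<sigma> g \<in> cball 0 1} \<inter> (pos_def :: ('a \<Rightarrow> complex) set) = pos_def"
    using pos_def_cmod_le by auto
  ultimately show ?thesis by simp
qed

text \<open>For \<open>cmod c = 1\<close>, adding
  \<open>c * \<sigma> (x + g) + cnj c * \<sigma> (x - g)\<close> to \<open>2 * \<sigma> x\<close>,
  or subtracting it, leaves a positive definite function up to normalisation. The two results sum to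
  \<open>4 * \<sigma> x\<close>, so extremality makes each a multiple of \<open>\<sigma>\<close>.
  The cases \<open>c = 1\<close> and \<open>c = \<i>\<close> together give multiplicativity.\<close>

lemma character_if_extreme_pos_def:
  assumes \<sigma>: "\<sigma> \<in> pos_def"
    and ext: "\<And>\<tau>1 \<tau>2 t. \<tau>1 \<in> pos_def \<Longrightarrow> \<tau>2 \<in> pos_def \<Longrightarrow> 0 < t \<Longrightarrow> t < 1 \<Longrightarrow>
      (\<And>g. \<sigma> g = of_real t * \<tau>1 g + of_real (1 - t) * \<tau>2 g) \<Longrightarrow> \<tau>1 = \<sigma>"
  shows "character \<sigma>"
proof -
  have \<sigma>0: "\<sigma> 0 = 1" and herm: "\<And>g. \<sigma> (- g) = cnj (\<sigma> g)" and pos: "\<And>L. 0 \<le> Re (hform \<sigma> L L)"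
    using \<sigma> by (auto simp: pos_def_def)
  have key: "c * \<sigma> (x + g) + cnj c * \<sigma> (x - g) = 2 * of_real (Re (c * \<sigma> g)) * \<sigma> x" if c: "cmod c = 1" for c x g
  proof -
    have cc: "c * cnj c = 1" using c complex_norm_square[of c] by simp
    define \<phi> where "\<phi> s x = 2 * \<sigma> x + s * (c * \<sigma> (x + g) + cnj c * \<sigma> (x - g))" for s x
    define w where "w s = 2 + 2 * s * Re (c * \<sigma> g)" for s :: real
    have \<phi>0: "\<phi> (of_real s) 0 = of_real (w s)" for s
      using herm[of g] by (simp add: \<phi>_def \<sigma>0 w_def complex_eq_iff algebra_simps)
    have \<phi>h: "\<phi> (of_real s) (- x) = cnj (\<phi> (of_real s) x)" for s x
    proof -
      have "\<sigma> (- x + g) = cnj (\<sigma> (x - g))" "\<sigma> (- x - g) = cnj (\<sigma> (x + g))"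
        using herm[of "x - g"] herm[of "x + g"] by simp_all
      then show ?thesis unfolding \<phi>_def herm[of x] by (simp add: distrib_left)
    qed
    have \<phi>p: "0 \<le> Re (hform (\<phi> (of_real s)) L L)" if s: "s = 1 \<or> s = - 1" for s L
    proof -
      \<comment> \<open>\<open>T\<close> is \<open>L\<close> translated by \<open>g\<close> with
        rotated coefficients; the form of \<open>\<sigma>\<close> on \<open>L @ T\<close> equals
        that of \<open>\<phi>\<close> on \<open>L\<close>.\<close>
      define T where "T = map (\<lambda>p. (of_real s * c * fst p, snd p + g)) L"
      have ss: "of_real s * of_real s = (1 :: complex)" using s by auto
      have 1: "hform \<sigma> T T = hform \<sigma> L L"
      proof -
        have e: "of_real s * c * a * cnj (of_real s * c * b) = a * cnj b" for a b
        proof -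
          have "of_real s * c * a * cnj (of_real s * c * b) = (of_real s * of_real s) * (c * cnj c) * (a * cnj b)"
            by simp
          then show ?thesis by (simp only: ss cc) simp
        qed
        show ?thesis by (simp only: hform_def T_def map_map o_def fst_conv snd_conv e add_diff_cancel_right)
      qed
      have "hform \<sigma> (L @ T) (L @ T) = 2 * hform \<sigma> L L + hform \<sigma> T L + hform \<sigma> L T"
        by (simp add: hform_append 1)
      also have "\<dots> = (\<Sum>p\<leftarrow>L. \<Sum>q\<leftarrow>L. 2 * (fst p * cnj (fst q) * \<sigma> (snd p - snd q)) +
          fst p * cnj (fst q) * (of_real s * c * \<sigma> (snd p - snd q + g)) +
          fst p * cnj (fst q) * (of_real s * cnj c * \<sigma> (snd p - snd q - g)))"
        unfolding hform_def T_def sum_list_addf sum_list_const_mult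
        by (simp add: o_def algebra_simps)
      also have "\<dots> = hform (\<phi> (of_real s)) L L"
        unfolding hform_def \<phi>_def by (simp add: algebra_simps)
      finally show ?thesis using pos[of "L @ T"] by simp
    qed
    have Re_le: "\<bar>Re (c * \<sigma> g)\<bar> \<le> 1"
      using abs_Re_le_cmod[of "c * \<sigma> g"] pos_def_cmod_le[OF \<sigma>, of g] c by (simp add: norm_mult)
    have sum: "\<phi> (of_real 1) x + \<phi> (of_real (- 1)) x = 4 * \<sigma> x" for x by (simp add: \<phi>_def)
    have scaled: "\<phi> (of_real 1) x = of_real (w 1) * \<sigma> x"
    proof -
      \<comment> \<open>\<open>w\<close> is the value of \<open>\<phi>\<close> at 0. A part whose
        value at 0 vanishes is identically 0; otherwise both parts are normalised and weighted by
        \<open>w / 4\<close>.\<close>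
      consider "w 1 = 0" | "w (- 1) = 0" | "w 1 > 0" "w (- 1) > 0" using Re_le by (fastforce simp: w_def)
      then show ?thesis
      proof cases
        case 1
        have "\<phi> (of_real 1) x = 0" by (rule hform_0_imp_0[OF \<phi>h \<phi>p]) (simp_all only: \<phi>0 1 of_real_0 simp_thms)
        then show ?thesis using 1 by simp
      next
        case 2
        have "\<phi> (of_real (- 1)) x = 0"
          by (rule hform_0_imp_0[OF \<phi>h \<phi>p]) (simp_all only: \<phi>0 2 of_real_0 simp_thms)
        then have "\<phi> (of_real 1) x = 4 * \<sigma> x" using sum[of x] by simp
        moreover have "w 1 = 4" using 2 by (simp add: w_def)
        ultimately show ?thesis by simp
      next
        case 3
        define \<tau> where "\<tau> s x = of_real (inverse (w s)) * \<phi> (of_real s) x" for s x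
        have \<tau>: "\<tau> s \<in> pos_def" if s: "s = 1 \<or> s = - 1" for s
        proof -
          have ws: "w s > 0" using s 3 by auto
          have "hform (\<tau> s) L L = of_real (inverse (w s)) * hform (\<phi> (of_real s)) L L" for L
            unfolding hform_def \<tau>_def by (simp only: sum_list_const_mult[symmetric] mult.left_commute)
          then show ?thesis unfolding pos_def_def
            using \<phi>p[OF s] \<phi>h[of s] \<phi>0[of s] ws by (auto simp: \<tau>_def mult_nonneg_nonneg)
        qed
        have w4: "w 1 + w (- 1) = 4" by (simp add: w_def)
        have "\<tau> 1 = \<sigma>"
        proof (rule ext[of "\<tau> 1" "\<tau> (- 1)" "w 1 / 4"])
          show "\<sigma> x = of_real (w 1 / 4) * \<tau> 1 x + of_real (1 - w 1 / 4) * \<tau> (- 1) x" for x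
          proof -
            have "1 - w 1 / 4 = w (- 1) / 4" using w4 by (simp add: field_simps)
            moreover have "of_real (w s / 4) * \<tau> s x = \<phi> (of_real s) x / 4" if "w s > 0" for s
              using that by (simp add: \<tau>_def)
            from this[of 1, OF 3(1)] this[of "- 1", OF 3(2)]
            have "of_real (w 1 / 4) * \<tau> 1 x + of_real (w (- 1) / 4) * \<tau> (- 1) x
               = (\<phi> (of_real 1) x + \<phi> (of_real (- 1)) x) / 4"
              by (simp only: add_divide_distrib)
            ultimately have "of_real (w 1 / 4) * \<tau> 1 x + of_real (1 - w 1 / 4) * \<tau> (- 1) x
               = (\<phi> (of_real 1) x + \<phi> (of_real (- 1)) x) / 4" by (simp only:)
            then show ?thesis unfolding sum[of x] by (simp only:) simp
          qed
        qed (use \<tau> 3 w4 in auto)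
        then have "\<tau> 1 x = \<sigma> x" by simp
        then show ?thesis using 3 by (simp add: \<tau>_def field_simps)
      qed
    qed
    then show ?thesis by (simp add: \<phi>_def w_def algebra_simps)
  qed
  have mult: "\<sigma> (x + g) = \<sigma> x * \<sigma> g" for x g
  proof -
    have a: "\<sigma> (x + g) + \<sigma> (x - g) = 2 * of_real (Re (\<sigma> g)) * \<sigma> x" using key[of 1 x g] by simp
    have "\<i> * (\<sigma> (x + g) - \<sigma> (x - g)) = \<i> * (2 * \<i> * of_real (Im (\<sigma> g)) * \<sigma> x)"
      using key[of \<i> x g] by (simp add: algebra_simps)
    then have b: "\<sigma> (x + g) - \<sigma> (x - g) = 2 * \<i> * of_real (Im (\<sigma> g)) * \<sigma> x" by simp
    have "2 * \<sigma> (x + g) = 2 * \<sigma> x * (of_real (Re (\<sigma> g)) + \<i> * of_real (Im (\<sigma> g)))"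
      using arg_cong2[OF a b, of "(+)"] by (simp add: algebra_simps)
    then show ?thesis by (simp add: complex_eq[symmetric])
  qed
  have "cmod (\<sigma> g) = 1" for g
  proof -
    have "\<sigma> g * cnj (\<sigma> g) = 1" using mult[of g "- g"] herm[of g] \<sigma>0 by simp
    then have "complex_of_real ((cmod (\<sigma> g))\<^sup>2) = 1" using complex_norm_square[of "\<sigma> g"] by simp
    then have "(cmod (\<sigma> g))\<^sup>2 = 1" using of_real_eq_1_iff by blast
    then have "cmod (\<sigma> g) = 1 \<or> cmod (\<sigma> g) = - 1" by (simp add: power2_eq_1_iff)
    then show ?thesis using norm_ge_zero[of "\<sigma> g"] by linarith
  qed
  then show ?thesis using mult by (simp add: character_def)
qed

text \<open>The evaluations separate points. \<open>J\<close> joins them as the objective: being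
  affine, it respects every convex combination that the evaluations respect.\<close>

lemma exists_character_in_face:
  fixes K0 :: "('a::ab_group_add \<Rightarrow> complex) set" and J :: "('a \<Rightarrow> complex) \<Rightarrow> real"
  assumes K0: "K0 \<subseteq> pos_def" "closed K0" "K0 \<noteq> {}"
    and face: "\<And>x y z t. x \<in> K0 \<Longrightarrow> y \<in> pos_def \<Longrightarrow> z \<in> pos_def \<Longrightarrow> 0 < t \<Longrightarrow> t < 1 \<Longrightarrow>
       (\<And>g. x g = of_real t * y g + of_real (1 - t) * z g) \<Longrightarrow> y \<in> K0 \<and> z \<in> K0"
    and J: "continuous_on UNIV J" "\<And>x y z t. (\<And>g. x g = of_real t * y g + of_real (1 - t) * z g) \<Longrightarrow>
       J x = t * J y + (1 - t) * J z"
  obtains \<gamma> where "character \<gamma>" "\<gamma> \<in> K0" "\<And>\<sigma>. \<sigma> \<in> K0 \<Longrightarrow> J \<sigma> \<le> J \<gamma>"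
proof -
  define Ls where "Ls = insert J (range (\<lambda>g \<sigma>. Re (\<sigma> g)) \<union> range (\<lambda>g \<sigma>. Im (\<sigma> (g :: 'a))))"
  have eqI: "x g = of_real t * y g + of_real (1 - t) * z g"
    if "\<And>l. l \<in> Ls \<Longrightarrow> l x = t * l y + (1 - t) * l z" for x y z t g
    using that[of "\<lambda>\<sigma>. Re (\<sigma> g)"] that[of "\<lambda>\<sigma>. Im (\<sigma> g)"] by (simp add: Ls_def complex_eq_iff)
  obtain \<gamma> where \<gamma>: "\<gamma> \<in> K0" "\<And>y. y \<in> K0 \<Longrightarrow> J y \<le> J \<gamma>"
    and ext: "\<And>y z t. y \<in> pos_def \<Longrightarrow> z \<in> pos_def \<Longrightarrow> 0 < t \<Longrightarrow> t < 1 \<Longrightarrow>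
       (\<And>l. l \<in> Ls \<Longrightarrow> l \<gamma> = t * l y + (1 - t) * l z) \<Longrightarrow> y = \<gamma>"
  proof (rule exists_extreme_point[OF compact_pos_def, of Ls K0 J])
    show "continuous_on UNIV l" if "l \<in> Ls" for l
      using that J(1) by (auto simp: Ls_def intro!: continuous_intros)
    show "x = y" if "\<And>l. l \<in> Ls \<Longrightarrow> l x = l y" for x y
    proof
      show "x g = y g" for g
        using that[of "\<lambda>\<sigma>. Re (\<sigma> g)"] that[of "\<lambda>\<sigma>. Im (\<sigma> g)"] by (simp add: Ls_def complex_eq_iff)
    qed
    show "y \<in> K0 \<and> z \<in> K0" if "x \<in> K0" "y \<in> pos_def" "z \<in> pos_def" "0 < t" "t < 1"
      "\<And>l. l \<in> Ls \<Longrightarrow> l x = t * l y + (1 - t) * l z" for x y z t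
      by (rule face[OF that(1-5)]) (rule eqI, rule that(6))
  qed (use K0 in \<open>auto simp: Ls_def\<close>)
  have "character \<gamma>"
  proof (rule character_if_extreme_pos_def)
    show "\<gamma> \<in> pos_def" using \<gamma> K0 by auto
    show "\<tau>1 = \<gamma>" if "\<tau>1 \<in> pos_def" "\<tau>2 \<in> pos_def" "0 < t" "t < 1"
      "\<And>g. \<gamma> g = of_real t * \<tau>1 g + of_real (1 - t) * \<tau>2 g" for \<tau>1 \<tau>2 t
    proof (rule ext[OF that(1-4)])
      show "l \<gamma> = t * l \<tau>1 + (1 - t) * l \<tau>2" if "l \<in> Ls" for l
        using that J(2)[of \<gamma> t \<tau>1 \<tau>2] \<open>\<And>g. \<gamma> g = of_real t * \<tau>1 g + of_real (1 - t) * \<tau>2 g\<close>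
        by (auto simp: Ls_def)
    qed
  qed
  then show thesis using that \<gamma> by blast
qed

text \<open>The form splits over the cosets of \<open>H\<close>, and on a single coset the kernel
  has rank one, so the form is a sum of squared moduli.\<close>

lemma hform_subgroup:
  fixes H :: "'a::ab_group_add set"
  assumes H: "0 \<in> H" "\<And>x y. x \<in> H \<Longrightarrow> y \<in> H \<Longrightarrow> x - y \<in> H"
    and \<psi>: "\<And>x y. x \<in> H \<Longrightarrow> y \<in> H \<Longrightarrow> \<psi> (x - y) = \<psi> x * cnj (\<psi> y)"
  shows "0 \<le> Re (hform (\<lambda>x. if x \<in> H then \<psi> x else 0) L L)"
proof -
  have Hm: "- x \<in> H" if "x \<in> H" for x using H(2)[OF H(1) that] by simp
  have Hp: "x + y \<in> H" if "x \<in> H" "y \<in> H" for x y using H(2)[OF that(1) Hm[OF that(2)]] by simp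
  \<comment> \<open>The representative depends only on the coset of \<open>x\<close>, because the
    predicate under \<open>SOME\<close> is the same for all its members.\<close>
  define \<kappa> where "\<kappa> x = (SOME y. x - y \<in> H)" for x
  have \<kappa>1: "x - \<kappa> x \<in> H" for x unfolding \<kappa>_def by (rule someI[of _ x]) (simp add: H)
  have \<kappa>2: "\<kappa> x = \<kappa> y \<longleftrightarrow> x - y \<in> H" for x y
  proof
    assume "\<kappa> x = \<kappa> y"
    then show "x - y \<in> H" using H(2)[OF \<kappa>1[of x] \<kappa>1[of y]] by simp
  next
    assume xy: "x - y \<in> H"
    have "x - z \<in> H \<longleftrightarrow> y - z \<in> H" for z
      using Hp[OF xy, of "y - z"] H(2)[of "x - z" "x - y", OF _ xy] by (auto simp: algebra_simps)
    then show "\<kappa> x = \<kappa> y" by (simp add: \<kappa>_def)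
  qed
  define f where "f p = fst p * \<psi> (snd p - \<kappa> (snd p))" for p :: "complex \<times> 'a"
  define S where "S = (\<lambda>p. \<kappa> (snd p)) ` set L"
  have swap: "(\<Sum>p\<leftarrow>M. \<Sum>k\<in>S. F p k) = (\<Sum>k\<in>S. \<Sum>p\<leftarrow>M. F p k)"
    for M :: "(complex \<times> 'a) list" and F :: "complex \<times> 'a \<Rightarrow> 'a \<Rightarrow> complex"
    by (induction M) (auto simp: sum.distrib)
  have e: "fst p * cnj (fst q) * (if snd p - snd q \<in> H then \<psi> (snd p - snd q) else 0)
      = (\<Sum>k\<in>S. (if \<kappa> (snd p) = k then f p else 0) * cnj (if \<kappa> (snd q) = k then f q else 0))"
    if "p \<in> set L" for p q
  proof -
    have "(\<Sum>k\<in>S. (if \<kappa> (snd p) = k then f p else 0) * cnj (if \<kappa> (snd q) = k then f q else 0))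
        = (\<Sum>k\<in>S. if \<kappa> (snd p) = k then f p * cnj (if \<kappa> (snd q) = k then f q else 0) else 0)"
      by (intro sum.cong) auto
    also have "\<dots> = f p * cnj (if \<kappa> (snd q) = \<kappa> (snd p) then f q else 0)"
      using that by (subst sum.delta') (auto simp: S_def)
    also have "\<dots> = fst p * cnj (fst q) * (if snd p - snd q \<in> H then \<psi> (snd p - snd q) else 0)"
    proof (cases "snd p - snd q \<in> H")
      case True
      then have eq: "\<kappa> (snd q) = \<kappa> (snd p)" using \<kappa>2 by metis
      have "\<psi> (snd p - snd q) = \<psi> (snd p - \<kappa> (snd p)) * cnj (\<psi> (snd q - \<kappa> (snd q)))"
        using \<psi>[OF \<kappa>1[of "snd p"] \<kappa>1[of "snd q"]] eq by simp
      then show ?thesis using True eq by (simp add: f_def)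
    next
      case False
      then have "\<kappa> (snd q) \<noteq> \<kappa> (snd p)" using \<kappa>2 by metis
      then show ?thesis using False by simp
    qed
    finally show ?thesis by simp
  qed
  have "hform (\<lambda>x. if x \<in> H then \<psi> x else 0) L L
     = (\<Sum>p\<leftarrow>L. \<Sum>q\<leftarrow>L. \<Sum>k\<in>S. (if \<kappa> (snd p) = k then f p else 0) * cnj (if \<kappa> (snd q) = k then f q else 0))"
    unfolding hform_def by (intro arg_cong[where f = sum_list] map_cong refl e)
  also have "\<dots> = (\<Sum>k\<in>S. \<Sum>p\<leftarrow>L. \<Sum>q\<leftarrow>L. (if \<kappa> (snd p) = k then f p else 0) * cnj (if \<kappa> (snd q) = k then f q else 0))"
    by (simp only: swap)
  also have "\<dots> = (\<Sum>k\<in>S. (\<Sum>p\<leftarrow>L. if \<kappa> (snd p) = k then f p else 0) * cnj (\<Sum>p\<leftarrow>L. if \<kappa> (snd p) = k then f p else 0))"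
  proof -
    have c: "cnj (\<Sum>p\<leftarrow>M. F p) = (\<Sum>p\<leftarrow>M. cnj (F p))" for M :: "(complex \<times> 'a) list" and F
      by (induction M) auto
    show ?thesis by (simp only: c sum_list_const_mult sum_list_mult_const)
  qed
  also have "\<dots> = (\<Sum>k\<in>S. of_real ((cmod (\<Sum>p\<leftarrow>L. if \<kappa> (snd p) = k then f p else 0))\<^sup>2))"
    by (simp only: complex_norm_square)
  finally show ?thesis by (simp add: sum_nonneg)
qed

text \<open>The characters are the extreme points of \<open>pos_def\<close>. The extension of \<open>\<psi>\<close> by 0 is positive definite,
  and the positive definite extensions of \<open>\<psi>\<close> form a face; a point of it minimising the real part at \<open>g\<close> is the
  character sought.\<close>

lemma extend_character:
  fixes H :: "'a::ab_group_add set"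
  assumes H: "0 \<in> H" "\<And>x y. x \<in> H \<Longrightarrow> y \<in> H \<Longrightarrow> x - y \<in> H"
    and \<psi>: "\<And>x y. x \<in> H \<Longrightarrow> y \<in> H \<Longrightarrow> \<psi> (x - y) = \<psi> x * cnj (\<psi> y)" "\<And>x. x \<in> H \<Longrightarrow> cmod (\<psi> x) = 1"
  obtains \<gamma> where "character \<gamma>" "\<And>x. x \<in> H \<Longrightarrow> \<gamma> x = \<psi> x" "g \<in> H \<or> Re (\<gamma> g) \<le> 0"
proof -
  define K0 where "K0 = {\<sigma>. \<sigma> \<in> pos_def \<and> (\<forall>x. x \<in> H \<longrightarrow> \<sigma> x = \<psi> x)}"
  define \<sigma>0 where "\<sigma>0 x = (if x \<in> H then \<psi> x else 0)" for x
  have Hm: "- x \<in> H" if "x \<in> H" for x using H(2)[OF H(1) that] by simp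
  have \<psi>0: "\<psi> 0 = 1"
    using \<psi>(1)[OF H(1) H(1)] \<psi>(2)[OF H(1)] complex_norm_square[of "\<psi> 0"] by auto
  have "\<sigma>0 (- x) = cnj (\<sigma>0 x)" for x
    using Hm[of x] Hm[of "- x"] \<psi>(1)[OF H(1), of x] \<psi>0 by (auto simp: \<sigma>0_def split: if_splits)
  then have \<sigma>0: "\<sigma>0 \<in> K0"
    using hform_subgroup[OF H \<psi>(1)] \<psi>0 H(1) by (auto simp: K0_def pos_def_def \<sigma>0_def[abs_def])
  obtain \<gamma> where \<gamma>: "character \<gamma>" "\<gamma> \<in> K0" "\<And>\<sigma>. \<sigma> \<in> K0 \<Longrightarrow> - Re (\<sigma> g) \<le> - Re (\<gamma> g)"
  proof (rule exists_character_in_face[of K0 "\<lambda>\<sigma>. - Re (\<sigma> g)"])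
    show "closed K0" unfolding K0_def
      by (intro closed_Collect_conj closed_Collect_all closed_Collect_imp_const closed_Collect_eq
          continuous_on_const continuous_on_product_coordinates) (simp add: closed_pos_def)
    show "y \<in> K0 \<and> z \<in> K0" if "x \<in> K0" "y \<in> pos_def" "z \<in> pos_def" "0 < t" "t < 1"
      "\<And>g. x g = of_real t * y g + of_real (1 - t) * z g" for x y z t
    proof -
      \<comment> \<open>Strict convexity of the unit disc: a number of modulus 1 is a proper convex
        combination of two points of the disc only if both are equal to it.\<close>
      have "y h = \<psi> h \<and> z h = \<psi> h" if "h \<in> H" for h
      proof -
        have n: "cmod (\<psi> h) = 1" using \<psi>(2) that by simp
        have le: "Re (u * cnj (\<psi> h)) \<le> 1" if "cmod u \<le> 1" for u
          using complex_Re_le_cmod[of "u * cnj (\<psi> h)"] that n by (simp add: norm_mult)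
        have eq: "u = \<psi> h" if "cmod u \<le> 1" "Re (u * cnj (\<psi> h)) = 1" for u
        proof -
          have "(cmod (u - \<psi> h))\<^sup>2 = (cmod u)\<^sup>2 + (cmod (\<psi> h))\<^sup>2 - 2 * Re (u * cnj (\<psi> h))"
            by (simp only: cmod_power2) (simp add: power2_eq_square algebra_simps)
          also have "\<dots> \<le> 0" using that n by (simp add: power_le_one)
          finally show ?thesis by simp
        qed
        have yz: "cmod (y h) \<le> 1" "cmod (z h) \<le> 1" using pos_def_cmod_le \<open>y \<in> pos_def\<close> \<open>z \<in> pos_def\<close> by auto
        have "\<psi> h = of_real t * y h + of_real (1 - t) * z h"
          using \<open>x \<in> K0\<close> \<open>h \<in> H\<close> \<open>\<And>g. x g = _ g\<close> by (simp add: K0_def)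
        then have "\<psi> h * cnj (\<psi> h) = of_real t * (y h * cnj (\<psi> h)) + of_real (1 - t) * (z h * cnj (\<psi> h))"
          by (simp only: distrib_right[symmetric] mult.assoc[symmetric])
        then have "1 = Re (of_real t * (y h * cnj (\<psi> h)) + of_real (1 - t) * (z h * cnj (\<psi> h)))"
          using complex_norm_square[of "\<psi> h"] n by simp
        then have s: "1 = t * Re (y h * cnj (\<psi> h)) + (1 - t) * Re (z h * cnj (\<psi> h))"
          by (simp only: plus_complex.sel Re_complex_of_real times_complex.sel Im_complex_of_real)
        have "t * (1 - Re (y h * cnj (\<psi> h))) + (1 - t) * (1 - Re (z h * cnj (\<psi> h))) = 0"
          using s by (simp only: right_diff_distrib) simp
        moreover have "0 \<le> t * (1 - Re (y h * cnj (\<psi> h)))" "0 \<le> (1 - t) * (1 - Re (z h * cnj (\<psi> h)))"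
          using le[OF yz(1)] le[OF yz(2)] \<open>0 < t\<close> \<open>t < 1\<close> by (auto intro!: mult_nonneg_nonneg simp del: times_complex.sel)
        ultimately have "t * (1 - Re (y h * cnj (\<psi> h))) = 0" "(1 - t) * (1 - Re (z h * cnj (\<psi> h))) = 0"
          by linarith+
        then have "Re (y h * cnj (\<psi> h)) = 1" "Re (z h * cnj (\<psi> h)) = 1"
          using \<open>0 < t\<close> \<open>t < 1\<close> by (simp_all del: times_complex.sel)
        then show ?thesis using eq yz by blast
      qed
      then show ?thesis using that by (simp add: K0_def)
    qed
    show "- Re (x g) = t * - Re (y g) + (1 - t) * - Re (z g)"
      if "\<And>g. x g = of_real t * y g + of_real (1 - t) * z g" for x y z t
      using arg_cong[OF that[of g], of Re] by simp
  qed (use \<sigma>0 in \<open>auto simp: K0_def intro!: continuous_intros\<close>)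
  show thesis
  proof (rule that[OF \<gamma>(1)])
    show "\<gamma> x = \<psi> x" if "x \<in> H" for x using \<gamma>(2) that by (simp add: K0_def)
    show "g \<in> H \<or> Re (\<gamma> g) \<le> 0" using \<gamma>(3)[OF \<sigma>0] by (auto simp: \<sigma>0_def split: if_splits)
  qed
qed

subsection \<open>The filter of Bohr neighbourhoods of 0\<close>

text \<open>The neighbourhood filter of 0 in the coarsest topology that makes all characters
  continuous. It saves the bookkeeping of finite sets of characters and radii.\<close>

definition bohr_filter :: "'a::ab_group_add filter" where
  "bohr_filter = (INF \<gamma>\<in>{\<gamma>. character \<gamma>}. filtercomap \<gamma> (nhds 1))"

lemma filterlim_bohr_filter:
  "filterlim f bohr_filter F \<longleftrightarrow> (\<forall>\<gamma>. character \<gamma> \<longrightarrow> ((\<lambda>x. \<gamma> (f x)) \<longlongrightarrow> 1) F)"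
  unfolding bohr_filter_def by (auto simp: filterlim_INF filterlim_filtercomap_iff o_def)

lemma tendsto_character: "character \<gamma> \<Longrightarrow> (\<gamma> \<longlongrightarrow> 1) bohr_filter"
  using iffD1[OF filterlim_bohr_filter filterlim_ident[of bohr_filter]] by blast

lemma eventually_bohr_filter:
  "eventually P bohr_filter \<longleftrightarrow>
    (\<exists>X e. finite X \<and> (\<forall>\<gamma>\<in>X. character \<gamma>) \<and> e > 0 \<and> (\<forall>g. (\<forall>\<gamma>\<in>X. cmod (\<gamma> g - 1) < e) \<longrightarrow> P g))"
proof
  assume "eventually P bohr_filter"
  then obtain X where X: "X \<subseteq> {\<gamma>. character \<gamma>}" "finite X"
    "eventually P (INF \<gamma>\<in>X. filtercomap \<gamma> (nhds 1))"
    using iffD1[OF eventually_INF] unfolding bohr_filter_def by blast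
  then obtain Q where Q: "\<And>\<gamma>. \<gamma> \<in> X \<Longrightarrow> eventually (Q \<gamma>) (filtercomap \<gamma> (nhds 1))"
    "\<And>y. (\<forall>\<gamma>\<in>X. Q \<gamma> y) \<Longrightarrow> P y"
    by (auto simp: eventually_INF_finite[OF X(2)])
  have "\<exists>d>0. \<forall>g. cmod (\<gamma> g - 1) < d \<longrightarrow> Q \<gamma> g" if "\<gamma> \<in> X" for \<gamma>
    using Q(1)[OF that] by (fastforce simp: eventually_filtercomap eventually_nhds_metric dist_norm)
  then obtain d where d: "\<And>\<gamma>. \<gamma> \<in> X \<Longrightarrow> d \<gamma> > 0 \<and> (\<forall>g. cmod (\<gamma> g - 1) < d \<gamma> \<longrightarrow> Q \<gamma> g)" by metis
  \<comment> \<open>The inserted 1 provides a radius when \<open>X\<close> is empty.\<close>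
  define e where "e = Min (insert 1 (d ` X))"
  have e: "e > 0" "\<And>\<gamma>. \<gamma> \<in> X \<Longrightarrow> e \<le> d \<gamma>" using X(2) d by (auto simp: e_def)
  have "P g" if "\<forall>\<gamma>\<in>X. cmod (\<gamma> g - 1) < e" for g
    by (rule Q(2)) (use that e d in \<open>meson less_le_trans\<close>)
  then show "\<exists>X e. finite X \<and> (\<forall>\<gamma>\<in>X. character \<gamma>) \<and> e > 0 \<and> (\<forall>g. (\<forall>\<gamma>\<in>X. cmod (\<gamma> g - 1) < e) \<longrightarrow> P g)"
    using X e(1) by blast
next
  assume "\<exists>X e. finite X \<and> (\<forall>\<gamma>\<in>X. character \<gamma>) \<and> e > 0 \<and> (\<forall>g. (\<forall>\<gamma>\<in>X. cmod (\<gamma> g - 1) < e) \<longrightarrow> P g)"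
  then obtain X e where X: "finite X" "\<forall>\<gamma>\<in>X. character \<gamma>" "e > 0" and P: "\<And>g. (\<forall>\<gamma>\<in>X. cmod (\<gamma> g - 1) < e) \<Longrightarrow> P g"
    by blast
  have "eventually (\<lambda>g. \<forall>\<gamma>\<in>X. cmod (\<gamma> g - 1) < e) bohr_filter"
    by (rule eventually_ball_finite[OF X(1)])
      (use X tendstoD[OF tendsto_character X(3)] in \<open>auto simp: dist_norm\<close>)
  then show "eventually P bohr_filter" by (rule eventually_mono) (rule P)
qed

lemma ex_bohr_nbhd_zero:
  assumes "eventually (\<lambda>g. g \<in> S) bohr_filter"
  shows "\<exists>B. bohr_nbhd_zero B \<and> B \<subseteq> S"
proof -
  obtain X e where X: "finite X" "\<forall>\<gamma>\<in>X. character \<gamma>" "e > 0" and P: "\<And>g. (\<forall>\<gamma>\<in>X. cmod (\<gamma> g - 1) < e) \<Longrightarrow> g \<in> S"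
    using assms unfolding eventually_bohr_filter by blast
  obtain ch where ch: "bij_betw ch {0..<card X} X" using ex_bij_betw_nat_finite[OF X(1)] by blast
  then have im: "ch ` {..<card X} = X" by (simp add: bij_betw_def atLeast0LessThan)
  then have "\<forall>i<card X. character (ch i)" using X by blast
  moreover have "Bohr ch (card X) e \<subseteq> S"
  proof
    fix g assume g: "g \<in> Bohr ch (card X) e"
    show "g \<in> S"
    proof (rule P, rule ballI)
      fix \<gamma> assume "\<gamma> \<in> X"
      then obtain i where "i < card X" "\<gamma> = ch i" using im by blast
      then show "cmod (\<gamma> g - 1) < e" using g by (simp add: Bohr_def)
    qed
  qed
  ultimately show ?thesis unfolding bohr_nbhd_zero_def using X(3) by blast
qed

lemma character_comp_zmul: "character \<gamma> \<Longrightarrow> character (\<lambda>x. \<gamma> (zmul c x))"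
  by (simp add: character_def zmul_add_right)

lemma filterlim_zmul_bohr: "filterlim (zmul c) bohr_filter bohr_filter"
  unfolding filterlim_bohr_filter using tendsto_character[OF character_comp_zmul] by blast

lemma filterlim_add_bohr: "filterlim (\<lambda>(x, y). x + y) bohr_filter (bohr_filter \<times>\<^sub>F bohr_filter)"
  unfolding filterlim_bohr_filter
proof (intro allI impI)
  fix \<gamma> :: "'a \<Rightarrow> complex" assume \<gamma>: "character \<gamma>"
  have "((\<lambda>p. \<gamma> (fst p) * \<gamma> (snd p)) \<longlongrightarrow> 1 * 1) (bohr_filter \<times>\<^sub>F bohr_filter)"
    by (intro tendsto_mult filterlim_compose[OF tendsto_character[OF \<gamma>]] filterlim_fst filterlim_snd)
  then show "((\<lambda>p. \<gamma> (case p of (x, y) \<Rightarrow> x + y)) \<longlongrightarrow> 1) (bohr_filter \<times>\<^sub>F bohr_filter)"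
    by (simp add: case_prod_beta character_add[OF \<gamma>])
qed

lemma eventually_bohr_add:
  assumes "eventually P bohr_filter"
  obtains Q where "eventually Q bohr_filter" "\<And>x y. Q x \<Longrightarrow> Q y \<Longrightarrow> P (x + y)"
proof -
  have "eventually (\<lambda>p. P (fst p + snd p)) (bohr_filter \<times>\<^sub>F bohr_filter)"
    using filterlim_add_bohr assms by (auto simp: filterlim_iff case_prod_beta)
  then show thesis using that by (auto simp: eventually_prod_same)
qed

lemma eventually_bohr_0: assumes "eventually P bohr_filter" shows "P 0"
  using assms by (auto simp: eventually_bohr_filter)

text \<open>Each of the finitely many cosets other than \<open>H\<close> is excluded by a character
  that is trivial on \<open>H\<close> and has nonpositive real part at a representative, hence on
  the whole coset.\<close>

lemma eventually_bohr_subgroup: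
  fixes H :: "'a::ab_group_add set"
  assumes H: "0 \<in> H" "\<And>x y. x \<in> H \<Longrightarrow> y \<in> H \<Longrightarrow> x - y \<in> H" and fin: "finite_index H"
  shows "eventually (\<lambda>x. x \<in> H) bohr_filter"
proof -
  have "\<exists>\<gamma>. character \<gamma> \<and> (\<forall>x\<in>H. \<gamma> x = 1) \<and> (g \<in> H \<or> Re (\<gamma> g) \<le> 0)" for g
    by (rule extend_character[OF H, of "\<lambda>_. 1" g]) auto
  then obtain \<gamma> where \<gamma>: "\<And>g. character (\<gamma> g)" "\<And>g x. x \<in> H \<Longrightarrow> \<gamma> g x = 1"
    "\<And>g. g \<in> H \<or> Re (\<gamma> g g) \<le> 0" by metis
  define \<C> where "\<C> = {(\<lambda>h. g + h) ` H | g. True}"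
  define rep where "rep C = (SOME g. g \<in> C)" for C :: "'a set"
  have "eventually (\<lambda>x. \<forall>C\<in>\<C>. Re (\<gamma> (rep C) x) > 0) bohr_filter"
  proof (rule eventually_ball_finite)
    show "finite \<C>" using fin by (simp add: finite_index_def \<C>_def)
    show "\<forall>C\<in>\<C>. eventually (\<lambda>x. Re (\<gamma> (rep C) x) > 0) bohr_filter"
      using order_tendstoD(1)[OF tendsto_Re[OF tendsto_character[OF \<gamma>(1)]], of 0] by auto
  qed
  then show ?thesis
  proof (rule eventually_mono)
    fix x assume x: "\<forall>C\<in>\<C>. Re (\<gamma> (rep C) x) > 0"
    define C where "C = (\<lambda>h. x + h) ` H"
    have "x \<in> C" using H(1) by (auto simp: C_def image_iff intro!: bexI[of _ 0])
    then have "rep C \<in> C" unfolding rep_def by (rule someI)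
    then obtain h where h: "h \<in> H" "rep C = x + h" by (auto simp: C_def)
    have pos: "Re (\<gamma> (rep C) x) > 0" using x by (auto simp: \<C>_def C_def)
    have "\<gamma> (rep C) (rep C) = \<gamma> (rep C) x"
      using h \<gamma>(2)[OF h(1)] character_add[OF \<gamma>(1), of "rep C" x h] by simp
    then have "x + h \<in> H" using \<gamma>(3)[of "rep C"] pos h by auto
    then show "x \<in> H" using H(2)[of "x + h" h] h by simp
  qed
qed

section \<open>Trigonometric polynomials and openness of integer multiplication\<close>

inductive trig_poly :: "('a \<Rightarrow> complex) set \<Rightarrow> ('a \<Rightarrow> complex) \<Rightarrow> bool" for \<Lambda> where
  char: "\<mu> \<in> \<Lambda> \<Longrightarrow> trig_poly \<Lambda> (\<lambda>x. c * \<mu> x)"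
| add: "trig_poly \<Lambda> f \<Longrightarrow> trig_poly \<Lambda> g \<Longrightarrow> trig_poly \<Lambda> (\<lambda>x. f x + g x)"

lemma trig_poly_mult:
  assumes \<Lambda>: "\<And>\<mu> \<nu>. \<mu> \<in> \<Lambda> \<Longrightarrow> \<nu> \<in> \<Lambda> \<Longrightarrow> (\<lambda>x. \<mu> x * \<nu> x) \<in> \<Lambda>"
    and f: "trig_poly \<Lambda> f" and g: "trig_poly \<Lambda> g"
  shows "trig_poly \<Lambda> (\<lambda>x. f x * g x)"
  using f
proof (induction rule: trig_poly.induct)
  case (char \<mu> c)
  note \<mu> = this
  show ?case using g
  proof (induction rule: trig_poly.induct)
    case (char \<nu> d)
    have "trig_poly \<Lambda> (\<lambda>x. (c * d) * (\<mu> x * \<nu> x))" by (rule trig_poly.char[OF \<Lambda>[OF \<mu> char]])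
    then show ?case by (simp add: mult_ac)
  next
    case (add f g)
    show ?case using trig_poly.add[OF add.IH] by (simp add: distrib_left)
  qed
next
  case (add f h)
  show ?case using trig_poly.add[OF add.IH] by (simp add: distrib_right)
qed

lemma trig_poly_prod:
  assumes \<Lambda>: "\<And>\<mu> \<nu>. \<mu> \<in> \<Lambda> \<Longrightarrow> \<nu> \<in> \<Lambda> \<Longrightarrow> (\<lambda>x. \<mu> x * \<nu> x) \<in> \<Lambda>" "(\<lambda>_. 1) \<in> \<Lambda>"
    and f: "\<And>i. i \<in> I \<Longrightarrow> trig_poly \<Lambda> (f i)"
  shows "trig_poly \<Lambda> (\<lambda>x. \<Prod>i\<in>I. f i x)"
  using f
proof (induction I rule: infinite_finite_induct)
  case (infinite I)
  then show ?case using trig_poly.char[OF \<Lambda>(2), of 1] by simp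
next
  case empty
  then show ?case using trig_poly.char[OF \<Lambda>(2), of 1] by simp
next
  case (insert i I)
  have "trig_poly \<Lambda> (f i)" "trig_poly \<Lambda> (\<lambda>x. \<Prod>i\<in>I. f i x)"
    by (rule insert.prems, simp) (rule insert.IH, rule insert.prems, simp)
  then show ?case unfolding prod.insert[OF insert.hyps]
    by (intro trig_poly_mult) (rule \<Lambda>(1))
qed

lemma character_zmul_int: "character \<gamma> \<Longrightarrow> \<gamma> (zmul (int n) x) = \<gamma> x ^ n"
  by (induction n) (auto simp: zmul_add_left character_add algebra_simps)

lemma cmod_diff_1_power2: "cmod z = 1 \<Longrightarrow> (cmod (z - 1))\<^sup>2 = 2 - 2 * Re z"
proof -
  assume "cmod z = 1"
  then have "(Re z)\<^sup>2 + (Im z)\<^sup>2 = 1" by (metis cmod_power2 one_power2)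
  then show ?thesis by (simp only: cmod_power2) (simp add: power2_eq_square algebra_simps)
qed

lemma subgroup_mult_set:
  "0 \<in> mult_set r" "x \<in> mult_set r \<Longrightarrow> y \<in> mult_set r \<Longrightarrow> x - y \<in> (mult_set r :: 'a::ab_group_add set)"
  unfolding mult_set_def by (metis rangeI zmul_0_right) (auto simp: zmul_diff_right[symmetric])

text \<open>Multiplication by \<open>r\<close> is open at 0. Averaging a trigonometric polynomial that peaks on
  the neighbourhood over representatives of the kernel of \<open>zmul r\<close> kills the characters that are nontrivial on
  the kernel; the other ones factor through \<open>zmul r\<close>.\<close>

lemma eventually_bohr_zmul_image:
  fixes P :: "'a::ab_group_add \<Rightarrow> bool"
  assumes r: "r \<noteq> 0" and fin: "finite_index (mult_set r :: 'a set)" and P: "eventually P bohr_filter"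
  shows "eventually (\<lambda>w. \<exists>x. w = zmul r x \<and> P x) bohr_filter"
proof -
  obtain X e where X: "finite X" "\<And>\<gamma>. \<gamma> \<in> X \<Longrightarrow> character \<gamma>" "e > 0"
    and PX: "\<And>g. (\<forall>\<gamma>\<in>X. cmod (\<gamma> g - 1) < e) \<Longrightarrow> P g"
    using P unfolding eventually_bohr_filter by metis
  define n where "n = nat \<bar>r\<bar>"
  have n: "n > 0" using r by (simp add: n_def)
  define N where "N = {k :: 'a. zmul r k = 0}"
  have N0: "0 \<in> N" and Nadd: "k \<in> N \<Longrightarrow> k' \<in> N \<Longrightarrow> k + k' \<in> N" for k k'
    by (auto simp: N_def zmul_add_right)
  define vec where "vec k = restrict (\<lambda>\<gamma>. \<gamma> k) X" for k :: 'a
  have vec_eq: "vec k = vec k' \<longleftrightarrow> (\<forall>\<gamma>\<in>X. \<gamma> k = \<gamma> k')" for k k'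
    unfolding vec_def fun_eq_iff restrict_def by auto
  \<comment> \<open>The kernel may be infinite, but on it a character takes only \<open>n\<close>-th
    roots of unity as values.\<close>
  have finN: "finite (vec ` N)"
  proof (rule finite_subset)
    show "vec ` N \<subseteq> PiE X (\<lambda>_. {z. z ^ n = 1})"
    proof (intro image_subsetI)
      fix k assume "k \<in> N"
      then have "zmul (int n) k = 0"
        by (cases "r \<ge> 0") (auto simp: N_def n_def zmul_minus_left)
      then have "\<gamma> k ^ n = 1" if "\<gamma> \<in> X" for \<gamma>
        using character_zmul_int[OF X(2)[OF that], of n k] X(2)[OF that] by simp
      then show "vec k \<in> PiE X (\<lambda>_. {z. z ^ n = 1})" by (auto simp: vec_def)
    qed
    show "finite (PiE X (\<lambda>_. {z :: complex. z ^ n = 1}))"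
      by (intro finite_PiE X finite_nth_roots n)
  qed
  obtain S where S: "S \<subseteq> N" "inj_on vec S" "vec ` N = vec ` S"
    using subset_image_inj[of "vec ` N" vec N] by auto
  have fS: "finite S" using finN S by (metis finite_imageD)
  \<comment> \<open>These characters factor through \<open>vec\<close>, so summing them over the
    representatives \<open>S\<close> works like summing characters over the finite image of the
    kernel.\<close>
  define \<Lambda> where "\<Lambda> = {\<mu>. character \<mu> \<and> (\<forall>k k'. (\<forall>\<gamma>\<in>X. \<gamma> k = \<gamma> k') \<longrightarrow> \<mu> k = \<mu> k')}"
  have \<Lambda>1: "(\<lambda>_. 1) \<in> \<Lambda>" by (auto simp: \<Lambda>_def character_def)
  have \<Lambda>m: "(\<lambda>x. \<mu> x * \<nu> x) \<in> \<Lambda>" if "\<mu> \<in> \<Lambda>" "\<nu> \<in> \<Lambda>" for \<mu> \<nu>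
  proof -
    have "character (\<lambda>x. \<mu> x * \<nu> x)" using that by (auto simp: \<Lambda>_def character_def norm_mult)
    moreover have "\<mu> k * \<nu> k = \<mu> k' * \<nu> k'" if "\<forall>\<gamma>\<in>X. \<gamma> k = \<gamma> k'" for k k'
    proof -
      have "\<mu> k = \<mu> k'" "\<nu> k = \<nu> k'" using \<open>\<mu> \<in> \<Lambda>\<close> \<open>\<nu> \<in> \<Lambda>\<close> that by (simp_all add: \<Lambda>_def)
      then show ?thesis by simp
    qed
    ultimately show ?thesis by (simp add: \<Lambda>_def)
  qed
  have \<Lambda>c: "(\<lambda>x. cnj (\<gamma> x)) \<in> \<Lambda>" "\<gamma> \<in> \<Lambda>" if "\<gamma> \<in> X" for \<gamma>
    using X(2)[OF that] that by (auto simp: \<Lambda>_def character_def)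
  have dich: "(\<forall>k\<in>N. \<mu> k = 1) \<or> (\<Sum>k\<in>S. \<mu> k) = 0" if \<mu>: "\<mu> \<in> \<Lambda>" for \<mu>
  proof (rule disjCI)
    have ch: "character \<mu>" using \<mu> by (simp add: \<Lambda>_def)
    assume s: "(\<Sum>k\<in>S. \<mu> k) \<noteq> 0"
    show "\<forall>k\<in>N. \<mu> k = 1"
    proof
      fix k0 assume k0: "k0 \<in> N"
      \<comment> \<open>\<open>p\<close> is translation by \<open>k0\<close> read off on
        representatives. It permutes \<open>S\<close>, and so shows that the sum is fixed by
        multiplication with \<open>\<mu> k0\<close>.\<close>
      define p where "p k = inv_into S vec (vec (k + k0))" for k
      have p: "p k \<in> S" "vec (p k) = vec (k + k0)" if "k \<in> S" for k
      proof -
        have "vec (k + k0) \<in> vec ` S" using that S k0 Nadd by blast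
        then show "p k \<in> S" "vec (p k) = vec (k + k0)"
          unfolding p_def by (rule inv_into_into, rule f_inv_into_f)
      qed
      have "inj_on p S"
      proof (rule inj_onI)
        fix k k' assume k: "k \<in> S" "k' \<in> S" "p k = p k'"
        then have "vec (k + k0) = vec (k' + k0)" using p(2) by metis
        then have "\<gamma> k = \<gamma> k'" if "\<gamma> \<in> X" for \<gamma>
        proof -
          have "\<gamma> k0 \<noteq> 0" using X(2)[OF that] by (metis character_norm norm_zero zero_neq_one)
          moreover have "\<gamma> (k + k0) = \<gamma> (k' + k0)"
            using \<open>vec (k + k0) = vec (k' + k0)\<close> that unfolding vec_eq by blast
          ultimately show ?thesis by (simp add: character_add[OF X(2)[OF that]])
        qed
        then have "vec k = vec k'" by (simp add: vec_eq)
        then show "k = k'" using S(2) k by (meson inj_onD)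
      qed
      moreover have "p ` S \<subseteq> S" using p by blast
      ultimately have pS: "p ` S = S" using endo_inj_surj[OF fS] by blast
      have "(\<Sum>k\<in>S. \<mu> k) = (\<Sum>k\<in>S. \<mu> (p k))"
        using sum.reindex[OF \<open>inj_on p S\<close>, of \<mu>] pS by (simp add: o_def)
      also have "\<dots> = (\<Sum>k\<in>S. \<mu> k0 * \<mu> k)"
      proof (intro sum.cong refl)
        fix k assume "k \<in> S"
        then have "\<forall>\<gamma>\<in>X. \<gamma> (p k) = \<gamma> (k + k0)" using p(2) vec_eq by blast
        then have "\<mu> (p k) = \<mu> (k + k0)" using \<mu> by (simp add: \<Lambda>_def)
        then show "\<mu> (p k) = \<mu> k0 * \<mu> k" by (simp add: character_add[OF ch])
      qed
      also have "\<dots> = \<mu> k0 * (\<Sum>k\<in>S. \<mu> k)" by (simp add: sum_distrib_left)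
      finally show "\<mu> k0 = 1" using s by simp
    qed
  qed
  \<comment> \<open>Both claims are additive in \<open>f\<close>, so a single character suffices: it
    is trivial on the kernel or has sum 0 over \<open>S\<close>.\<close>
  have push: "\<exists>G. (G \<longlongrightarrow> (\<Sum>k\<in>S. f k)) bohr_filter \<and> (\<forall>x. (\<Sum>k\<in>S. f (x + k)) = G (zmul r x))"
    if "trig_poly \<Lambda> f" for f
    using that
  proof (induction rule: trig_poly.induct)
    case (char \<mu> c)
    have ch: "character \<mu>" using char by (simp add: \<Lambda>_def)
    show ?case
    proof (cases "\<forall>k\<in>N. \<mu> k = 1")
      case True
      define \<psi> where "\<psi> w = \<mu> (SOME x. w = zmul r x)" for w
      have \<psi>: "\<psi> (zmul r x) = \<mu> x" for x
      proof -
        define y where "y = (SOME y. zmul r x = zmul r y)"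
        have "zmul r x = zmul r y" unfolding y_def by (rule someI) (rule refl)
        then have "x - y \<in> N" by (simp add: N_def zmul_diff_right)
        then have "\<mu> (x - y) = 1" using True by simp
        then have "\<mu> x = \<mu> y" using character_add[OF ch, of "x - y" y] by simp
        then show ?thesis by (simp add: \<psi>_def y_def)
      qed
      have "\<exists>\<gamma>. character \<gamma> \<and> (\<forall>x\<in>mult_set r. \<gamma> x = \<psi> x)"
      \<comment> \<open>The extra point is 0, which lies in the subgroup and makes the third
        conclusion trivial.\<close>
      proof (rule extend_character[of "mult_set r" \<psi> 0])
        show "0 \<in> (mult_set r :: 'a set)" by (rule subgroup_mult_set)
        show "x - y \<in> mult_set r" if "x \<in> mult_set r" "y \<in> mult_set r" for x y :: 'a
          using that by (rule subgroup_mult_set)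
        show "\<psi> (x - y) = \<psi> x * cnj (\<psi> y)" if "x \<in> mult_set r" "y \<in> mult_set r" for x y
          using that by (auto simp: mult_set_def \<psi> zmul_diff_right[symmetric] character_diff[OF ch])
        show "cmod (\<psi> x) = 1" if "x \<in> mult_set r" for x
          using that ch by (auto simp: mult_set_def \<psi>)
      qed (intro exI conjI ballI)
      then obtain \<gamma> where \<gamma>: "character \<gamma>" "\<And>x. x \<in> mult_set r \<Longrightarrow> \<gamma> x = \<psi> x" by blast
      have g: "\<gamma> (zmul r x) = \<mu> x" for x using \<gamma>(2)[of "zmul r x"] by (simp add: mult_set_def \<psi>)
      define G where "G w = of_nat (card S) * (c * \<gamma> w)" for w
      have mk: "\<mu> k = 1" if "k \<in> S" for k using True S that by auto
      have "(G \<longlongrightarrow> of_nat (card S) * (c * 1)) bohr_filter"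
        unfolding G_def by (intro tendsto_mult tendsto_const tendsto_character \<gamma>)
      then have "(G \<longlongrightarrow> (\<Sum>k\<in>S. c * \<mu> k)) bohr_filter" by (simp add: mk)
      moreover have "(\<Sum>k\<in>S. c * \<mu> (x + k)) = G (zmul r x)" for x
        by (simp add: G_def g character_add[OF ch] mk)
      ultimately show ?thesis by blast
    next
      case False
      then have "(\<Sum>k\<in>S. \<mu> k) = 0" using dich char by blast
      then have "(\<Sum>k\<in>S. c * \<mu> (x + k)) = 0" for x
        by (simp add: character_add[OF ch] sum_distrib_left[symmetric] mult.left_commute)
      from this this[of 0] show ?thesis by (intro exI[of _ "\<lambda>_. 0"]) auto
    qed
  next
    case (add f g)
    then obtain F G where
      "(F \<longlongrightarrow> (\<Sum>k\<in>S. f k)) bohr_filter" "\<And>x. (\<Sum>k\<in>S. f (x + k)) = F (zmul r x)"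
      "(G \<longlongrightarrow> (\<Sum>k\<in>S. g k)) bohr_filter" "\<And>x. (\<Sum>k\<in>S. g (x + k)) = G (zmul r x)" by blast
    then show ?case
      by (intro exI[of _ "\<lambda>w. F w + G w"]) (auto simp: sum.distrib intro!: tendsto_add)
  qed
  \<comment> \<open>For \<open>cmod z = 1\<close> the factor \<open>(1 + Re z) / 2\<close> is
    \<open>1 - (cmod (z - 1))\<^sup>2 / 4\<close>, hence at most \<open>b\<close> once a character
    is at distance \<open>e\<close> from 1. The maximum with 0 handles large
    \<open>e\<close>.\<close>
  define b where "b = max 0 (1 - e\<^sup>2 / 4)"
  have b: "0 \<le> b" "b < 1" using X(3) by (auto simp: b_def)
  \<comment> \<open>With this exponent, \<open>card S\<close> values outside the neighbourhood sum
    to less than 1/2.\<close>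
  obtain M where M: "b ^ M < 1 / (2 * (real (card S) + 1))"
    using real_arch_pow_inv[of "1 / (2 * (real (card S) + 1))" b] b by auto
  define \<psi> where "\<psi> x = (\<Prod>\<gamma>\<in>X. ((1 + Re (\<gamma> x)) / 2) ^ M)" for x
  have fac: "0 \<le> (1 + Re (\<gamma> x)) / 2" "(1 + Re (\<gamma> x)) / 2 \<le> 1" if "\<gamma> \<in> X" for \<gamma> x
    using abs_Re_le_cmod[of "\<gamma> x"] X(2)[OF that] by auto
  have \<psi>_nonneg: "0 \<le> \<psi> x" for x unfolding \<psi>_def using fac by (intro prod_nonneg) auto
  have \<psi>_small: "\<psi> x \<le> b ^ M" if nP: "\<not> P x" for x
  proof -
    obtain \<gamma> where \<gamma>: "\<gamma> \<in> X" "e \<le> cmod (\<gamma> x - 1)" using PX[of x] nP by (meson not_le)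
    have "e\<^sup>2 \<le> 2 - 2 * Re (\<gamma> x)"
      using power_mono[OF \<gamma>(2), of 2] X(3) cmod_diff_1_power2[of "\<gamma> x"] X(2)[OF \<gamma>(1)] by simp
    then have "(1 + Re (\<gamma> x)) / 2 \<le> 1 - e\<^sup>2 / 4" by (simp add: field_simps)
    also have "\<dots> \<le> b" by (simp add: b_def)
    finally have "(1 + Re (\<gamma> x)) / 2 \<le> b" .
    then have 1: "((1 + Re (\<gamma> x)) / 2) ^ M \<le> b ^ M" using fac[OF \<gamma>(1)] by (intro power_mono)
    have 2: "(\<Prod>\<gamma>\<in>X - {\<gamma>}. ((1 + Re (\<gamma> x)) / 2) ^ M) \<le> 1"
      using fac by (intro prod_le_1) (auto intro!: power_le_one)
    have "\<psi> x = ((1 + Re (\<gamma> x)) / 2) ^ M * (\<Prod>\<gamma>\<in>X - {\<gamma>}. ((1 + Re (\<gamma> x)) / 2) ^ M)"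
      unfolding \<psi>_def using \<gamma>(1) X(1) by (simp add: prod.remove)
    also have "\<dots> \<le> ((1 + Re (\<gamma> x)) / 2) ^ M * 1"
      using 2 fac[OF \<gamma>(1)] by (intro mult_left_mono) auto
    finally show ?thesis using 1 by simp
  qed
  have "trig_poly \<Lambda> (\<lambda>x. of_real (\<psi> x))"
  proof -
    \<comment> \<open>On the unit circle \<open>(1 + Re z) / 2\<close> is the squared modulus of
      \<open>(1 + z) / 2\<close>, which makes each factor a product of two trigonometric
      polynomials.\<close>
    have eq: "complex_of_real (\<psi> x) = (\<Prod>\<gamma>\<in>X. \<Prod>i<M. (1/2 * 1 + 1/2 * \<gamma> x) * (1/2 * 1 + 1/2 * cnj (\<gamma> x)))" for x
    proof -
      have "complex_of_real ((1 + Re (\<gamma> x)) / 2) = (1/2 * 1 + 1/2 * \<gamma> x) * (1/2 * 1 + 1/2 * cnj (\<gamma> x))"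
        if "\<gamma> \<in> X" for \<gamma>
      proof -
        have "\<gamma> x * cnj (\<gamma> x) = 1" using X(2)[OF that] complex_norm_square[of "\<gamma> x"] by simp
        then have "(1/2 * 1 + 1/2 * \<gamma> x) * (1/2 * 1 + 1/2 * cnj (\<gamma> x)) = 1/4 * (2 + (\<gamma> x + cnj (\<gamma> x)))"
          by (simp add: algebra_simps)
        also have "\<dots> = complex_of_real ((1 + Re (\<gamma> x)) / 2)"
          by (simp add: complex_add_cnj)
        finally show ?thesis by simp
      qed
      then show ?thesis unfolding \<psi>_def of_real_prod of_real_power by (simp cong: prod.cong)
    qed
    have half: "trig_poly \<Lambda> (\<lambda>x. 1/2 * 1 + 1/2 * \<mu> x)" if "\<mu> \<in> \<Lambda>" for \<mu>
      by (rule trig_poly.add[OF trig_poly.char[OF \<Lambda>1] trig_poly.char[OF that]])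
    show ?thesis unfolding eq
    proof (rule trig_poly_prod)
      show "(\<lambda>x. \<mu> x * \<nu> x) \<in> \<Lambda>" if "\<mu> \<in> \<Lambda>" "\<nu> \<in> \<Lambda>" for \<mu> \<nu> by (rule \<Lambda>m[OF that])
      show "(\<lambda>_. 1) \<in> \<Lambda>" by (rule \<Lambda>1)
      fix \<gamma> assume \<gamma>: "\<gamma> \<in> X"
      show "trig_poly \<Lambda> (\<lambda>x. \<Prod>i<M. (1/2 * 1 + 1/2 * \<gamma> x) * (1/2 * 1 + 1/2 * cnj (\<gamma> x)))"
      proof (rule trig_poly_prod)
        show "(\<lambda>x. \<mu> x * \<nu> x) \<in> \<Lambda>" if "\<mu> \<in> \<Lambda>" "\<nu> \<in> \<Lambda>" for \<mu> \<nu> by (rule \<Lambda>m[OF that])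
        show "(\<lambda>_. 1) \<in> \<Lambda>" by (rule \<Lambda>1)
        show "trig_poly \<Lambda> (\<lambda>x. (1/2 * 1 + 1/2 * \<gamma> x) * (1/2 * 1 + 1/2 * cnj (\<gamma> x)))"
          by (rule trig_poly_mult[OF _ half[OF \<Lambda>c(2)[OF \<gamma>]] half[OF \<Lambda>c(1)[OF \<gamma>]]]) (rule \<Lambda>m)
      qed
    qed
  qed
  from push[OF this] obtain G where G: "(G \<longlongrightarrow> (\<Sum>k\<in>S. of_real (\<psi> k))) bohr_filter"
    "\<And>x. (\<Sum>k\<in>S. complex_of_real (\<psi> (x + k))) = G (zmul r x)" by blast
  have "1 \<le> (\<Sum>k\<in>S. \<psi> k)"
  proof -
    \<comment> \<open>The kernel contains 0, so at some point of \<open>S\<close> all characters in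
      \<open>X\<close> take the value 1.\<close>
    have "vec 0 \<in> vec ` S" using N0 S(3) by blast
    then obtain s where s: "s \<in> S" "vec s = vec 0" by auto
    have "((1 + Re (\<gamma> s)) / 2) ^ M = 1" if "\<gamma> \<in> X" for \<gamma>
    proof -
      have "\<gamma> s = 1" using that s(2) X(2)[OF that] vec_eq[of s 0] by auto
      then show ?thesis by simp
    qed
    then have "\<psi> s = 1" unfolding \<psi>_def by (intro prod.neutral ballI)
    then show ?thesis using member_le_sum[of s S \<psi>] s fS \<psi>_nonneg by auto
  qed
  then have "1 / 2 < Re (\<Sum>k\<in>S. complex_of_real (\<psi> k))" by simp
  from order_tendstoD(1)[OF tendsto_Re[OF G(1)] this]
  have "eventually (\<lambda>w. 1 / 2 < Re (G w)) bohr_filter" .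
  moreover have "eventually (\<lambda>w. w \<in> (mult_set r :: 'a set)) bohr_filter"
    by (rule eventually_bohr_subgroup[OF _ _ fin]) (auto intro: subgroup_mult_set)
  ultimately show ?thesis
  proof eventually_elim
    case (elim w)
    then obtain x where x: "w = zmul r x" by (auto simp: mult_set_def)
    have "\<exists>k\<in>S. P (x + k)"
    proof (rule ccontr)
      assume "\<not> ?thesis"
      then have "(\<Sum>k\<in>S. \<psi> (x + k)) \<le> (\<Sum>k\<in>S. b ^ M)" by (intro sum_mono \<psi>_small) auto
      also have "\<dots> \<le> (real (card S) + 1) * b ^ M"
        using b by (simp add: mult_right_mono)
      also have "\<dots> < 1 / 2" using M by (simp add: field_simps)
      finally have lt: "(\<Sum>k\<in>S. \<psi> (x + k)) < 1 / 2" .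
      have "complex_of_real (\<Sum>k\<in>S. \<psi> (x + k)) = G w" using G(2)[of x] x by simp
      then have "Re (G w) = (\<Sum>k\<in>S. \<psi> (x + k))" by (metis Re_complex_of_real)
      then show False using elim(1) lt by linarith
    qed
    then obtain k where k: "k \<in> S" "P (x + k)" by blast
    then have "w = zmul r (x + k)" using S(1) x by (auto simp: N_def zmul_add_right)
    then show ?case using k by blast
  qed
qed

text \<open>The joint values of the finitely many characters are sorted into finitely many cells.
  One cell has positive mean, and subtracting one of its points moves it into the Bohr set.\<close>

lemma (in mean) m_eventually_bohr:
  assumes "eventually P bohr_filter" shows "0 < m (\<lambda>x. of_bool (P x))"
proof -
  obtain X e where X: "finite X" "\<And>\<gamma>. \<gamma> \<in> X \<Longrightarrow> character \<gamma>" "e > 0"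
    and PX: "\<And>g. (\<forall>\<gamma>\<in>X. cmod (\<gamma> g - 1) < e) \<Longrightarrow> P g"
    using assms unfolding eventually_bohr_filter by metis
  obtain T where T: "finite T" "sphere 0 1 \<subseteq> (\<Union>t\<in>T. ball (t :: complex) (e / 2))"
    using seq_compact_imp_totally_bounded[OF compact_imp_seq_compact[OF compact_sphere], of "0 :: complex" 1] X(3)
    by (meson half_gt_zero)
  have "\<exists>t. t \<in> T \<and> dist t (\<gamma> g) < e / 2" if "\<gamma> \<in> X" for \<gamma> g
  proof -
    have "\<gamma> g \<in> sphere 0 1" using X(2)[OF that] by simp
    then have "\<gamma> g \<in> (\<Union>t\<in>T. ball t (e / 2))" using T(2) by blast
    then show ?thesis by auto
  qed
  then obtain t where t: "\<And>\<gamma> g. \<gamma> \<in> X \<Longrightarrow> t \<gamma> g \<in> T \<and> dist (t \<gamma> g) (\<gamma> g) < e / 2" by metis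
  define code where "code g = restrict (\<lambda>\<gamma>. t \<gamma> g) X" for g
  define C where "C = PiE X (\<lambda>_. T)"
  have fC: "finite C" unfolding C_def using X(1) T(1) by (intro finite_PiE)
  have code: "code g \<in> C" for g using t by (auto simp: code_def C_def)
  have b: "bfun (\<lambda>g. of_bool (Q g))" for Q :: "'a \<Rightarrow> bool" by (rule bfunI[of _ 1]) auto
  have "(\<lambda>g. 1) = (\<lambda>g. \<Sum>c\<in>C. of_bool (code g = c) :: real)"
    by (rule ext) (simp only: of_bool_def sum.delta'[OF fC] code if_True)
  then have "1 = m (\<lambda>g. \<Sum>c\<in>C. of_bool (code g = c))" using m_one by metis
  also have "\<dots> = (\<Sum>c\<in>C. m (\<lambda>g. of_bool (code g = c)))" by (rule m_sum) (rule b)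
  finally have "0 < (\<Sum>c\<in>C. m (\<lambda>g. of_bool (code g = c)))" by simp
  then obtain c where c: "c \<in> C" "0 < m (\<lambda>g. of_bool (code g = c))"
    by (meson not_le sum_nonpos)
  have "\<exists>g0. code g0 = c"
  proof (rule ccontr)
    assume "\<not> ?thesis"
    then have "(\<lambda>g. of_bool (code g = c) :: real) = (\<lambda>_. 0)" by auto
    then have "m (\<lambda>g. of_bool (code g = c)) = m (\<lambda>_. 0)" by (rule arg_cong)
    then show False using c(2) m_const[of 0] by simp
  qed
  then obtain g0 where g0: "code g0 = c" by blast
  have "m (\<lambda>g. of_bool (code g = c)) \<le> m (\<lambda>g. of_bool (P (g + - g0)))"
  proof (rule m_mono[OF b b])
    fix g
    have "P (g + - g0)" if eq: "code g = c"
    proof (rule PX, rule ballI)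
      fix \<gamma> assume \<gamma>: "\<gamma> \<in> X"
      have "code g \<gamma> = code g0 \<gamma>" using eq g0 by simp
      then have "t \<gamma> g = t \<gamma> g0" using \<gamma> by (simp add: code_def)
      then have "dist (\<gamma> g) (\<gamma> g0) < e"
        using t[OF \<gamma>, of g] t[OF \<gamma>, of g0] dist_triangle_half_r[of "t \<gamma> g" "\<gamma> g" e "\<gamma> g0"] by auto
      moreover have "\<gamma> (g + - g0) - 1 = (\<gamma> g - \<gamma> g0) * cnj (\<gamma> g0)"
      proof -
        have "\<gamma> g0 * cnj (\<gamma> g0) = 1" using X(2)[OF \<gamma>] complex_norm_square[of "\<gamma> g0"] by simp
        then show ?thesis using character_diff[OF X(2)[OF \<gamma>], of g g0] by (simp add: left_diff_distrib)
      qed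
      ultimately show "cmod (\<gamma> (g + - g0) - 1) < e" using X(2)[OF \<gamma>] by (simp add: norm_mult dist_norm)
    qed
    then show "of_bool (code g = c) \<le> (of_bool (P (g + - g0)) :: real)" by simp
  qed
  also have "\<dots> = m (\<lambda>g. of_bool (P g))" by (rule m_shift[OF b])
  finally show ?thesis using c(2) by linarith
qed

subsection \<open>Correlations, almost periodic functions and the box form\<close>

context mean
begin

definition rho :: "('a \<Rightarrow> real) \<Rightarrow> 'a \<Rightarrow> real" where
  "rho h g = m (\<lambda>z. h (z + g) * h z)"

text \<open>A graded substitute for almost periodicity: \<open>e\<close> bounds the squared seminorm
  of the change, for all translations in some Bohr neighbourhood.\<close>

definition bohr_ap :: "real \<Rightarrow> ('a \<Rightarrow> real) set" where
  "bohr_ap e = {F. bfun F \<and> eventually (\<lambda>u. m (\<lambda>z. (F (z + u) - F z)\<^sup>2) \<le> e) bohr_filter}"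

text \<open>For an ergodic mean and suitable \<open>xs\<close> this approximates
  \<open>(rho h g)\<^sup>2\<close>.\<close>

definition tau :: "('a \<Rightarrow> real) \<Rightarrow> 'a list \<Rightarrow> 'a \<Rightarrow> real" where
  "tau h xs g = m (\<lambda>z. (avg xs (\<lambda>y. h (z + y + g) * h (z + y)))\<^sup>2)"

text \<open>Fourth power of a box norm: by \<open>boxform_eq\<close> it averages the product of
  \<open>h\<close> over the corners \<open>y + v\<close>, \<open>y + v'\<close>,
  \<open>y' + v\<close>, \<open>y' + v'\<close>, taken relative to \<open>z\<close>.\<close>

definition boxform :: "('a \<Rightarrow> real) \<Rightarrow> 'a list \<Rightarrow> 'a list \<Rightarrow> real" where
  "boxform h xs ys = avg ys (\<lambda>v. avg ys (\<lambda>v'. tau h xs (v - v')))"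

lemma m_sum_list:
  assumes "\<And>p. bfun (F p)" shows "m (\<lambda>x. \<Sum>p\<leftarrow>L. F p x) = (\<Sum>p\<leftarrow>L. m (F p))"
proof -
  have b: "bfun (\<lambda>x. \<Sum>p\<leftarrow>L. F p x)" for L by (induction L) (auto simp: assms)
  show ?thesis by (induction L) (auto simp: m_add assms b)
qed

lemma m_prod_shift:
  assumes "bfun h" shows "m (\<lambda>z. h (z + v) * h (z + v')) = rho h (v - v')"
proof -
  have "bfun (\<lambda>z. h (z + v) * h (z + v'))" by (intro bfun_mult bfun_comp[OF assms])
  from m_shift[OF this, of "- v'"] show ?thesis by (simp add: rho_def algebra_simps)
qed

lemma rho_abs_le: "(\<And>z. \<bar>h z\<bar> \<le> 1) \<Longrightarrow> \<bar>rho h g\<bar> \<le> 1"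
  unfolding rho_def by (rule m_abs_le) (auto simp: abs_mult intro: mult_le_one)

context
  fixes \<gamma> :: "'a \<Rightarrow> complex" and h :: "'a \<Rightarrow> real"
  assumes \<gamma>: "character \<gamma>" and h: "\<And>z. \<bar>h z\<bar> \<le> 1"
begin

text \<open>The energy becomes linear in \<open>\<gamma>\<close>. The right-hand side makes sense
  for every positive definite function and is the functional \<open>J\<close> maximised
  below.\<close>

lemma energy_eq:
  "energy \<gamma> h xs = avg xs (\<lambda>v. avg xs (\<lambda>v'. Re (\<gamma> (v - v')) * rho h (v - v')))"
proof -
  have bh: "bfun h" by (rule bfunI[OF h])
  have e: "(cmod (wavg \<gamma> h xs z))\<^sup>2 = avg xs (\<lambda>v. avg xs (\<lambda>v'. Re (\<gamma> (v - v')) * (h (z + v) * h (z + v'))))" for z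
  proof -
    have cn: "cnj (avg xs \<phi>) = avg xs (\<lambda>x. cnj (\<phi> x))" for \<phi> :: "'a \<Rightarrow> complex"
      by (rule avg_linear) (simp add: bounded_linear.linear bounded_linear_cnj)
    have re: "Re (avg xs \<phi>) = avg xs (\<lambda>x. Re (\<phi> x))" for \<phi> :: "'a \<Rightarrow> complex"
      by (rule avg_linear) (simp add: bounded_linear.linear bounded_linear_Re)
    have "(cmod (wavg \<gamma> h xs z))\<^sup>2 = Re (wavg \<gamma> h xs z * cnj (wavg \<gamma> h xs z))"
      by (simp add: complex_mult_cnj cmod_power2)
    also have "wavg \<gamma> h xs z * cnj (wavg \<gamma> h xs z)
        = avg xs (\<lambda>v. avg xs (\<lambda>v'. (\<gamma> v * of_real (h (z + v))) * cnj (\<gamma> v' * of_real (h (z + v')))))"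
      unfolding wavg_def cn by (simp only: avg_mult_left avg_mult_right)
    also have "Re \<dots> = avg xs (\<lambda>v. avg xs (\<lambda>v'. Re (\<gamma> (v - v')) * (h (z + v) * h (z + v'))))"
      unfolding re by (intro avg_cong) (simp add: character_diff[OF \<gamma>] algebra_simps)
    finally show ?thesis .
  qed
  have "energy \<gamma> h xs = avg xs (\<lambda>v. avg xs (\<lambda>v'. m (\<lambda>z. Re (\<gamma> (v - v')) * (h (z + v) * h (z + v')))))"
    unfolding energy_def e
    by (subst m_avg, intro bfun_avg bfun_mult bfun_const bfun_comp[OF bh])
      (intro avg_cong m_avg bfun_mult bfun_const bfun_comp[OF bh])
  also have "\<dots> = avg xs (\<lambda>v. avg xs (\<lambda>v'. Re (\<gamma> (v - v')) * rho h (v - v')))"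
    by (intro avg_cong, subst m_cmult, intro bfun_mult bfun_comp[OF bh]) (simp add: m_prod_shift[OF bh])
  finally show ?thesis .
qed

text \<open>Averaging translates does not increase the energy, by Jensen's inequality, and averages
  over \<open>conv\<close> do not depend on the order of the lists. So one list does at least as
  well as finitely many given ones.\<close>

lemma energy_conv:
  "energy \<gamma> h (conv xs ys) \<le> energy \<gamma> h ys" "energy \<gamma> h (conv xs ys) \<le> energy \<gamma> h xs"
  if ne: "xs \<noteq> []" "ys \<noteq> []"
proof -
  have *: "energy \<gamma> h (conv xs ys) \<le> energy \<gamma> h ys" if "xs \<noteq> []" "ys \<noteq> []" for xs ys
  proof -
    have w: "wavg \<gamma> h (conv xs ys) z = avg xs (\<lambda>x. \<gamma> x * wavg \<gamma> h ys (z + x))" for z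
      unfolding wavg_def avg_conv avg_mult_left[symmetric] character_add[OF \<gamma>]
      by (simp add: algebra_simps)
    have "energy \<gamma> h (conv xs ys) \<le> m (\<lambda>z. avg xs (\<lambda>x. (cmod (wavg \<gamma> h ys (z + x)))\<^sup>2))"
      unfolding energy_def
    proof (rule m_mono)
      show "(cmod (wavg \<gamma> h (conv xs ys) z))\<^sup>2 \<le> avg xs (\<lambda>x. (cmod (wavg \<gamma> h ys (z + x)))\<^sup>2)" for z
        unfolding w using power2_norm_avg_le[of xs "\<lambda>x. \<gamma> x * wavg \<gamma> h ys (z + x)"]
        by (simp add: norm_mult \<gamma>)
    qed (intro bfun_avg bfun_energy[OF \<gamma> h] bfun_comp[OF bfun_energy[OF \<gamma> h]])+
    also have "\<dots> = avg xs (\<lambda>x. m (\<lambda>z. (cmod (wavg \<gamma> h ys (z + x)))\<^sup>2))"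
      by (rule m_avg) (rule bfun_comp[OF bfun_energy[OF \<gamma> h]])
    also have "\<dots> = avg xs (\<lambda>x. energy \<gamma> h ys)"
      unfolding energy_def by (intro avg_cong m_shift bfun_energy[OF \<gamma> h])
    finally show ?thesis using that by simp
  qed
  have "energy \<gamma> h (conv xs ys) = energy \<gamma> h (conv ys xs)"
  proof -
    have "wavg \<gamma> h (conv xs ys) z = wavg \<gamma> h (conv ys xs) z" for z
      unfolding wavg_def avg_conv by (subst avg_avg_swap) (simp add: add.commute)
    then show ?thesis by (simp add: energy_def)
  qed
  then show "energy \<gamma> h (conv xs ys) \<le> energy \<gamma> h ys" "energy \<gamma> h (conv xs ys) \<le> energy \<gamma> h xs"
    using *[OF ne] *[OF ne(2,1)] by auto
qed

end

text \<open>Up to the factor \<open>rho h 0\<close>, the form is the mean of the squared modulus of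
  a combination of translates of \<open>h\<close>.\<close>

lemma rho_pos_def:
  assumes h: "\<And>z. \<bar>h z\<bar> \<le> 1" and pos: "rho h 0 > 0"
  shows "(\<lambda>g. complex_of_real (rho h g / rho h 0)) \<in> pos_def"
proof -
  have bh: "bfun h" by (rule bfunI[OF h])
  have sym: "rho h (- g) = rho h g" for g
  proof -
    have "rho h (- g) = m (\<lambda>z. h (z + 0) * h (z + g))" using m_prod_shift[OF bh, of 0 g] by simp
    also have "\<dots> = rho h g" by (simp add: rho_def mult.commute)
    finally show ?thesis .
  qed
  have "0 \<le> Re (hform (\<lambda>g. complex_of_real (rho h g / rho h 0)) L L)" for L
  proof -
    define s where "s z = (\<Sum>p\<leftarrow>L. fst p * of_real (h (z + snd p)))" for z
    have Re_sl: "Re (\<Sum>p\<leftarrow>M. \<phi> p) = (\<Sum>p\<leftarrow>M. Re (\<phi> p))" and cnj_sl: "cnj (\<Sum>p\<leftarrow>M. \<phi> p) = (\<Sum>p\<leftarrow>M. cnj (\<phi> p))"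
      for M :: "(complex \<times> 'a) list" and \<phi> :: "complex \<times> 'a \<Rightarrow> complex"
      by (induction M) auto
    have e: "(cmod (s z))\<^sup>2 = (\<Sum>p\<leftarrow>L. \<Sum>q\<leftarrow>L. Re (fst p * cnj (fst q)) * (h (z + snd p) * h (z + snd q)))" for z
    proof -
      have "(cmod (s z))\<^sup>2 = Re (s z * cnj (s z))" by (simp add: complex_mult_cnj cmod_power2)
      also have "s z * cnj (s z) = (\<Sum>p\<leftarrow>L. \<Sum>q\<leftarrow>L. fst p * of_real (h (z + snd p)) * cnj (fst q * of_real (h (z + snd q))))"
        unfolding s_def cnj_sl unfolding sum_list_mult_const[symmetric] unfolding sum_list_const_mult[symmetric] ..
      also have "Re \<dots> = (\<Sum>p\<leftarrow>L. \<Sum>q\<leftarrow>L. Re (fst p * cnj (fst q)) * (h (z + snd p) * h (z + snd q)))"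
        unfolding Re_sl by (intro arg_cong[where f = sum_list] map_cong refl) (simp add: algebra_simps)
      finally show ?thesis .
    qed
    have bs: "bfun (\<lambda>x. \<Sum>p\<leftarrow>M. F p x)" if "\<And>p. bfun (F p)"
      for M :: "(complex \<times> 'a) list" and F :: "complex \<times> 'a \<Rightarrow> 'a \<Rightarrow> real"
      by (induction M) (auto simp: that)
    have b: "bfun (\<lambda>z. \<Sum>q\<leftarrow>L. Re (fst p * cnj (fst q)) * (h (z + snd p) * h (z + snd q)))" for p
      by (intro bs bfun_mult bfun_const bfun_comp[OF bh])
    have "bfun (\<lambda>z. (cmod (s z))\<^sup>2)" unfolding e by (intro bs bfun_mult bfun_const bfun_comp[OF bh])
    then have "0 \<le> m (\<lambda>z. (cmod (s z))\<^sup>2)" by (rule m_nonneg) simp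
    also have "m (\<lambda>z. (cmod (s z))\<^sup>2) = (\<Sum>p\<leftarrow>L. m (\<lambda>z. \<Sum>q\<leftarrow>L. Re (fst p * cnj (fst q)) * (h (z + snd p) * h (z + snd q))))"
      unfolding e by (rule m_sum_list) (rule b)
    also have "\<dots> = (\<Sum>p\<leftarrow>L. \<Sum>q\<leftarrow>L. m (\<lambda>z. Re (fst p * cnj (fst q)) * (h (z + snd p) * h (z + snd q))))"
      by (intro arg_cong[where f = sum_list] map_cong refl m_sum_list bfun_mult bfun_const bfun_comp[OF bh])
    also have "\<dots> = (\<Sum>p\<leftarrow>L. \<Sum>q\<leftarrow>L. Re (fst p * cnj (fst q)) * rho h (snd p - snd q))"
      by (intro arg_cong[where f = sum_list] map_cong refl, subst m_cmult, intro bfun_mult bfun_comp[OF bh])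
        (simp add: m_prod_shift[OF bh])
    also have "\<dots> = rho h 0 * Re (hform (\<lambda>g. complex_of_real (rho h g / rho h 0)) L L)"
      unfolding hform_def Re_sl sum_list_const_mult[symmetric] using pos
      by (intro arg_cong[where f = sum_list] map_cong refl) (simp add: field_simps)
    finally show ?thesis using pos by (simp add: zero_le_mult_iff)
  qed
  then show ?thesis using pos sym by (simp add: pos_def_def)
qed

text \<open>A weak form of Bochner's theorem: the functional \<open>J xs\<close> attains its maximum over positive
  definite functions at a character, and the normalised \<open>rho h\<close> already has a large value. One character serves
  all \<open>xs\<close> by compactness.\<close>

lemma exists_character_energy:
  assumes h: "\<And>z. \<bar>h z\<bar> \<le> 1" and c: "c > 0"
    and lb: "\<And>xs. xs \<noteq> [] \<Longrightarrow> c \<le> avg xs (\<lambda>v. avg xs (\<lambda>v'. (rho h (v - v'))\<^sup>2))"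
  obtains \<gamma> where "character \<gamma>" "\<And>xs. xs \<noteq> [] \<Longrightarrow> c \<le> energy \<gamma> h xs"
proof -
  have bh: "bfun h" by (rule bfunI[OF h])
  define r0 where "r0 = rho h 0"
  have "0 \<le> r0" unfolding r0_def rho_def by (rule m_nonneg) (intro bfun_mult bfun_comp[OF bh], simp)
  \<comment> \<open>The hypothesis for a list with one entry keeps \<open>rho h 0\<close> away from
    0.\<close>
  moreover have "c \<le> r0\<^sup>2" using lb[of "[0]"] by (simp add: avg_def r0_def)
  ultimately have r0: "0 < r0" using c by (cases "r0 = 0") auto
  have r1: "r0 \<le> 1" using rho_abs_le[of h 0] h by (simp add: r0_def)
  define J where "J xs \<sigma> = avg xs (\<lambda>v. avg xs (\<lambda>v'. Re (\<sigma> (v - v')) * rho h (v - v')))"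
    for xs and \<sigma> :: "'a \<Rightarrow> complex"
  have cont: "continuous_on UNIV (J xs)" for xs
    unfolding J_def avg_def
    by (intro continuous_on_scaleR continuous_on_const continuous_on_sum_list continuous_on_mult
        continuous_on_Re continuous_on_product_coordinates)
  have aff: "J xs x = t * J xs y + (1 - t) * J xs z"
    if "\<And>g. x g = of_real t * y g + of_real (1 - t) * z g" for xs x y z t
  proof -
    have "Re (x g) = t * Re (y g) + (1 - t) * Re (z g)" for g by (simp add: that)
    then show ?thesis unfolding J_def
      by (simp add: distrib_right mult.assoc avg_add avg_mult_left)
  qed
  have ex: "\<exists>\<gamma>. character \<gamma> \<and> c \<le> J xs \<gamma>" if ne: "xs \<noteq> []" for xs
  proof -
    have pd: "(\<lambda>g. complex_of_real (rho h g / rho h 0)) \<in> pos_def"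
      by (rule rho_pos_def[OF h]) (use r0 r0_def in auto)
    obtain \<gamma> where \<gamma>: "character \<gamma>" "\<gamma> \<in> pos_def" "\<And>\<sigma>. \<sigma> \<in> pos_def \<Longrightarrow> J xs \<sigma> \<le> J xs \<gamma>"
    proof (rule exists_character_in_face[of pos_def "J xs"])
      show "closed (pos_def :: ('a \<Rightarrow> complex) set)" by (rule closed_pos_def)
      show "pos_def \<noteq> ({} :: ('a \<Rightarrow> complex) set)" using pd by blast
      show "J xs x = t * J xs y + (1 - t) * J xs z"
        if "\<And>g. x g = of_real t * y g + of_real (1 - t) * z g" for x y z t using that by (rule aff)
    qed (auto intro: cont)
    \<comment> \<open>At the normalised \<open>rho h\<close> the functional is the average of the
      squares of \<open>rho h\<close> divided by \<open>r0\<close>, and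
      \<open>r0 \<le> 1\<close>.\<close>
    have "J xs (\<lambda>g. complex_of_real (rho h g / rho h 0)) = avg xs (\<lambda>v. avg xs (\<lambda>v'. inverse r0 * (rho h (v - v'))\<^sup>2))"
      unfolding J_def by (intro avg_cong) (simp add: r0_def power2_eq_square field_simps)
    also have "\<dots> = inverse r0 * avg xs (\<lambda>v. avg xs (\<lambda>v'. (rho h (v - v'))\<^sup>2))"
      by (simp only: avg_mult_left)
    also have "\<dots> \<ge> 1 * c"
      using lb[OF ne] r0 r1 c by (intro mult_mono) (auto simp: one_le_inverse)
    finally have "c \<le> J xs \<gamma>" using \<gamma>(3)[OF pd] by simp
    then show ?thesis using \<gamma>(1) by blast
  qed
  define C where "C xs = {\<gamma>. character \<gamma> \<and> c \<le> J xs \<gamma>}" for xs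
  have "closed (C xs)" for xs
    unfolding C_def character_def
    by (intro closed_Collect_conj closed_Collect_all closed_Collect_eq closed_Collect_le cont
        continuous_on_const continuous_on_norm continuous_on_mult continuous_on_product_coordinates)
  define K where "K = {\<sigma> :: 'a \<Rightarrow> complex. \<forall>g. \<sigma> g \<in> cball 0 1}"
  have "K \<inter> \<Inter>(C ` {xs. xs \<noteq> []}) \<noteq> {}"
  proof (rule compact_imp_fip)
    show "compact K" unfolding K_def by (rule compact_PiE_UNIV) simp
    show "closed T" if "T \<in> C ` {xs. xs \<noteq> []}" for T using that \<open>\<And>xs. closed (C xs)\<close> by auto
    fix \<F> assume \<F>: "finite \<F>" "\<F> \<subseteq> C ` {xs. xs \<noteq> []}"
    then obtain Xs where Xs: "finite Xs" "Xs \<subseteq> {xs. xs \<noteq> []}" "\<F> = C ` Xs"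
      by (meson finite_subset_image)
    \<comment> \<open>Finite intersections: the lists are merged by \<open>conv\<close>, and a
      character that is good for the merged list is good for each of them.\<close>
    have "\<exists>ys. ys \<noteq> [] \<and> (\<forall>xs\<in>Xs. \<forall>\<gamma>. character \<gamma> \<longrightarrow> energy \<gamma> h ys \<le> energy \<gamma> h xs)"
      using Xs(1,2)
    proof (induction Xs rule: finite_induct)
      case empty
      show ?case by (intro exI[of _ "[0]"]) simp
    next
      case (insert x Xs)
      then obtain ys where ys: "ys \<noteq> []" "\<forall>xs\<in>Xs. \<forall>\<gamma>. character \<gamma> \<longrightarrow> energy \<gamma> h ys \<le> energy \<gamma> h xs" by auto
      have x: "x \<noteq> []" using insert by auto
      show ?case
      proof (intro exI[of _ "conv x ys"] conjI ballI allI impI)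
        show "conv x ys \<noteq> []" using x ys by simp
        show "energy \<gamma> h (conv x ys) \<le> energy \<gamma> h xs" if "xs \<in> insert x Xs" "character \<gamma>" for xs \<gamma>
          using energy_conv[where h = h, OF that(2) h x ys(1)] that ys(2) by (auto intro: order_trans)
      qed
    qed
    then obtain ys where ys: "ys \<noteq> []" "\<And>xs \<gamma>. xs \<in> Xs \<Longrightarrow> character \<gamma> \<Longrightarrow> energy \<gamma> h ys \<le> energy \<gamma> h xs" by blast
    obtain \<gamma> where \<gamma>: "character \<gamma>" "c \<le> J ys \<gamma>" using ex[OF ys(1)] by blast
    have JE: "J xs \<gamma> = energy \<gamma> h xs" for xs unfolding J_def by (rule energy_eq[OF \<gamma>(1) h, symmetric])
    have "\<gamma> \<in> C xs" if "xs \<in> Xs" for xs using ys(2)[OF that \<gamma>(1)] \<gamma> by (simp add: C_def JE)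
    moreover have "\<gamma> \<in> K" using \<gamma>(1) by (simp add: K_def)
    ultimately show "K \<inter> \<Inter>\<F> \<noteq> {}" using Xs(3) by blast
  qed
  then obtain \<gamma> where \<gamma>: "\<And>xs. xs \<noteq> [] \<Longrightarrow> \<gamma> \<in> C xs" by blast
  show thesis
  proof
    show ch: "character \<gamma>" using \<gamma>[of "[0]"] by (simp add: C_def)
    show "c \<le> energy \<gamma> h xs" if "xs \<noteq> []" for xs
      using \<gamma>[OF that] energy_eq[where h = h, OF ch h, of xs] by (simp add: C_def J_def)
  qed
qed

text \<open>Otherwise some character has energy at least \<open>2 * \<eta>\<close> on every list,
  and the real part of an almost minimal average is an almost periodic test function that correlates
  too strongly with \<open>h\<close>.\<close>

lemma rho_small_if_orthogonal:
  assumes h: "\<And>z. \<bar>h z\<bar> \<le> 1" and \<eta>: "\<eta> > 0" and e: "e > 0"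
    and orth: "\<And>Q. Q \<in> bohr_ap e \<Longrightarrow> (\<And>z. \<bar>Q z\<bar> \<le> 1) \<Longrightarrow> m (\<lambda>z. h z * Q z) \<le> \<eta>"
  shows "\<exists>xs. xs \<noteq> [] \<and> avg xs (\<lambda>v. avg xs (\<lambda>v'. (rho h (v - v'))\<^sup>2)) < 2 * \<eta>"
proof (rule ccontr)
  assume "\<not> ?thesis"
  then have lb: "2 * \<eta> \<le> avg xs (\<lambda>v. avg xs (\<lambda>v'. (rho h (v - v'))\<^sup>2))" if "xs \<noteq> []" for xs
    using that by (meson not_le)
  obtain \<gamma> where \<gamma>: "character \<gamma>" and E: "\<And>xs. xs \<noteq> [] \<Longrightarrow> 2 * \<eta> \<le> energy \<gamma> h xs"
    using exists_character_energy[OF h _ lb] \<eta> by auto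
  define I where "I = Inf (energy \<gamma> h ` {xs. xs \<noteq> []})"
  have bdd: "bdd_below (energy \<gamma> h ` {xs. xs \<noteq> []})" using E by (auto intro!: bdd_belowI2)
  have I: "I \<le> energy \<gamma> h xs" if "xs \<noteq> []" for xs
    unfolding I_def using that by (intro cInf_lower bdd) auto
  \<comment> \<open>The test function will change by at most
    \<open>2 * (4 * \<kappa>) + \<kappa>\<close> in squared seminorm, whence \<open>e / 9\<close>;
    the other bound keeps the loss \<open>2 * sqrt \<kappa>\<close> at or below
    \<open>\<eta> / 2\<close>.\<close>
  define \<kappa> where "\<kappa> = min (e / 9) ((\<eta> / 4)\<^sup>2)"
  have \<kappa>: "\<kappa> > 0" "9 * \<kappa> \<le> e" "\<kappa> \<le> (\<eta> / 4)\<^sup>2" using e \<eta> by (auto simp: \<kappa>_def min_def)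
  have sk: "sqrt \<kappa> \<le> \<eta> / 4" using real_sqrt_le_mono[OF \<kappa>(3)] \<eta> by simp
  have "\<exists>xs. xs \<noteq> [] \<and> energy \<gamma> h xs < I + \<kappa>"
    using cInf_lessD[of "energy \<gamma> h ` {xs. xs \<noteq> []}" "I + \<kappa>"] \<kappa>(1) by (auto simp: I_def)
  then obtain xs where xs: "xs \<noteq> []" "energy \<gamma> h xs \<le> I + \<kappa>" by (meson less_imp_le)
  let ?a = "wavg \<gamma> h xs"
  define Q where "Q z = Re (?a z)" for z
  have Q1: "\<bar>Q z\<bar> \<le> 1" for z
    unfolding Q_def using abs_Re_le_cmod[of "?a z"] cmod_wavg_le[where h = h, OF \<gamma> h, of xs z] by linarith
  have bQ: "bfun Q" by (rule bfunI[OF Q1])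
  have "eventually (\<lambda>u. cmod (\<gamma> u - 1) < sqrt (\<kappa> / 2)) bohr_filter"
    using tendstoD[OF tendsto_character[OF \<gamma>], of "sqrt (\<kappa> / 2)"] \<kappa>(1) by (simp add: dist_norm)
  then have "eventually (\<lambda>u. m (\<lambda>z. (Q (z + u) - Q z)\<^sup>2) \<le> e) bohr_filter"
  proof (rule eventually_mono)
    fix u assume u: "cmod (\<gamma> u - 1) < sqrt (\<kappa> / 2)"
    let ?d = "\<lambda>z. \<gamma> u * ?a (z + u) - ?a z"
    have bd: "cmod (?d z) \<le> 2" for z
      using norm_triangle_ineq4[of "\<gamma> u * ?a (z + u)" "?a z"]
        cmod_wavg_le[where h = h, OF \<gamma> h, of xs z] cmod_wavg_le[where h = h, OF \<gamma> h, of xs "z + u"] by (simp add: norm_mult \<gamma>)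
    have "(cmod (\<gamma> u - 1))\<^sup>2 \<le> (sqrt (\<kappa> / 2))\<^sup>2" using u by (intro power_mono) auto
    then have g: "(cmod (\<gamma> u - 1))\<^sup>2 \<le> \<kappa> / 2" using \<kappa>(1) by simp
    have "m (\<lambda>z. (Q (z + u) - Q z)\<^sup>2) \<le> m (\<lambda>z. 2 * (cmod (?d z))\<^sup>2 + \<kappa>)"
    proof (rule m_mono)
      show "bfun (\<lambda>z. (Q (z + u) - Q z)\<^sup>2)" by (intro bfun_power2 bfun_diff bQ bfun_comp[OF bQ])
      show "bfun (\<lambda>z. 2 * (cmod (?d z))\<^sup>2 + \<kappa>)"
        by (intro bfun_add bfun_mult bfun_const bfun_cmod2[OF \<gamma> h bd])
      fix z
      \<comment> \<open>The change splits into the defect of the eigenfunction equation and the part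
        due to \<open>\<gamma> u\<close> not being 1.\<close>
      have "Q (z + u) - Q z = Re (?d z + (1 - \<gamma> u) * ?a (z + u))"
        by (simp add: Q_def algebra_simps)
      also have "\<bar>\<dots>\<bar> \<le> cmod (?d z + (1 - \<gamma> u) * ?a (z + u))" by (rule abs_Re_le_cmod)
      also have "\<dots> \<le> cmod (?d z) + cmod (1 - \<gamma> u) * cmod (?a (z + u))"
        by (metis norm_mult norm_triangle_ineq)
      also have "\<dots> \<le> cmod (?d z) + cmod (\<gamma> u - 1) * 1"
        using cmod_wavg_le[where h = h, OF \<gamma> h, of xs "z + u"]
        by (intro add_left_mono mult_mono) (auto simp: norm_minus_commute)
      finally have "(Q (z + u) - Q z)\<^sup>2 \<le> (cmod (?d z) + cmod (\<gamma> u - 1))\<^sup>2"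
        by (simp add: abs_le_square_iff[symmetric])
      also have "\<dots> \<le> 2 * (cmod (?d z))\<^sup>2 + 2 * (cmod (\<gamma> u - 1))\<^sup>2"
        using zero_le_power2[of "cmod (?d z) - cmod (\<gamma> u - 1)"] by (simp only: power2_sum power2_diff)
      finally show "(Q (z + u) - Q z)\<^sup>2 \<le> 2 * (cmod (?d z))\<^sup>2 + \<kappa>" using g by linarith
    qed
    also have "\<dots> = 2 * m (\<lambda>z. (cmod (?d z))\<^sup>2) + \<kappa>"
      by (subst m_add, intro bfun_mult bfun_const bfun_cmod2[OF \<gamma> h bd], rule bfun_const,
          subst m_cmult, rule bfun_cmod2[OF \<gamma> h bd]) simp
    also have "\<dots> \<le> 2 * (4 * \<kappa>) + \<kappa>"
      using near_minimal_shift[where h = h and u = u, OF \<gamma> h I xs] by simp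
    also have "\<dots> \<le> e" using \<kappa>(2) by simp
    finally show "m (\<lambda>z. (Q (z + u) - Q z)\<^sup>2) \<le> e" .
  qed
  then have "Q \<in> bohr_ap e" using bQ by (simp add: bohr_ap_def)
  then have "m (\<lambda>z. h z * Q z) \<le> \<eta>" using Q1 by (rule orth)
  moreover have "energy \<gamma> h xs - 2 * sqrt \<kappa> \<le> m (\<lambda>z. h z * Q z)"
    unfolding Q_def by (rule near_minimal_corr[OF \<gamma> h I xs])
  ultimately show False using E[OF xs(1)] sk \<eta> by linarith
qed

lemma tau_nonneg: "(\<And>z. \<bar>h z\<bar> \<le> 1) \<Longrightarrow> 0 \<le> tau h xs g"
  unfolding tau_def
  by (intro m_nonneg bfun_power2 bfun_avg bfun_mult bfun_comp[OF bfunI]) auto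

lemma boxform_eq:
  assumes h: "\<And>z. \<bar>h z\<bar> \<le> 1"
  shows "boxform h xs ys = avg ys (\<lambda>v. avg ys (\<lambda>v'. avg xs (\<lambda>y. avg xs (\<lambda>y'.
     m (\<lambda>z. h (z + y + v) * h (z + y + v') * (h (z + y' + v) * h (z + y' + v')))))))"
proof -
  have bh: "bfun h" by (rule bfunI[OF h])
  have "tau h xs (v - v') = avg xs (\<lambda>y. avg xs (\<lambda>y'.
     m (\<lambda>z. h (z + y + v) * h (z + y + v') * (h (z + y' + v) * h (z + y' + v')))))" for v v'
  proof -
    have "bfun (\<lambda>z. (avg xs (\<lambda>y. h (z + y + (v - v')) * h (z + y)))\<^sup>2)"
      by (intro bfun_power2 bfun_avg bfun_mult bfun_comp[OF bh])
    from m_shift[OF this, of v', symmetric]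
    have "tau h xs (v - v') = m (\<lambda>z. (avg xs (\<lambda>y. h (z + v' + y + (v - v')) * h (z + v' + y)))\<^sup>2)"
      by (simp add: tau_def)
    also have "(\<lambda>z. (avg xs (\<lambda>y. h (z + v' + y + (v - v')) * h (z + v' + y)))\<^sup>2)
      = (\<lambda>z. avg xs (\<lambda>y. avg xs (\<lambda>y'. h (z + y + v) * h (z + y + v') * (h (z + y' + v) * h (z + y' + v')))))"
    proof
      fix z
      have "avg xs (\<lambda>y. h (z + v' + y + (v - v')) * h (z + v' + y)) = avg xs (\<lambda>y. h (z + y + v) * h (z + y + v'))"
        by (intro avg_cong) (simp add: algebra_simps)
      then show "(avg xs (\<lambda>y. h (z + v' + y + (v - v')) * h (z + v' + y)))\<^sup>2
        = avg xs (\<lambda>y. avg xs (\<lambda>y'. h (z + y + v) * h (z + y + v') * (h (z + y' + v) * h (z + y' + v'))))"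
        by (simp only: power2_eq_square avg_mult_left avg_mult_right)
    qed
    also have "m \<dots> = avg xs (\<lambda>y. avg xs (\<lambda>y'.
     m (\<lambda>z. h (z + y + v) * h (z + y + v') * (h (z + y' + v) * h (z + y' + v')))))"
      by (subst m_avg, intro bfun_avg bfun_mult bfun_comp[OF bh])
        (intro avg_cong m_avg bfun_mult bfun_comp[OF bh])
    finally show ?thesis .
  qed
  then show ?thesis by (simp only: boxform_def)
qed

text \<open>The corners are symmetric in the two lists. A reduction proved for one list can
  therefore be applied to the other as well.\<close>

lemma boxform_commute:
  assumes h: "\<And>z. \<bar>h z\<bar> \<le> 1" shows "boxform h xs ys = boxform h ys xs"
proof -
  define \<Phi> where "\<Phi> v v' y y' = m (\<lambda>z. h (z + y + v) * h (z + y + v') * (h (z + y' + v) * h (z + y' + v')))"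
    for v v' y y'
  have sym: "\<Phi> v v' y y' = \<Phi> y y' v v'" for v v' y y'
    unfolding \<Phi>_def by (rule arg_cong[where f = m]) (auto simp: fun_eq_iff algebra_simps)
  have "boxform h xs ys = avg ys (\<lambda>v. avg ys (\<lambda>v'. avg xs (\<lambda>y. avg xs (\<lambda>y'. \<Phi> v v' y y'))))"
    unfolding boxform_eq[OF h] \<Phi>_def ..
  also have "\<dots> = avg ys (\<lambda>v. avg xs (\<lambda>y. avg ys (\<lambda>v'. avg xs (\<lambda>y'. \<Phi> v v' y y'))))"
    by (intro avg_cong avg_avg_swap)
  also have "\<dots> = avg xs (\<lambda>y. avg ys (\<lambda>v. avg ys (\<lambda>v'. avg xs (\<lambda>y'. \<Phi> v v' y y'))))"
    by (rule avg_avg_swap)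
  also have "\<dots> = avg xs (\<lambda>y. avg ys (\<lambda>v. avg xs (\<lambda>y'. avg ys (\<lambda>v'. \<Phi> v v' y y'))))"
    by (intro avg_cong avg_avg_swap)
  also have "\<dots> = avg xs (\<lambda>y. avg xs (\<lambda>y'. avg ys (\<lambda>v. avg ys (\<lambda>v'. \<Phi> v v' y y'))))"
    by (intro avg_cong avg_avg_swap)
  also have "\<dots> = avg xs (\<lambda>y. avg xs (\<lambda>y'. avg ys (\<lambda>v. avg ys (\<lambda>v'. \<Phi> y y' v v'))))"
    by (simp only: sym)
  also have "\<dots> = boxform h ys xs" unfolding boxform_eq[OF h] \<Phi>_def ..
  finally show ?thesis .
qed

end

text \<open>Some coset contains a fraction \<open>1 / card\<close> of the list; as \<open>\<tau>\<close> is nonnegative, the pairs outside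
  that coset may be dropped.\<close>

lemma coset_pigeonhole:
  fixes \<tau> :: "'a::ab_group_add \<Rightarrow> real"
  assumes \<tau>: "\<And>g. 0 \<le> \<tau> g" and ys: "ys \<noteq> []"
    and fin: "finite_index (mult_set q :: 'a set)" 
  shows "\<exists>us. us \<noteq> [] \<and> avg us (\<lambda>u. avg us (\<lambda>u'. \<tau> (zmul q u - zmul q u'))) \<le>
    (real (card {(\<lambda>h. g + h) ` (mult_set q :: 'a set) | g. True}))\<^sup>2 * avg ys (\<lambda>v. avg ys (\<lambda>v'. \<tau> (v - v')))"
proof -
  define cos where "cos v = (\<lambda>h. v + h) ` (mult_set q :: 'a set)" for v
  define \<C> where "\<C> = {(\<lambda>h. g + h) ` (mult_set q :: 'a set) | g. True}"
  have f\<C>: "finite \<C>" using fin by (simp add: finite_index_def \<C>_def)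
  have cos\<C>: "cos v \<in> \<C>" for v by (auto simp: cos_def \<C>_def)
  define l where "l C = length (filter (\<lambda>v. cos v = C) ys)" for C
  have "length ys = (\<Sum>C\<in>\<C>. l C)"
  proof -
    have "length xs = (\<Sum>C\<in>\<C>. length (filter (\<lambda>v. cos v = C) xs))" for xs
    proof (induction xs)
      case (Cons x xs)
      have "(\<Sum>C\<in>\<C>. length (filter (\<lambda>v. cos v = C) (x # xs)))
          = (\<Sum>C\<in>\<C>. (if cos x = C then 1 else 0) + length (filter (\<lambda>v. cos v = C) xs))"
        by (intro sum.cong) auto
      also have "\<dots> = 1 + length xs" by (simp add: sum.distrib f\<C> cos\<C> flip: Cons)
      finally show ?case by simp
    qed simp
    from this[of ys] show ?thesis by (simp only: l_def)
  qed
  also have "\<exists>C\<in>\<C>. (\<Sum>C\<in>\<C>. l C) \<le> card \<C> * l C"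
  proof (rule ccontr)
    assume "\<not> ?thesis"
    then have less: "card \<C> * l C < (\<Sum>C\<in>\<C>. l C)" if "C \<in> \<C>" for C using that by (meson not_le)
    have ne: "\<C> \<noteq> {}" using cos\<C> by auto
    have "(\<Sum>C\<in>\<C>. card \<C> * l C) < (\<Sum>C\<in>\<C>. (\<Sum>C\<in>\<C>. l C))"
      by (rule sum_strict_mono[OF f\<C> ne]) (rule less)
    then show False by (simp add: sum_distrib_left)
  qed
  finally obtain C where C: "C \<in> \<C>" "length ys \<le> card \<C> * l C" by blast
  define ws where "ws = filter (\<lambda>v. cos v = C) ys"
  have lws: "length ws = l C" by (simp add: ws_def l_def)
  have lC: "0 < l C" using C(2) ys by (cases "l C") auto
  then obtain v0 where v0: "v0 \<in> set ws" using lws by (cases ws) auto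
  \<comment> \<open>Subtracting a common base point turns a list inside one coset into multiples of
    \<open>q\<close> without changing differences.\<close>
  have "\<exists>u. w = v0 + zmul q u" if "w \<in> set ws" for w
  proof -
    have "cos w = cos v0" using that v0 by (simp add: ws_def)
    moreover have "w \<in> cos w" using subgroup_mult_set(1)[of q] by (auto simp: cos_def image_iff intro!: bexI[of _ 0])
    ultimately have "w \<in> cos v0" by simp
    then show ?thesis by (auto simp: cos_def mult_set_def)
  qed
  then obtain f where f: "\<And>w. w \<in> set ws \<Longrightarrow> w = v0 + zmul q (f w)" by metis
  define us where "us = map f ws"
  have le: "(\<Sum>x\<leftarrow>filter P xs. \<phi> x) \<le> (\<Sum>x\<leftarrow>xs. \<phi> x)" if "\<And>x. 0 \<le> \<phi> x"
    for P and xs :: "'a list" and \<phi> :: "'a \<Rightarrow> real"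
    by (induction xs) (auto intro: add_mono that order_trans[OF _ add_increasing[OF that order_refl]])
  have unfold: "avg xs (\<lambda>v. avg xs (\<lambda>v'. \<psi> v v')) = (\<Sum>v\<leftarrow>xs. \<Sum>v'\<leftarrow>xs. \<psi> v v') / (real (length xs))\<^sup>2"
    for xs :: "'a list" and \<psi> :: "'a \<Rightarrow> 'a \<Rightarrow> real"
    unfolding avg_def real_scaleR_def sum_list_const_mult by (simp add: power2_eq_square field_simps)
  have "avg us (\<lambda>u. avg us (\<lambda>u'. \<tau> (zmul q u - zmul q u'))) = avg ws (\<lambda>w. avg ws (\<lambda>w'. \<tau> (w - w')))"
    unfolding us_def avg_map
  proof (intro avg_cong)
    fix w w' assume w: "w \<in> set ws" "w' \<in> set ws"
    have "w - w' = zmul q (f w) - zmul q (f w')"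
      by (subst f[OF w(1)], subst f[OF w(2)]) simp
    then show "\<tau> (zmul q (f w) - zmul q (f w')) = \<tau> (w - w')" by simp
  qed
  also have "\<dots> = (\<Sum>v\<leftarrow>ws. \<Sum>v'\<leftarrow>ws. \<tau> (v - v')) / (real (l C))\<^sup>2"
    unfolding unfold lws ..
  also have "\<dots> \<le> (\<Sum>v\<leftarrow>ys. \<Sum>v'\<leftarrow>ys. \<tau> (v - v')) / (real (l C))\<^sup>2"
  proof (rule divide_right_mono)
    have "(\<Sum>v\<leftarrow>ws. \<Sum>v'\<leftarrow>ws. \<tau> (v - v')) \<le> (\<Sum>v\<leftarrow>ws. \<Sum>v'\<leftarrow>ys. \<tau> (v - v'))"
      by (rule sum_list_mono) (simp add: ws_def le \<tau>)
    also have "\<dots> \<le> (\<Sum>v\<leftarrow>ys. \<Sum>v'\<leftarrow>ys. \<tau> (v - v'))"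
      unfolding ws_def by (rule le) (rule sum_list_nonneg, use \<tau> in auto)
    finally show "(\<Sum>v\<leftarrow>ws. \<Sum>v'\<leftarrow>ws. \<tau> (v - v')) \<le> (\<Sum>v\<leftarrow>ys. \<Sum>v'\<leftarrow>ys. \<tau> (v - v'))" .
  qed simp
  also have "\<dots> \<le> (real (card \<C>))\<^sup>2 * ((\<Sum>v\<leftarrow>ys. \<Sum>v'\<leftarrow>ys. \<tau> (v - v')) / (real (length ys))\<^sup>2)"
  proof -
    define T where "T = (\<Sum>v\<leftarrow>ys. \<Sum>v'\<leftarrow>ys. \<tau> (v - v'))"
    have T: "0 \<le> T" unfolding T_def by (rule sum_list_nonneg, clarsimp, rule sum_list_nonneg) (use \<tau> in auto)
    have n: "0 < real (length ys)" using ys by simp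
    have "real (length ys) \<le> real (card \<C>) * real (l C)" using C(2) by (simp flip: of_nat_mult)
    then have "(real (length ys))\<^sup>2 \<le> (real (card \<C>) * real (l C))\<^sup>2" by (intro power_mono) auto
    then have "T * (real (length ys))\<^sup>2 \<le> T * (real (card \<C>) * real (l C))\<^sup>2" using T by (rule mult_left_mono)
    then show ?thesis unfolding T_def[symmetric] using n lC
      by (simp add: divide_simps power_mult_distrib mult_ac)
  qed
  finally have "avg us (\<lambda>u. avg us (\<lambda>u'. \<tau> (zmul q u - zmul q u'))) \<le> (real (card \<C>))\<^sup>2 * avg ys (\<lambda>v. avg ys (\<lambda>v'. \<tau> (v - v')))"
    unfolding unfold[of ys] .
  moreover have "us \<noteq> []" using lws lC by (auto simp: us_def)
  ultimately show ?thesis unfolding \<C>_def by blast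
qed

section \<open>Box forms along multiples and the van der Corput inequality\<close>

context mean
begin

text \<open>Small box forms come with uncontrolled lists, whereas the van der Corput inequality
  needs lists of multiples. The constant, a product of squared indices, is independent of
  \<open>h\<close>, which is chosen later.\<close>

lemma boxform_multiples:
  assumes l: "finite_index (mult_set l :: 'a set)" and q: "finite_index (mult_set q :: 'a set)"
  shows "\<exists>C>0. \<forall>h xs ys. (\<forall>z. \<bar>h z\<bar> \<le> 1) \<longrightarrow> xs \<noteq> [] \<longrightarrow> ys \<noteq> [] \<longrightarrow>
    (\<exists>bs us. bs \<noteq> [] \<and> us \<noteq> [] \<and> boxform h (map (zmul l) bs) (map (zmul q) us) \<le> C * boxform h xs ys)"
proof -
  define k where "k q = (real (card {(\<lambda>h. g + h) ` (mult_set q :: 'a set) | g. True}))\<^sup>2" for q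
  have step: "\<exists>us. us \<noteq> [] \<and> boxform h xs (map (zmul q) us) \<le> k q * boxform h xs ys"
    if h: "\<And>z. \<bar>h z\<bar> \<le> 1" and "ys \<noteq> []" "finite_index (mult_set q :: 'a set)" for h xs ys q
    using coset_pigeonhole[of "tau h xs" ys q] tau_nonneg[OF h] that
    by (simp add: boxform_def avg_map k_def)
  have kpos: "0 < k q" if "finite_index (mult_set q :: 'a set)" for q
  proof -
    have "{(\<lambda>h. g + h) ` (mult_set q :: 'a set) | g. True} \<noteq> {}" by auto
    then have "card {(\<lambda>h. g + h) ` (mult_set q :: 'a set) | g. True} \<noteq> 0"
      using that unfolding finite_index_def by (metis card_eq_0_iff)
    then show ?thesis by (simp add: k_def)
  qed
  show ?thesis
  proof (intro exI[of _ "k l * k q"] conjI allI impI)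
    show "0 < k l * k q" using kpos[OF l] kpos[OF q] by simp
    fix h :: "'a \<Rightarrow> real" and xs ys :: "'a list"
    assume h': "\<forall>z. \<bar>h z\<bar> \<le> 1" and ne: "xs \<noteq> []" "ys \<noteq> []"
    have h: "\<bar>h z\<bar> \<le> 1" for z using h' by blast
    obtain us where us: "us \<noteq> []" "boxform h xs (map (zmul q) us) \<le> k q * boxform h xs ys"
      using step[where h = h and xs = xs, OF h ne(2) q] by blast
    obtain bs where bs: "bs \<noteq> []"
      "boxform h (map (zmul q) us) (map (zmul l) bs) \<le> k l * boxform h (map (zmul q) us) xs"
      using step[where h = h and xs = "map (zmul q) us", OF h ne(1) l] by blast
    have "boxform h (map (zmul l) bs) (map (zmul q) us) \<le> k l * boxform h xs (map (zmul q) us)"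
      using bs(2) unfolding boxform_commute[where h = h and xs = "map (zmul q) us", OF h] .
    also have "\<dots> \<le> k l * (k q * boxform h xs ys)"
      using us(2) kpos[OF l] by (intro mult_left_mono) auto
    finally show "\<exists>bs us. bs \<noteq> [] \<and> us \<noteq> [] \<and>
         boxform h (map (zmul l) bs) (map (zmul q) us) \<le> k l * k q * boxform h xs ys"
      using us(1) bs(1) by (metis mult.assoc)
  qed
qed

text \<open>Averaging in \<open>y\<close> and Cauchy-Schwarz in \<open>z\<close> remove
  \<open>g\<close>. After translating \<open>z\<close> by \<open>- zmul p y\<close> the variable
  \<open>y\<close> survives only in the shift \<open>zmul (q - p) y\<close>, and a second averaging
  with Cauchy-Schwarz removes \<open>g1\<close>.\<close>

lemma van_der_Corput:
  assumes g: "\<And>z. \<bar>g z\<bar> \<le> 1" and g1: "\<And>z. \<bar>g1 z\<bar> \<le> 1" and h: "\<And>z. \<bar>h z\<bar> \<le> 1"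
    and bs: "bs \<noteq> []" and us: "us \<noteq> []"
  shows "(m (\<lambda>y. m (\<lambda>z. g z * (g1 (z + zmul p y + w) * h (z + zmul q y)))))\<^sup>2
    \<le> sqrt (boxform h (map (zmul (q - p)) bs) (map (zmul q) us))"
proof -
  have bg: "bfun g" and bg1: "bfun g1" and bh: "bfun h" using g g1 h by (auto intro: bfunI)
  define X where "X y z = g1 (z + zmul p y + w) * h (z + zmul q y)" for y z
  have X1: "\<bar>X y z\<bar> \<le> 1" for y z unfolding X_def by (auto simp: abs_mult intro!: mult_le_one g1 h)
  have bX: "bfun (X y)" for y by (rule bfunI[OF X1])
  define A where "A y z = avg us (\<lambda>u. X (y + u) z)" for y z
  have A1: "\<bar>A y z\<bar> \<le> 1" for y z
    unfolding A_def using norm_avg_le_const[of "\<lambda>u. X (y + u) z" 1 us] X1 by simp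
  have bA: "bfun (A y)" for y by (rule bfunI[OF A1])
  define \<Theta> where "\<Theta> y = m (\<lambda>z. g z * X y z)" for y
  have \<Theta>1: "\<bar>\<Theta> y\<bar> \<le> 1" for y
    unfolding \<Theta>_def by (rule m_abs_le) (auto simp: abs_mult intro!: mult_le_one g X1)
  have b\<Theta>: "bfun \<Theta>" by (rule bfunI[OF \<Theta>1])
  have "m \<Theta> = avg us (\<lambda>u. m (\<lambda>y. \<Theta> (y + u)))" using us by (simp add: m_shift[OF b\<Theta>])
  also have "\<dots> = m (\<lambda>y. avg us (\<lambda>u. \<Theta> (y + u)))" by (rule m_avg[symmetric]) (rule bfun_comp[OF b\<Theta>])
  also have "(\<lambda>y. avg us (\<lambda>u. \<Theta> (y + u))) = (\<lambda>y. m (\<lambda>z. g z * A y z))"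
    unfolding \<Theta>_def A_def avg_mult_left[symmetric]
    by (intro ext m_avg[symmetric] bfun_mult bg bX)
  finally have m\<Theta>: "m \<Theta> = m (\<lambda>y. m (\<lambda>z. g z * A y z))" .
  have gA: "\<bar>m (\<lambda>z. g z * A y z)\<bar> \<le> 1" for y
    by (rule m_abs_le) (auto simp: abs_mult intro!: mult_le_one g A1)
  have "(m \<Theta>)\<^sup>2 \<le> m (\<lambda>y. (m (\<lambda>z. g z * A y z))\<^sup>2)"
    unfolding m\<Theta> by (rule power2_m_le) (rule bfunI[OF gA])
  also have "\<dots> \<le> m (\<lambda>y. m (\<lambda>z. (A y z)\<^sup>2))"
  proof (rule m_mono)
    show "bfun (\<lambda>y. (m (\<lambda>z. g z * A y z))\<^sup>2)" by (intro bfun_power2 bfunI[OF gA])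
    show "bfun (\<lambda>y. m (\<lambda>z. (A y z)\<^sup>2))"
      by (rule bfun_m[of _ 1]) (simp add: A1 abs_square_le_1)
    show "(m (\<lambda>z. g z * A y z))\<^sup>2 \<le> m (\<lambda>z. (A y z)\<^sup>2)" for y
      using power_mono[OF abs_m_mult_le[OF bA g], where n = 2] by (simp add: power2_nrm bA)
  qed
  also have "(\<lambda>y. m (\<lambda>z. (A y z)\<^sup>2)) = (\<lambda>y. avg us (\<lambda>u. avg us (\<lambda>u'. m (\<lambda>z. X (y + u) z * X (y + u') z))))"
  proof
    fix y
    have "(A y z)\<^sup>2 = avg us (\<lambda>u. avg us (\<lambda>u'. X (y + u) z * X (y + u') z))" for z
      unfolding A_def power2_eq_square by (simp only: avg_mult_left avg_mult_right)
    then show "m (\<lambda>z. (A y z)\<^sup>2) = avg us (\<lambda>u. avg us (\<lambda>u'. m (\<lambda>z. X (y + u) z * X (y + u') z)))"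
      by (simp only:) (subst m_avg, intro bfun_avg bfun_mult bX, intro avg_cong m_avg bfun_mult bX)
  qed
  also have "m \<dots> = avg us (\<lambda>u. avg us (\<lambda>u'. m (\<lambda>y. m (\<lambda>z. X (y + u) z * X (y + u') z))))"
  proof -
    have b: "bfun (\<lambda>y. m (\<lambda>z. X (y + u) z * X (y + u') z))" for u u'
      by (rule bfun_m[of _ 1]) (auto simp: abs_mult intro!: mult_le_one X1)
    show ?thesis by (subst m_avg, intro bfun_avg b, intro avg_cong m_avg b)
  qed
  also have "\<dots> \<le> avg us (\<lambda>u. avg us (\<lambda>u'. sqrt (tau h (map (zmul (q - p)) bs) (zmul q u - zmul q u'))))"
  proof (intro avg_mono)
    fix u u'
    define G where "G z = g1 (z + zmul p u + w) * g1 (z + zmul p u' + w)" for z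
    define V where "V z = h (z + zmul q u) * h (z + zmul q u')" for z
    have G1: "\<bar>G z\<bar> \<le> 1" and V1: "\<bar>V z\<bar> \<le> 1" for z
      unfolding G_def V_def by (auto simp: abs_mult intro!: mult_le_one g1 h)
    have bG: "bfun G" and bV: "bfun V" using G1 V1 by (auto intro: bfunI)
    define \<Psi> where "\<Psi> y = m (\<lambda>z. G z * V (z + zmul (q - p) y))" for y
    have \<Psi>1: "\<bar>\<Psi> y\<bar> \<le> 1" for y
      unfolding \<Psi>_def by (rule m_abs_le) (auto simp: abs_mult intro!: mult_le_one G1 V1)
    have b\<Psi>: "bfun \<Psi>" by (rule bfunI[OF \<Psi>1])
    have "m (\<lambda>z. X (y + u) z * X (y + u') z) = \<Psi> y" for y
    proof -
      have b: "bfun (\<lambda>z. X (y + u) z * X (y + u') z)" by (intro bfun_mult bX)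
      have "X (y + u) (z + - zmul p y) * X (y + u') (z + - zmul p y) = G z * V (z + zmul (q - p) y)" for z
        unfolding X_def G_def V_def zmul_add_right zmul_diff_left by (simp add: algebra_simps)
      then show ?thesis using m_shift[OF b, of "- zmul p y"] by (simp add: \<Psi>_def)
    qed
    then have "m (\<lambda>y. m (\<lambda>z. X (y + u) z * X (y + u') z)) = m \<Psi>" by simp
    also have "\<dots> = avg bs (\<lambda>b. m (\<lambda>y. \<Psi> (y + b)))" using bs by (simp add: m_shift[OF b\<Psi>])
    also have "\<dots> = m (\<lambda>y. avg bs (\<lambda>b. \<Psi> (y + b)))" by (rule m_avg[symmetric]) (rule bfun_comp[OF b\<Psi>])
    also have "\<dots> \<le> sqrt (tau h (map (zmul (q - p)) bs) (zmul q u - zmul q u'))"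
    proof (rule m_le_const)
      show "bfun (\<lambda>y. avg bs (\<lambda>b. \<Psi> (y + b)))" by (intro bfun_avg bfun_comp[OF b\<Psi>])
      fix y
      \<comment> \<open>The seminorm of \<open>D\<close> is free of \<open>y\<close>, so the bound
        survives the mean over \<open>y\<close>.\<close>
      define D where "D z = avg bs (\<lambda>b. V (z + zmul (q - p) b))" for z
      have bD: "bfun D" unfolding D_def[abs_def] by (intro bfun_avg bfun_comp[OF bV])
      have "avg bs (\<lambda>b. \<Psi> (y + b)) = m (\<lambda>z. avg bs (\<lambda>b. G z * V (z + zmul (q - p) (y + b))))"
        unfolding \<Psi>_def by (rule m_avg[symmetric]) (intro bfun_mult bG bfun_comp[OF bV])
      also have "\<dots> = m (\<lambda>z. G z * D (z + zmul (q - p) y))"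
        unfolding D_def avg_mult_left[symmetric] by (simp add: zmul_add_right add.assoc)
      also have "\<dots> \<le> nrm (\<lambda>z. D (z + zmul (q - p) y))"
        by (rule order_trans[OF abs_ge_self abs_m_mult_le[OF bfun_comp[OF bD] G1]])
      also have "\<dots> = nrm D" by (rule nrm_shift[OF bD])
      also have "\<dots> = nrm (\<lambda>z. D (z + - zmul q u'))" by (rule nrm_shift[OF bD, symmetric])
      also have "\<dots> = sqrt (tau h (map (zmul (q - p)) bs) (zmul q u - zmul q u'))"
        unfolding nrm_def tau_def D_def V_def avg_map by (simp add: algebra_simps)
      finally show "avg bs (\<lambda>b. \<Psi> (y + b)) \<le> sqrt (tau h (map (zmul (q - p)) bs) (zmul q u - zmul q u'))" .
    qed
    finally show "m (\<lambda>y. m (\<lambda>z. X (y + u) z * X (y + u') z)) \<le> sqrt (tau h (map (zmul (q - p)) bs) (zmul q u - zmul q u'))" .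
  qed
  also have "\<dots> \<le> sqrt (boxform h (map (zmul (q - p)) bs) (map (zmul q) us))"
  proof (rule real_le_rsqrt)
    define T where "T u u' = tau h (map (zmul (q - p)) bs) (zmul q u - zmul q u')" for u u'
    have T: "0 \<le> T u u'" for u u' unfolding T_def by (rule tau_nonneg[OF h])
    \<comment> \<open>Jensen's inequality, once for each average, moves the square inside.\<close>
    have "(avg us (\<lambda>u. avg us (\<lambda>u'. sqrt (T u u'))))\<^sup>2 \<le> avg us (\<lambda>u. (avg us (\<lambda>u'. sqrt (T u u')))\<^sup>2)"
      by (rule power2_avg_le)
    also have "\<dots> \<le> avg us (\<lambda>u. avg us (\<lambda>u'. (sqrt (T u u'))\<^sup>2))"
      by (intro avg_mono power2_avg_le)
    also have "\<dots> = avg us (\<lambda>u. avg us (\<lambda>u'. T u u'))" by (simp add: T)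
    also have "\<dots> = boxform h (map (zmul (q - p)) bs) (map (zmul q) us)"
      unfolding boxform_def avg_map T_def ..
    finally show "(avg us (\<lambda>u. avg us (\<lambda>u'. sqrt (tau h (map (zmul (q - p)) bs) (zmul q u - zmul q u')))))\<^sup>2
       \<le> boxform h (map (zmul (q - p)) bs) (map (zmul q) us)" unfolding T_def .
  qed
  finally show ?thesis unfolding \<Theta>_def X_def .
qed

end

section \<open>Ergodic means: orthogonality to almost periodic functions and small box forms\<close>

locale ergodic_mean = mean +
  assumes ergodic: "bfun V \<Longrightarrow> \<epsilon> > 0 \<Longrightarrow> \<exists>xs. xs \<noteq> [] \<and> m (\<lambda>z. (avg xs (\<lambda>x. V (z + x)) - m V)\<^sup>2) < \<epsilon>"
begin

text \<open>Convolution with a further list does not increase the deviation from the mean, so the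
  lists for the single functions can be merged.\<close>

lemma ergodic_finite:
  assumes "finite I" "\<And>i. i \<in> I \<Longrightarrow> bfun (V i)" and \<epsilon>: "\<epsilon> > 0"
  shows "\<exists>xs. xs \<noteq> [] \<and> (\<forall>i\<in>I. m (\<lambda>z. (avg xs (\<lambda>x. V i (z + x)) - m (V i))\<^sup>2) < \<epsilon>)"
  using assms(1,2)
proof (induction I rule: finite_induct)
  case empty
  show ?case by (intro exI[of _ "[0]"]) simp
next
  case (insert i I)
  then obtain ys where ys: "ys \<noteq> []" "\<And>i. i \<in> I \<Longrightarrow> m (\<lambda>z. (avg ys (\<lambda>x. V i (z + x)) - m (V i))\<^sup>2) < \<epsilon>" by auto
  obtain xs where xs: "xs \<noteq> []" "m (\<lambda>z. (avg xs (\<lambda>x. V i (z + x)) - m (V i))\<^sup>2) < \<epsilon>"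
    using ergodic[OF insert.prems[of i] \<epsilon>] by auto
  have le: "m (\<lambda>z. (avg (conv xs ys) (\<lambda>x. W (z + x)) - c)\<^sup>2) \<le> m (\<lambda>z. (avg ys (\<lambda>x. W (z + x)) - c)\<^sup>2)"
    if "xs \<noteq> []" "ys \<noteq> []" "bfun W" for xs ys W and c :: real
  proof -
    have bD: "bfun (\<lambda>z. (avg ys (\<lambda>y. W (z + y)) - c)\<^sup>2)"
      by (intro bfun_power2 bfun_diff bfun_const bfun_avg bfun_comp[OF that(3)])
    have "m (\<lambda>z. (avg (conv xs ys) (\<lambda>x. W (z + x)) - c)\<^sup>2) \<le> m (\<lambda>z. avg xs (\<lambda>x. (avg ys (\<lambda>y. W (z + x + y)) - c)\<^sup>2))"
    proof (rule m_mono)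
      fix z
      have "avg (conv xs ys) (\<lambda>x. W (z + x)) - c = avg xs (\<lambda>x. avg ys (\<lambda>y. W (z + x + y)) - c)"
        using that by (simp add: avg_conv avg_diff add.assoc)
      then show "(avg (conv xs ys) (\<lambda>x. W (z + x)) - c)\<^sup>2 \<le> avg xs (\<lambda>x. (avg ys (\<lambda>y. W (z + x + y)) - c)\<^sup>2)"
        using power2_avg_le by simp
    qed (intro bfun_power2 bfun_diff bfun_const bfun_avg bfun_comp[OF that(3)])+
    also have "\<dots> = avg xs (\<lambda>x. m (\<lambda>z. (avg ys (\<lambda>y. W (z + x + y)) - c)\<^sup>2))"
      by (rule m_avg) (intro bfun_power2 bfun_diff bfun_const bfun_avg bfun_comp[OF that(3)])
    also have "\<dots> = avg xs (\<lambda>x. m (\<lambda>z. (avg ys (\<lambda>y. W (z + y)) - c)\<^sup>2))"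
      by (intro avg_cong) (rule m_shift[OF bD])
    finally show ?thesis using that by simp
  qed
  have conv_comm: "avg (conv xs ys) \<phi> = avg (conv ys xs) \<phi>" for \<phi> :: "'a \<Rightarrow> real"
    unfolding avg_conv by (subst avg_avg_swap) (simp add: add.commute)
  show ?case
  proof (intro exI[of _ "conv xs ys"] conjI ballI)
    show "conv xs ys \<noteq> []" using xs ys by simp
    fix j assume "j \<in> insert i I"
    then consider "j = i" | "j \<in> I" by blast
    then show "m (\<lambda>z. (avg (conv xs ys) (\<lambda>x. V j (z + x)) - m (V j))\<^sup>2) < \<epsilon>"
    proof cases
      case 1
      then show ?thesis unfolding conv_comm using le[OF ys(1) xs(1), of "V i" "m (V i)"] xs(2) insert.prems[of i] by auto
    next
      case 2
      then show ?thesis using le[OF xs(1) ys(1), of "V j" "m (V j)"] ys(2)[OF 2] insert.prems[of j] by auto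
    qed
  qed
qed

text \<open>The small average of \<open>(rho h g)\<^sup>2\<close> fixes \<open>ys\<close>.
  Ergodicity, applied to the finitely many differences of its entries, then supplies
  \<open>xs\<close> for which \<open>tau\<close> exceeds that square by at most
  \<open>\<eta>\<close>.\<close>

lemma boxform_small_if_orthogonal:
  assumes h: "\<And>z. \<bar>h z\<bar> \<le> 1" and \<eta>: "\<eta> > 0" and e: "e > 0"
    and orth: "\<And>Q. Q \<in> bohr_ap e \<Longrightarrow> (\<And>z. \<bar>Q z\<bar> \<le> 1) \<Longrightarrow> m (\<lambda>z. h z * Q z) \<le> \<eta>"
  shows "\<exists>xs ys. xs \<noteq> [] \<and> ys \<noteq> [] \<and> boxform h xs ys \<le> 3 * \<eta>"
proof -
  have bh: "bfun h" by (rule bfunI[OF h])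
  have "\<exists>ys. ys \<noteq> [] \<and> avg ys (\<lambda>v. avg ys (\<lambda>v'. (rho h (v - v'))\<^sup>2)) < 2 * \<eta>"
    by (rule rho_small_if_orthogonal[OF h \<eta> e orth])
  then obtain ys where ys: "ys \<noteq> []" "avg ys (\<lambda>v. avg ys (\<lambda>v'. (rho h (v - v'))\<^sup>2)) < 2 * \<eta>" by blast
  define V where "V g z = h (z + g) * h z" for g z
  have bV: "bfun (V g)" for g unfolding V_def[abs_def] by (intro bfun_mult bfun_comp[OF bh] bh)
  have mV: "m (V g) = rho h g" for g by (simp add: V_def[abs_def] rho_def)
  define D where "D = (\<lambda>p. fst p - snd p) ` (set ys \<times> set ys)"
  have "\<exists>xs. xs \<noteq> [] \<and> (\<forall>g\<in>D. m (\<lambda>z. (avg xs (\<lambda>x. V g (z + x)) - m (V g))\<^sup>2) < \<eta>)"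
    by (rule ergodic_finite) (simp_all add: D_def bV \<eta>)
  then obtain xs where xs: "xs \<noteq> []"
    "\<And>g. g \<in> D \<Longrightarrow> m (\<lambda>z. (avg xs (\<lambda>x. V g (z + x)) - m (V g))\<^sup>2) < \<eta>" by blast
  have "boxform h xs ys \<le> avg ys (\<lambda>v. avg ys (\<lambda>v'. (rho h (v - v'))\<^sup>2 + \<eta>))"
    unfolding boxform_def
  proof (intro avg_mono)
    fix v v' assume v: "v \<in> set ys" "v' \<in> set ys"
    define g where "g = v - v'"
    have g: "g \<in> D" using v by (force simp: g_def D_def)
    define E where "E z = avg xs (\<lambda>x. V g (z + x))" for z
    have bE: "bfun E" unfolding E_def[abs_def] by (intro bfun_avg bfun_comp[OF bV])
    have mE: "m E = rho h g"
    proof -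
      have "m E = avg xs (\<lambda>x. m (\<lambda>z. V g (z + x)))"
        unfolding E_def[abs_def] by (rule m_avg) (rule bfun_comp[OF bV])
      then show ?thesis using xs(1) by (simp add: m_shift[OF bV] mV)
    qed
    have "tau h xs g = m (\<lambda>z. (E z)\<^sup>2)"
      unfolding tau_def E_def V_def by (simp add: algebra_simps)
    \<comment> \<open>As \<open>E\<close> has mean \<open>rho h g\<close>, its mean square is its
      variance plus \<open>(rho h g)\<^sup>2\<close>.\<close>
    also have "(\<lambda>z. (E z)\<^sup>2) = (\<lambda>z. (E z - rho h g)\<^sup>2 + (2 * rho h g * E z - (rho h g)\<^sup>2))"
      by (auto simp: power2_eq_square algebra_simps)
    also have "m \<dots> = m (\<lambda>z. (E z - rho h g)\<^sup>2) + (2 * rho h g * m E - (rho h g)\<^sup>2)"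
      by (subst m_add, (intro bfun_power2 bfun_diff bfun_mult bfun_const bE)+,
          subst m_diff, (intro bfun_mult bfun_const bE)+, subst m_cmult, rule bE) simp
    also have "\<dots> = m (\<lambda>z. (E z - rho h g)\<^sup>2) + (rho h g)\<^sup>2"
      unfolding mE by (simp add: power2_eq_square)
    also have "\<dots> \<le> (rho h g)\<^sup>2 + \<eta>" using xs(2)[OF g] by (simp add: mV E_def)
    finally show "tau h xs (v - v') \<le> (rho h (v - v'))\<^sup>2 + \<eta>" by (simp add: g_def)
  qed
  also have "\<dots> = avg ys (\<lambda>v. avg ys (\<lambda>v'. (rho h (v - v'))\<^sup>2)) + \<eta>"
    using ys(1) by (simp add: avg_add)
  finally show ?thesis using ys xs(1) by (intro exI[of _ xs] exI[of _ ys]) auto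
qed

end

subsection \<open>Approximation by almost periodic functions\<close>

context mean
begin

lemma m_power2_add_le:
  assumes "bfun \<phi>" "bfun \<psi>"
  shows "m (\<lambda>z. (\<phi> z + \<psi> z)\<^sup>2) \<le> 2 * m (\<lambda>z. (\<phi> z)\<^sup>2) + 2 * m (\<lambda>z. (\<psi> z)\<^sup>2)"
proof -
  have "m (\<lambda>z. (\<phi> z + \<psi> z)\<^sup>2) \<le> m (\<lambda>z. 2 * (\<phi> z)\<^sup>2 + 2 * (\<psi> z)\<^sup>2)"
  proof (rule m_mono)
    show "(\<phi> z + \<psi> z)\<^sup>2 \<le> 2 * (\<phi> z)\<^sup>2 + 2 * (\<psi> z)\<^sup>2" for z
      using zero_le_power2[of "\<phi> z - \<psi> z"] by (simp only: power2_sum power2_diff)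
  qed (intro bfun_power2 bfun_add bfun_mult bfun_const assms)+
  also have "\<dots> = m (\<lambda>z. 2 * (\<phi> z)\<^sup>2) + m (\<lambda>z. 2 * (\<psi> z)\<^sup>2)"
    by (rule m_add) (intro bfun_power2 bfun_mult bfun_const assms)+
  also have "\<dots> = 2 * m (\<lambda>z. (\<phi> z)\<^sup>2) + 2 * m (\<lambda>z. (\<psi> z)\<^sup>2)"
    using m_cmult[OF bfun_power2[OF assms(1)], of 2] m_cmult[OF bfun_power2[OF assms(2)], of 2] by simp
  finally show ?thesis .
qed

lemma bohr_ap_bfun: "F \<in> bohr_ap e \<Longrightarrow> bfun F"
  by (simp add: bohr_ap_def)

lemma bohr_ap_mono: "F \<in> bohr_ap e \<Longrightarrow> e \<le> e' \<Longrightarrow> F \<in> bohr_ap e'"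
  by (auto simp: bohr_ap_def elim: eventually_mono)

lemma bohr_ap_const: "0 \<le> e \<Longrightarrow> (\<lambda>_. c) \<in> bohr_ap e"
  by (simp add: bohr_ap_def)

text \<open>The factor 4 is the price of \<open>m_power2_add_le\<close>.\<close>

lemma bohr_ap_add:
  assumes F: "F \<in> bohr_ap (e / 4)" and Q: "Q \<in> bohr_ap (e / 4)" and t: "\<bar>t\<bar> \<le> 1"
  shows "(\<lambda>z. F z + t * Q z) \<in> bohr_ap e"
proof -
  have b: "bfun F" "bfun Q" using assms bohr_ap_bfun by auto
  have ev: "eventually (\<lambda>u. m (\<lambda>z. (F (z + u) - F z)\<^sup>2) \<le> e / 4) bohr_filter"
    "eventually (\<lambda>u. m (\<lambda>z. (Q (z + u) - Q z)\<^sup>2) \<le> e / 4) bohr_filter"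
    using F Q by (auto simp: bohr_ap_def)
  have "eventually (\<lambda>u. m (\<lambda>z. (F (z + u) + t * Q (z + u) - (F z + t * Q z))\<^sup>2) \<le> e) bohr_filter"
    using ev
  proof eventually_elim
    case (elim u)
    have bF: "bfun (\<lambda>z. F (z + u) - F z)" and bQ: "bfun (\<lambda>z. Q (z + u) - Q z)"
      by (intro bfun_diff b bfun_comp[OF b(1)] bfun_comp[OF b(2)])+
    have "m (\<lambda>z. (F (z + u) + t * Q (z + u) - (F z + t * Q z))\<^sup>2)
        = m (\<lambda>z. ((F (z + u) - F z) + t * (Q (z + u) - Q z))\<^sup>2)"
      by (simp add: algebra_simps)
    also have "\<dots> \<le> 2 * m (\<lambda>z. (F (z + u) - F z)\<^sup>2) + 2 * m (\<lambda>z. (t * (Q (z + u) - Q z))\<^sup>2)"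
      by (rule m_power2_add_le) (intro bF bQ bfun_mult bfun_const)+
    also have "m (\<lambda>z. (t * (Q (z + u) - Q z))\<^sup>2) \<le> m (\<lambda>z. (Q (z + u) - Q z)\<^sup>2)"
    proof (rule m_mono)
      show "(t * (Q (z + u) - Q z))\<^sup>2 \<le> (Q (z + u) - Q z)\<^sup>2" for z
        using t by (simp add: power_mult_distrib mult_left_le_one_le abs_square_le_1)
    qed (intro bfun_power2 bfun_mult bfun_const bQ)+
    finally show ?case using elim by linarith
  qed
  moreover have "bfun (\<lambda>z. F z + t * Q z)" by (intro bfun_add bfun_mult bfun_const b)
  ultimately show ?thesis by (simp add: bohr_ap_def)
qed

text \<open>Serves the truncation to [0, 1] and the cutoff that detects small values.\<close>

lemma bohr_ap_lipschitz:
  assumes F: "F \<in> bohr_ap e" and \<Phi>: "\<And>a b. \<bar>\<Phi> a - \<Phi> b\<bar> \<le> L * \<bar>a - b\<bar>" and b\<Phi>: "bfun (\<lambda>z. \<Phi> (F z))"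
  shows "(\<lambda>z. \<Phi> (F z)) \<in> bohr_ap (L\<^sup>2 * e)"
proof -
  have b: "bfun F" using F bohr_ap_bfun by auto
  have "eventually (\<lambda>u. m (\<lambda>z. (F (z + u) - F z)\<^sup>2) \<le> e) bohr_filter"
    using F by (auto simp: bohr_ap_def)
  then have "eventually (\<lambda>u. m (\<lambda>z. (\<Phi> (F (z + u)) - \<Phi> (F z))\<^sup>2) \<le> L\<^sup>2 * e) bohr_filter"
  proof eventually_elim
    case (elim u)
    have bF: "bfun (\<lambda>z. F (z + u) - F z)" by (intro bfun_diff b bfun_comp[OF b])
    have "m (\<lambda>z. (\<Phi> (F (z + u)) - \<Phi> (F z))\<^sup>2) \<le> m (\<lambda>z. L\<^sup>2 * (F (z + u) - F z)\<^sup>2)"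
    proof (rule m_mono)
      show "bfun (\<lambda>z. (\<Phi> (F (z + u)) - \<Phi> (F z))\<^sup>2)"
        by (intro bfun_power2 bfun_diff b\<Phi> bfun_comp[OF b\<Phi>])
      show "bfun (\<lambda>z. L\<^sup>2 * (F (z + u) - F z)\<^sup>2)" by (intro bfun_mult bfun_const bfun_power2 bF)
      show "(\<Phi> (F (z + u)) - \<Phi> (F z))\<^sup>2 \<le> L\<^sup>2 * (F (z + u) - F z)\<^sup>2" for z
        using power_mono[OF \<Phi>[of "F (z + u)" "F z"], of 2] by (simp add: power_mult_distrib)
    qed
    also have "\<dots> = L\<^sup>2 * m (\<lambda>z. (F (z + u) - F z)\<^sup>2)" by (intro m_cmult bfun_power2 bF)
    finally show ?case using elim by (meson mult_left_mono order_trans zero_le_power2)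
  qed
  then show ?thesis using b\<Phi> by (simp add: bohr_ap_def)
qed

text \<open>Convexity keeps \<open>e\<close> unchanged, so the parallelogram law can be used at a
  fixed error.\<close>

lemma bohr_ap_midpoint:
  assumes F: "F \<in> bohr_ap e" and Q: "Q \<in> bohr_ap e"
  shows "(\<lambda>z. (F z + Q z) / 2) \<in> bohr_ap e"
proof -
  have b: "bfun F" "bfun Q" using assms bohr_ap_bfun by auto
  have ev: "eventually (\<lambda>u. m (\<lambda>z. (F (z + u) - F z)\<^sup>2) \<le> e) bohr_filter"
    "eventually (\<lambda>u. m (\<lambda>z. (Q (z + u) - Q z)\<^sup>2) \<le> e) bohr_filter"
    using F Q by (auto simp: bohr_ap_def)
  have "eventually (\<lambda>u. m (\<lambda>z. ((F (z + u) + Q (z + u)) / 2 - (F z + Q z) / 2)\<^sup>2) \<le> e) bohr_filter"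
    using ev
  proof eventually_elim
    case (elim u)
    have bF: "bfun (\<lambda>z. F (z + u) - F z)" and bQ: "bfun (\<lambda>z. Q (z + u) - Q z)"
      by (intro bfun_diff b bfun_comp[OF b(1)] bfun_comp[OF b(2)])+
    have "m (\<lambda>z. ((F (z + u) + Q (z + u)) / 2 - (F z + Q z) / 2)\<^sup>2)
        = m (\<lambda>z. (1/4) * ((F (z + u) - F z) + (Q (z + u) - Q z))\<^sup>2)"
      by (rule arg_cong[where f = m]) (auto simp: power2_eq_square field_simps)
    also have "\<dots> = (1/4) * m (\<lambda>z. ((F (z + u) - F z) + (Q (z + u) - Q z))\<^sup>2)"
      by (intro m_cmult bfun_power2 bfun_add bF bQ)
    finally show ?case using m_power2_add_le[OF bF bQ] elim by linarith
  qed
  moreover have "bfun (\<lambda>z. (F z + Q z) / 2)" by (intro bfun_add bfun_divide b)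
  ultimately show ?thesis by (simp add: bohr_ap_def)
qed

context
  fixes f :: "'a \<Rightarrow> real"
  assumes f: "\<And>z. 0 \<le> f z" "\<And>z. f z \<le> 1"
begin

lemma bfun_f: "bfun f"
  using f by (intro bfunI[of _ 1]) (simp add: abs_le_iff)

text \<open>The squared distance from \<open>f\<close> to \<open>bohr_ap e\<close> can only grow as
  \<open>e\<close> decreases, and \<open>D\<close> is its limit. The value need not be attained: the
  lower bound holds for some \<open>e\<close>, while almost minimisers exist for every
  \<open>e\<close>.\<close>

lemma ap_distance:
  shows "\<exists>D. (\<forall>\<kappa>>0. \<exists>e>0. \<forall>F\<in>bohr_ap e. D - \<kappa> \<le> m (\<lambda>z. (f z - F z)\<^sup>2)) \<and>
    (\<forall>\<kappa>>0. \<forall>e>0. \<exists>F\<in>bohr_ap e. (\<forall>z. 0 \<le> F z \<and> F z \<le> 1) \<and> m (\<lambda>z. (f z - F z)\<^sup>2) \<le> D + \<kappa>)"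
proof -
  define E where "E F = m (\<lambda>z. (f z - F z)\<^sup>2)" for F
  have bE: "bfun (\<lambda>z. (f z - F z)\<^sup>2)" if "bfun F" for F
    by (intro bfun_power2 bfun_diff bfun_f that)
  have E0: "0 \<le> E F" if "F \<in> bohr_ap e" for F e
    unfolding E_def by (intro m_nonneg bE) (use that bohr_ap_bfun in auto)
  define Dv where "Dv e = Inf (E ` bohr_ap e)" for e
  have bdd: "bdd_below (E ` bohr_ap e)" for e using E0 by (auto intro!: bdd_belowI2)
  have Dv_le: "Dv e \<le> E F" if "F \<in> bohr_ap e" for F e
    unfolding Dv_def using that by (intro cInf_lower bdd) auto
  have zero: "(\<lambda>_. 0) \<in> bohr_ap e" if "e > 0" for e using that by (intro bohr_ap_const) auto
  have bddv: "bdd_above (Dv ` {0<..})"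
    by (rule bdd_aboveI2[of _ _ "E (\<lambda>_. 0)"]) (auto intro: Dv_le zero)
  define D where "D = Sup (Dv ` {0<..})"
  show ?thesis
  proof (rule exI[of _ D], intro conjI allI impI)
    fix \<kappa> :: real assume \<kappa>: "\<kappa> > 0"
    have "\<exists>x\<in>Dv ` {0<..}. D - \<kappa> < x"
      unfolding D_def by (rule less_cSupD) (use \<kappa> in auto)
    then obtain e where e: "e > 0" "D - \<kappa> < Dv e" by auto
    then show "\<exists>e>0. \<forall>F\<in>bohr_ap e. D - \<kappa> \<le> m (\<lambda>z. (f z - F z)\<^sup>2)"
      using Dv_le unfolding E_def by (meson less_imp_le order_trans)
    fix e :: real assume e: "e > 0"
    have "Dv e \<le> D" unfolding D_def using e by (intro cSup_upper bddv) auto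
    have "\<exists>x\<in>E ` bohr_ap e. x < Dv e + \<kappa>"
      unfolding Dv_def by (rule cInf_lessD) (use \<kappa> zero[OF e] in auto)
    then obtain F where F: "F \<in> bohr_ap e" "E F < Dv e + \<kappa>" by auto
    \<comment> \<open>Truncation is 1-Lipschitz and never increases the distance to
      \<open>f\<close>, whose values lie in [0, 1].\<close>
    define G where "G z = max 0 (min 1 (F z))" for z
    have bF: "bfun F" using F bohr_ap_bfun by auto
    have bG: "bfun G" unfolding G_def[abs_def] by (intro bfun_max bfun_min bfun_const bF)
    have "(\<lambda>z. max 0 (min 1 (F z))) \<in> bohr_ap (1\<^sup>2 * e)"
      by (rule bohr_ap_lipschitz[OF F(1)]) (use bG in \<open>auto simp: G_def[abs_def]\<close>)
    then have "G \<in> bohr_ap e" by (simp add: G_def[abs_def])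
    moreover have "E G \<le> E F" unfolding E_def
    proof (rule m_mono[OF bE[OF bG] bE[OF bF]])
      fix z
      have "\<bar>f z - G z\<bar> \<le> \<bar>f z - F z\<bar>" using f[of z] by (auto simp: G_def)
      then show "(f z - G z)\<^sup>2 \<le> (f z - F z)\<^sup>2" by (simp add: abs_le_square_iff)
    qed
    ultimately show "\<exists>F\<in>bohr_ap e. (\<forall>z. 0 \<le> F z \<and> F z \<le> 1) \<and> m (\<lambda>z. (f z - F z)\<^sup>2) \<le> D + \<kappa>"
      using F(2) \<open>Dv e \<le> D\<close> unfolding E_def by (intro bexI[of _ G]) (auto simp: G_def)
  qed
qed

text \<open>Parallelogram law; the midpoint lies in the same class and cannot fall below
  \<open>D - \<kappa>\<close>.\<close>

lemma near_minimizers_close: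
  assumes min: "\<And>F. F \<in> bohr_ap e \<Longrightarrow> D - \<kappa> \<le> m (\<lambda>z. (f z - F z)\<^sup>2)"
    and F: "F \<in> bohr_ap e" "m (\<lambda>z. (f z - F z)\<^sup>2) \<le> D + \<kappa>"
    and G: "G \<in> bohr_ap e" "m (\<lambda>z. (f z - G z)\<^sup>2) \<le> D + \<kappa>"
  shows "m (\<lambda>z. (F z - G z)\<^sup>2) \<le> 8 * \<kappa>"
proof -
  have b: "bfun F" "bfun G" using F G bohr_ap_bfun by auto
  have bE: "bfun (\<lambda>z. (f z - F z)\<^sup>2)" if "bfun F" for F
    by (intro bfun_power2 bfun_diff bfun_f that)
  have bM: "bfun (\<lambda>z. (F z + G z) / 2)" by (intro bfun_add bfun_divide b)
  have "m (\<lambda>z. (F z - G z)\<^sup>2) = m (\<lambda>z. 2 * (f z - F z)\<^sup>2 + 2 * (f z - G z)\<^sup>2 + (- 4) * (f z - (F z + G z) / 2)\<^sup>2)"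
    by (rule arg_cong[where f = m]) (auto simp: power2_eq_square field_simps)
  also have "\<dots> = m (\<lambda>z. 2 * (f z - F z)\<^sup>2 + 2 * (f z - G z)\<^sup>2) + m (\<lambda>z. (- 4) * (f z - (F z + G z) / 2)\<^sup>2)"
    by (rule m_add) (intro bfun_add bfun_mult bfun_const bE b bM)+
  also have "m (\<lambda>z. 2 * (f z - F z)\<^sup>2 + 2 * (f z - G z)\<^sup>2) = m (\<lambda>z. 2 * (f z - F z)\<^sup>2) + m (\<lambda>z. 2 * (f z - G z)\<^sup>2)"
    by (rule m_add) (intro bfun_add bfun_mult bfun_const bE b bM)+
  finally have "m (\<lambda>z. (F z - G z)\<^sup>2) = 2 * m (\<lambda>z. (f z - F z)\<^sup>2) + 2 * m (\<lambda>z. (f z - G z)\<^sup>2)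
     + (- 4) * m (\<lambda>z. (f z - (F z + G z) / 2)\<^sup>2)"
    unfolding m_cmult[OF bE[OF b(1)]] m_cmult[OF bE[OF b(2)]] m_cmult[OF bE[OF bM]] .
  moreover have "D - \<kappa> \<le> m (\<lambda>z. (f z - (F z + G z) / 2)\<^sup>2)" by (rule min[OF bohr_ap_midpoint[OF F(1) G(1)]])
  ultimately show ?thesis using F(2) G(2) by linarith
qed

text \<open>First variation in the direction \<open>Q\<close>: the step
  \<open>t = sqrt (2 * \<kappa>)\<close> balances the slack \<open>2 * \<kappa>\<close> of almost
  minimality against the quadratic term.\<close>

lemma near_minimizer_orthogonal:
  assumes min: "\<And>F. F \<in> bohr_ap e \<Longrightarrow> D - \<kappa> \<le> m (\<lambda>z. (f z - F z)\<^sup>2)"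
    and \<kappa>: "0 < \<kappa>" "2 * \<kappa> \<le> 1"
    and F: "F \<in> bohr_ap (e / 4)" "m (\<lambda>z. (f z - F z)\<^sup>2) \<le> D + \<kappa>"
    and Q: "Q \<in> bohr_ap (e / 4)" "\<And>z. \<bar>Q z\<bar> \<le> 1"
  shows "m (\<lambda>z. (f z - F z) * Q z) \<le> sqrt (2 * \<kappa>)"
proof -
  define t where "t = sqrt (2 * \<kappa>)"
  have t: "0 < t" "t \<le> 1" "t * t = 2 * \<kappa>" using \<kappa> by (auto simp: t_def)
  have b: "bfun F" "bfun Q" using F Q bohr_ap_bfun by auto
  have bh: "bfun (\<lambda>z. f z - F z)" by (intro bfun_diff bfun_f b)
  have "D - \<kappa> \<le> m (\<lambda>z. (f z - (F z + t * Q z))\<^sup>2)"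
    by (rule min[OF bohr_ap_add[OF F(1) Q(1)]]) (use t in auto)
  also have "\<dots> = m (\<lambda>z. (f z - F z)\<^sup>2 + ((- 2 * t) * ((f z - F z) * Q z) + (t * t) * (Q z)\<^sup>2))"
    by (rule arg_cong[where f = m]) (auto simp: power2_eq_square algebra_simps)
  also have "\<dots> = m (\<lambda>z. (f z - F z)\<^sup>2) + m (\<lambda>z. (- 2 * t) * ((f z - F z) * Q z) + (t * t) * (Q z)\<^sup>2)"
    by (rule m_add) (intro bfun_add bfun_mult bfun_const bh b bfun_power2)+
  also have "m (\<lambda>z. (- 2 * t) * ((f z - F z) * Q z) + (t * t) * (Q z)\<^sup>2)
     = m (\<lambda>z. (- 2 * t) * ((f z - F z) * Q z)) + m (\<lambda>z. (t * t) * (Q z)\<^sup>2)"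
    by (rule m_add) (intro bfun_add bfun_mult bfun_const bh b bfun_power2)+
  also have "m (\<lambda>z. (- 2 * t) * ((f z - F z) * Q z)) = (- 2 * t) * m (\<lambda>z. (f z - F z) * Q z)"
    by (rule m_cmult) (intro bfun_mult bh b)
  also have "m (\<lambda>z. (t * t) * (Q z)\<^sup>2) = (t * t) * m (\<lambda>z. (Q z)\<^sup>2)"
    by (rule m_cmult) (intro bfun_power2 b)
  finally have "D - \<kappa> \<le> m (\<lambda>z. (f z - F z)\<^sup>2) + ((- 2 * t) * m (\<lambda>z. (f z - F z) * Q z) + (t * t) * m (\<lambda>z. (Q z)\<^sup>2))" .
  moreover have "(t * t) * m (\<lambda>z. (Q z)\<^sup>2) \<le> (t * t) * 1"
    using Q(2) by (intro mult_left_mono m_le_const bfun_power2 b) (auto simp: abs_square_le_1)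
  ultimately have "2 * (t * m (\<lambda>z. (f z - F z) * Q z)) \<le> 2 * (t * t)" using F(2) t(3) by linarith
  then show ?thesis using t(1) unfolding t_def[symmetric] by simp
qed

end

end

section \<open>Lower bound for the correlation\<close>

context ergodic_mean
begin

text \<open>The fourth power of \<open>\<epsilon>\<close> arises because the van der Corput
  inequality bounds a square by the square root of a box form.\<close>

lemma correlation_error:
  assumes C: "\<forall>h xs ys. (\<forall>z. \<bar>h z\<bar> \<le> 1) \<longrightarrow> xs \<noteq> [] \<longrightarrow> ys \<noteq> [] \<longrightarrow>
       (\<exists>bs us. bs \<noteq> [] \<and> us \<noteq> [] \<and> boxform h (map (zmul (q - p)) bs) (map (zmul q) us) \<le> C * boxform h xs ys)"
    and C0: "C > 0"
    and g: "\<And>z. \<bar>g z\<bar> \<le> 1" and g1: "\<And>z. \<bar>g1 z\<bar> \<le> 1" and h: "\<And>z. \<bar>h z\<bar> \<le> 1"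
    and \<eta>: "\<eta> > 0" and e: "e > 0" and \<epsilon>: "\<epsilon> > 0" "C * (3 * \<eta>) \<le> \<epsilon> ^ 4"
    and orth: "\<And>Q. Q \<in> bohr_ap e \<Longrightarrow> (\<And>z. \<bar>Q z\<bar> \<le> 1) \<Longrightarrow> m (\<lambda>z. h z * Q z) \<le> \<eta>"
  shows "\<bar>m (\<lambda>y. m (\<lambda>z. g z * (g1 (z + zmul p y + w) * h (z + zmul q y))))\<bar> \<le> \<epsilon>"
proof -
  have "\<exists>xs ys. xs \<noteq> [] \<and> ys \<noteq> [] \<and> boxform h xs ys \<le> 3 * \<eta>"
    by (rule boxform_small_if_orthogonal[OF h \<eta> e orth])
  then obtain xs ys where xy: "xs \<noteq> []" "ys \<noteq> []" "boxform h xs ys \<le> 3 * \<eta>" by blast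
  have "\<exists>bs us. bs \<noteq> [] \<and> us \<noteq> [] \<and> boxform h (map (zmul (q - p)) bs) (map (zmul q) us) \<le> C * boxform h xs ys"
    using C h xy(1,2) by blast
  then obtain bs us where bu: "bs \<noteq> []" "us \<noteq> []"
    "boxform h (map (zmul (q - p)) bs) (map (zmul q) us) \<le> C * boxform h xs ys" by blast
  have "C * boxform h xs ys \<le> C * (3 * \<eta>)" using C0 xy(3) by (intro mult_left_mono) auto
  then have "boxform h (map (zmul (q - p)) bs) (map (zmul q) us) \<le> (\<epsilon>\<^sup>2)\<^sup>2" using bu(3) \<epsilon>(2) by simp
  then have "sqrt (boxform h (map (zmul (q - p)) bs) (map (zmul q) us)) \<le> \<epsilon>\<^sup>2"
    by (intro real_le_lsqrt) auto
  moreover have "(m (\<lambda>y. m (\<lambda>z. g z * (g1 (z + zmul p y + w) * h (z + zmul q y)))))\<^sup>2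
    \<le> sqrt (boxform h (map (zmul (q - p)) bs) (map (zmul q) us))"
    by (rule van_der_Corput[OF g g1 h bu(1,2)])
  ultimately have "(m (\<lambda>y. m (\<lambda>z. g z * (g1 (z + zmul p y + w) * h (z + zmul q y)))))\<^sup>2 \<le> \<epsilon>\<^sup>2" by linarith
  then show ?thesis using \<epsilon>(1) by (simp add: abs_le_square_iff[symmetric])
qed

text \<open>Replace two of the factors by an almost minimiser \<open>G\<close> of the distance to \<open>f\<close>. The error must be
  small compared with the mean \<open>b\<close> of the Bohr set \<open>B\<close>, so \<open>G\<close> is chosen after \<open>B\<close>; the set \<open>B\<close> comes from a coarser
  almost minimiser \<open>F\<close>, and its periods are also almost periods of \<open>G\<close> because almost minimisers are close to
  each other.\<close>

lemma correlation_positive: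
  fixes f :: "'a \<Rightarrow> real"
  assumes f: "\<And>z. 0 \<le> f z" "\<And>z. f z \<le> 1" and c: "0 < c" "c \<le> 1"
    and fin: "finite_index (mult_set r :: 'a set)" "finite_index (mult_set s :: 'a set)"
      "finite_index (mult_set (r + s) :: 'a set)"
  shows "\<exists>P. eventually P bohr_filter \<and> (\<forall>f0 p x. P p \<longrightarrow> P x \<longrightarrow> (\<forall>z. 0 \<le> f0 z \<and> f0 z \<le> f (z + p)) \<longrightarrow> c \<le> m f0 \<longrightarrow>
     0 < m (\<lambda>y. m (\<lambda>z. f0 (z + zmul s y + x) * (f (z - zmul r y) * f z))))"
proof -
  obtain D where D: "(\<forall>\<kappa>>0. \<exists>e>0. \<forall>F\<in>bohr_ap e. D - \<kappa> \<le> m (\<lambda>z. (f z - F z)\<^sup>2)) \<and>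
    (\<forall>\<kappa>>0. \<forall>e>0. \<exists>F\<in>bohr_ap e. (\<forall>z. 0 \<le> F z \<and> F z \<le> 1) \<and> m (\<lambda>z. (f z - F z)\<^sup>2) \<le> D + \<kappa>)"
    using ap_distance[where f = f, OF f] ..
  note D1 = conjunct1[OF D, rule_format] and D2 = conjunct2[OF D, rule_format]
  \<comment> \<open>The error terms \<open>\<Theta>2\<close> and \<open>\<Theta>3\<close> below have
    \<open>p = s\<close>, \<open>q = - r\<close> and \<open>p = s + r\<close>, \<open>q = r\<close>;
    in each case \<open>q\<close> and \<open>q - p\<close> must have images of finite index.\<close>
  have "- r - s = - (r + s)" by simp
  then have fin1: "finite_index (mult_set (- r - s) :: 'a set)" using fin(3) by (simp only: mult_set_uminus)
  have fin2: "finite_index (mult_set (- r) :: 'a set)" using fin(1) by (simp add: mult_set_uminus)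
  obtain C1 where C1: "0 < C1 \<and> (\<forall>h xs ys. (\<forall>z. \<bar>h z\<bar> \<le> 1) \<longrightarrow> xs \<noteq> [] \<longrightarrow> ys \<noteq> [] \<longrightarrow>
       (\<exists>bs us. bs \<noteq> [] \<and> us \<noteq> [] \<and> boxform h (map (zmul (- r - s)) bs) (map (zmul (- r)) us) \<le> C1 * boxform h xs ys))"
    using boxform_multiples[OF fin1 fin2] ..
  have fin3: "finite_index (mult_set (r - (s + r)) :: 'a set)" using fin(2) by (simp add: mult_set_uminus)
  obtain C2 where C2: "0 < C2 \<and> (\<forall>h xs ys. (\<forall>z. \<bar>h z\<bar> \<le> 1) \<longrightarrow> xs \<noteq> [] \<longrightarrow> ys \<noteq> [] \<longrightarrow>
       (\<exists>bs us. bs \<noteq> [] \<and> us \<noteq> [] \<and> boxform h (map (zmul (r - (s + r))) bs) (map (zmul r) us) \<le> C2 * boxform h xs ys))"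
    using boxform_multiples[OF fin3 fin(1)] ..
  define C where "C = max C1 C2"
  \<comment> \<open>The main term \<open>c ^ 3 / 2\<close> is \<open>48 * \<beta>\<close>, the
    losses add up to at most \<open>12.5 * \<beta>\<close>, and \<open>24 * \<beta>\<close> has to
    remain.\<close>
  define \<beta> where "\<beta> = c ^ 3 / 96"
  \<comment> \<open>Makes the distance \<open>sqrt (8 * \<kappa>)\<close> of almost minimisers
    \<open>\<beta> / 2\<close> and the orthogonality defect \<open>sqrt (2 * \<kappa>)\<close> equal
    to \<open>\<beta> / 4\<close>.\<close>
  define \<kappa> where "\<kappa> = \<beta>\<^sup>2 / 32"
  have \<beta>: "0 < \<beta>" "\<beta> \<le> 1" using c power_le_one[of c 3] by (auto simp: \<beta>_def)
  then have \<beta>2: "\<beta>\<^sup>2 \<le> 1" by (simp add: power_le_one)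
  have \<kappa>: "0 < \<kappa>" "2 * \<kappa> \<le> 1" using \<beta> \<beta>2 by (auto simp: \<kappa>_def)
  have sq\<kappa>: "sqrt (8 * \<kappa>) = \<beta> / 2" "sqrt (2 * \<kappa>) = \<beta> / 4"
  proof -
    have "8 * \<kappa> = (\<beta> / 2)\<^sup>2" "2 * \<kappa> = (\<beta> / 4)\<^sup>2" by (simp_all add: \<kappa>_def power2_eq_square)
    then show "sqrt (8 * \<kappa>) = \<beta> / 2" "sqrt (2 * \<kappa>) = \<beta> / 4" using \<beta> by simp_all
  qed
  obtain e1 where e1: "e1 > 0" "\<And>F. F \<in> bohr_ap e1 \<Longrightarrow> D - \<kappa> \<le> m (\<lambda>z. (f z - F z)\<^sup>2)"
    using D1[OF \<kappa>(1)] by blast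
  have "min (\<beta>\<^sup>2) e1 > 0" using \<beta> e1 by simp
  from D2[OF \<kappa>(1) this] obtain F where F: "F \<in> bohr_ap (min (\<beta>\<^sup>2) e1)" "m (\<lambda>z. (f z - F z)\<^sup>2) \<le> D + \<kappa>" by blast
  have bF: "bfun F" using F bohr_ap_bfun by auto
  have F1: "F \<in> bohr_ap e1" using F(1) by (rule bohr_ap_mono) simp
  have F\<beta>: "F \<in> bohr_ap (\<beta>\<^sup>2)" using F(1) by (rule bohr_ap_mono) simp
  define P where "P u \<longleftrightarrow> m (\<lambda>z. (F (z + u) - F z)\<^sup>2) \<le> \<beta>\<^sup>2" for u
  have evP: "eventually P bohr_filter" using F\<beta> by (simp add: bohr_ap_def P_def[abs_def])
  have Pn: "nrm (\<lambda>z. F (z + u) - F z) \<le> \<beta>" if "P u" for u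
    unfolding nrm_def using that \<beta> by (intro real_le_lsqrt) (auto simp: P_def)
  have Pm: "nrm (\<lambda>z. F (z + - u) - F z) \<le> \<beta>" if "P u" for u
  proof -
    have "bfun (\<lambda>z. F (z + - u) - F z)" by (intro bfun_diff bF bfun_comp[OF bF])
    from nrm_shift[OF this, of u] have "nrm (\<lambda>z. F (z + - u) - F z) = nrm (\<lambda>z. F z - F (z + u))" by simp
    also have "\<dots> = nrm (\<lambda>z. F (z + u) - F z)" by (rule nrm_minus_commute)
    finally show ?thesis using Pn[OF that] by simp
  qed
  define B where "B y \<longleftrightarrow> P (zmul r y) \<and> P (zmul s y)" for y
  have "eventually B bohr_filter"
    unfolding B_def[abs_def] using filterlim_zmul_bohr[of r] filterlim_zmul_bohr[of s] evP
    by (intro eventually_conj) (auto simp: filterlim_iff)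
  then have "0 < m (\<lambda>y. of_bool (B y))" by (rule m_eventually_bohr)
  define b where "b = m (\<lambda>y. of_bool (B y))"
  have b: "b > 0" using \<open>0 < m (\<lambda>y. of_bool (B y))\<close> by (simp add: b_def)
  \<comment> \<open>The two error terms together, \<open>b * c ^ 3 / 8\<close>, stay below the main
    term \<open>b * c ^ 3 / 4\<close>.\<close>
  define \<epsilon> where "\<epsilon> = b * c ^ 3 / 16"
  have \<epsilon>: "\<epsilon> > 0" using b c by (simp add: \<epsilon>_def)
  define \<eta> where "\<eta> = \<epsilon> ^ 4 / (3 * C)"
  have Cpos: "C > 0" using conjunct1[OF C1] by (simp add: C_def)
  have \<eta>: "\<eta> > 0" using \<epsilon> Cpos by (simp add: \<eta>_def)
  have "C * (3 * \<eta>) = \<epsilon> ^ 4" using Cpos by (simp add: \<eta>_def)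
  moreover have "C1 * (3 * \<eta>) \<le> C * (3 * \<eta>)" "C2 * (3 * \<eta>) \<le> C * (3 * \<eta>)"
    using \<eta> by (auto simp: C_def intro!: mult_right_mono)
  ultimately have C\<epsilon>: "C1 * (3 * \<eta>) \<le> \<epsilon> ^ 4" "C2 * (3 * \<eta>) \<le> \<epsilon> ^ 4" by auto
  define \<kappa>' where "\<kappa>' = min \<kappa> (\<eta>\<^sup>2 / 2)"
  have \<kappa>': "0 < \<kappa>'" "2 * \<kappa>' \<le> 1" "\<kappa>' \<le> \<kappa>" using \<kappa> \<eta> by (auto simp: \<kappa>'_def)
  have s\<eta>: "sqrt (2 * \<kappa>') \<le> \<eta>" using \<eta> by (intro real_le_lsqrt) (auto simp: \<kappa>'_def)
  have s\<beta>: "sqrt (2 * \<kappa>') \<le> \<beta> / 4" unfolding sq\<kappa>(2)[symmetric] using \<kappa>' by simp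
  obtain e2 where e2: "e2 > 0" "\<And>F. F \<in> bohr_ap e2 \<Longrightarrow> D - \<kappa>' \<le> m (\<lambda>z. (f z - F z)\<^sup>2)"
    using D1[OF \<kappa>'(1)] by blast
  \<comment> \<open>The three bounds serve the comparison with \<open>F\<close>, the orthogonality
    of \<open>h\<close>, and a cutoff of \<open>G\<close> with Lipschitz constant
    \<open>1 / c\<close>.\<close>
  define e' where "e' = min e1 (min (e2 / 4) (c\<^sup>2 * (e2 / 4)))"
  have e': "e' > 0" "e' \<le> e1" "e' \<le> e2 / 4" "e' \<le> c\<^sup>2 * (e2 / 4)" using e1 e2 c by (auto simp: e'_def)
  obtain G where G: "G \<in> bohr_ap e'" "\<And>z. 0 \<le> G z" "\<And>z. G z \<le> 1" "m (\<lambda>z. (f z - G z)\<^sup>2) \<le> D + \<kappa>'"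
    using D2[OF \<kappa>'(1) e'(1)] by blast
  have bG: "bfun G" using G bohr_ap_bfun by auto
  have G2: "G \<in> bohr_ap (e2 / 4)" by (rule bohr_ap_mono[OF G(1) e'(3)])
  define h where "h z = f z - G z" for z
  have h: "\<bar>h z\<bar> \<le> 1" for z using f[of z] G(2,3)[of z] by (auto simp: h_def abs_le_iff)
  have bf: "bfun f" by (rule bfun_f[OF f])
  have bh: "bfun h" by (rule bfunI[OF h])
  have orth: "m (\<lambda>z. h z * Q z) \<le> sqrt (2 * \<kappa>')" if "Q \<in> bohr_ap (e2 / 4)" "\<And>z. \<bar>Q z\<bar> \<le> 1" for Q
    unfolding h_def by (rule near_minimizer_orthogonal[OF f e2(2) \<kappa>'(1,2) G2 G(4) that])
  have FG: "nrm (\<lambda>z. F z - G z) \<le> \<beta> / 2"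
  proof -
    have "m (\<lambda>z. (F z - G z)\<^sup>2) \<le> 8 * \<kappa>"
      by (rule near_minimizers_close[OF f e1(2) F1 F(2)]) (use bohr_ap_mono[OF G(1) e'(2)] G(4) \<kappa>'(3) in auto)
    then show ?thesis unfolding nrm_def sq\<kappa>(1)[symmetric] by simp
  qed
  have bGs: "bfun (\<lambda>z. G (z + u))" and bFs: "bfun (\<lambda>z. F (z + u))" for u
    by (rule bfun_comp[OF bG], rule bfun_comp[OF bF])
  \<comment> \<open>The summand \<open>\<beta>\<close> is twice the distance
    \<open>\<beta> / 2\<close> between \<open>F\<close> and \<open>G\<close>.\<close>
  have transfer: "nrm (\<lambda>z. G (z + u) - G z) \<le> \<delta> + \<beta>" if "nrm (\<lambda>z. F (z + u) - F z) \<le> \<delta>" for u \<delta>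
  proof -
    have "nrm (\<lambda>z. G (z + u) - G z) \<le> nrm (\<lambda>z. G (z + u) - F (z + u)) + nrm (\<lambda>z. F (z + u) - G z)"
      by (rule nrm_diff_triangle[OF bGs bFs bG])
    also have "nrm (\<lambda>z. F (z + u) - G z) \<le> nrm (\<lambda>z. F (z + u) - F z) + nrm (\<lambda>z. F z - G z)"
      by (rule nrm_diff_triangle[OF bFs bF bG])
    also have "nrm (\<lambda>z. G (z + u) - F (z + u)) = nrm (\<lambda>z. F z - G z)"
      using nrm_shift[of "\<lambda>z. G z - F z" u] nrm_minus_commute[of G F] bG bF by (simp add: bfun_diff)
    finally show ?thesis using FG that by simp
  qed
  show ?thesis
  proof (intro exI[of _ P] conjI evP allI impI)
    fix f0 :: "'a \<Rightarrow> real" and p x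
    assume p: "P p" and x: "P x" and f0: "\<forall>z. 0 \<le> f0 z \<and> f0 z \<le> f (z + p)" and cf0: "c \<le> m f0"
    have f01: "\<bar>f0 z\<bar> \<le> 1" "0 \<le> f0 z" "f0 z \<le> f (z + p)" for z
      using f0 f(2)[of "z + p"] by (auto intro: order_trans)
    have bf0: "bfun f0" by (rule bfunI[OF f01(1)])
    have f1: "\<bar>f z\<bar> \<le> 1" and G1: "\<bar>G z\<bar> \<le> 1" for z using f G(2,3) by (simp_all add: abs_le_iff)
    \<comment> \<open>The product \<open>f * f\<close> telescopes into \<open>G * G\<close>,
      \<open>G * h\<close> and \<open>f * h\<close>. The last term is translated by
      \<open>zmul r y\<close>, so that a factor without \<open>y\<close> remains as the van der
      Corput inequality requires.\<close>
    define \<Theta>1 where "\<Theta>1 y = m (\<lambda>z. f0 (z + zmul s y + x) * (G (z - zmul r y) * G z))" for y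
    define \<Theta>2 where "\<Theta>2 y = m (\<lambda>z. G z * (f0 (z + zmul s y + x) * h (z + zmul (- r) y)))" for y
    define \<Theta>3 where "\<Theta>3 y = m (\<lambda>z. f z * (f0 (z + zmul (s + r) y + x) * h (z + zmul r y)))" for y
    have split: "m (\<lambda>z. f0 (z + zmul s y + x) * (f (z - zmul r y) * f z)) = \<Theta>1 y + (\<Theta>2 y + \<Theta>3 y)" for y
    proof -
      have B1: "bfun (\<lambda>z. f0 (z + zmul s y + x) * (G (z - zmul r y) * G z))"
        and B2: "bfun (\<lambda>z. G z * (f0 (z + zmul s y + x) * h (z - zmul r y)))"
        and B3: "bfun (\<lambda>z. f (z - zmul r y) * (f0 (z + zmul s y + x) * h z))"
        by (intro bfun_mult bfun_comp[OF bf0] bfun_comp[OF bG] bfun_comp[OF bf] bfun_comp[OF bh] bG bh)+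
      have "m (\<lambda>z. f0 (z + zmul s y + x) * (f (z - zmul r y) * f z))
        = m (\<lambda>z. f0 (z + zmul s y + x) * (G (z - zmul r y) * G z) +
            (G z * (f0 (z + zmul s y + x) * h (z - zmul r y)) + f (z - zmul r y) * (f0 (z + zmul s y + x) * h z)))"
        by (rule arg_cong[where f = m]) (auto simp: h_def algebra_simps)
      also have "\<dots> = \<Theta>1 y + m (\<lambda>z. G z * (f0 (z + zmul s y + x) * h (z - zmul r y)) + f (z - zmul r y) * (f0 (z + zmul s y + x) * h z))"
        unfolding \<Theta>1_def by (rule m_add) (intro bfun_add B1 B2 B3)+
      also have "m (\<lambda>z. G z * (f0 (z + zmul s y + x) * h (z - zmul r y)) + f (z - zmul r y) * (f0 (z + zmul s y + x) * h z))
        = m (\<lambda>z. G z * (f0 (z + zmul s y + x) * h (z - zmul r y))) + m (\<lambda>z. f (z - zmul r y) * (f0 (z + zmul s y + x) * h z))"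
        by (rule m_add[OF B2 B3])
      also have "m (\<lambda>z. G z * (f0 (z + zmul s y + x) * h (z - zmul r y))) = \<Theta>2 y"
        by (simp add: \<Theta>2_def zmul_minus_left)
      also have "m (\<lambda>z. f (z - zmul r y) * (f0 (z + zmul s y + x) * h z)) = \<Theta>3 y"
        unfolding m_shift[OF B3, of "zmul r y", symmetric] \<Theta>3_def by (simp add: zmul_add_left algebra_simps)
      finally show ?thesis .
    qed
    have b1: "bfun \<Theta>1" unfolding \<Theta>1_def[abs_def]
      by (rule bfun_m[of _ 1]) (auto simp: abs_mult intro!: mult_le_one f01 G1)
    have b2: "bfun \<Theta>2" unfolding \<Theta>2_def[abs_def]
      by (rule bfun_m[of _ 1]) (auto simp: abs_mult intro!: mult_le_one f01 G1 h)
    have b3: "bfun \<Theta>3" unfolding \<Theta>3_def[abs_def]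
      by (rule bfun_m[of _ 1]) (auto simp: abs_mult intro!: mult_le_one f01 f1 h)
    have orth\<eta>: "m (\<lambda>z. h z * Q z) \<le> \<eta>" if "Q \<in> bohr_ap (e2 / 4)" "\<And>z. \<bar>Q z\<bar> \<le> 1" for Q
      using orth[OF that] s\<eta> by linarith
    have e24: "e2 / 4 > 0" using e2 by simp
    have err2: "\<bar>m \<Theta>2\<bar> \<le> \<epsilon>"
      unfolding \<Theta>2_def[abs_def]
      by (rule correlation_error[OF conjunct2[OF C1] conjunct1[OF C1] G1 f01(1) h \<eta> e24 \<epsilon> C\<epsilon>(1) orth\<eta>])
    have err3: "\<bar>m \<Theta>3\<bar> \<le> \<epsilon>"
      unfolding \<Theta>3_def[abs_def]
      by (rule correlation_error[OF conjunct2[OF C2] conjunct1[OF C2] f1 f01(1) h \<eta> e24 \<epsilon> C\<epsilon>(2) orth\<eta>])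
    have f0G: "c ^ 3 / 2 - c\<^sup>2 * \<beta> / 2 - 4 * c * \<beta> \<le> m (\<lambda>z. f0 z * (G z)\<^sup>2)"
    proof -
      \<comment> \<open>\<open>Q\<close> is a Lipschitz substitute for the indicator of the set where \<open>G\<close> is small; \<open>f\<close>, hence
        \<open>f0\<close>, carries little mass there.\<close>
      define Q where "Q z = max 0 (1 - G z / c)" for z
      have Q1: "\<bar>Q z\<bar> \<le> 1" "0 \<le> Q z" "Q z \<le> 1" for z using G(2)[of z] c by (auto simp: Q_def)
      have bQ: "bfun Q" by (rule bfunI[OF Q1(1)])
      have lip: "\<bar>max 0 (1 - a / c) - max 0 (1 - b / c)\<bar> \<le> 1 / c * \<bar>a - b\<bar>" for a b :: real
      proof -
        have "\<bar>max 0 (1 - a / c) - max 0 (1 - b / c)\<bar> \<le> \<bar>(1 - a / c) - (1 - b / c)\<bar>" by linarith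
        also have "(1 - a / c) - (1 - b / c) = (b - a) / c" by (simp add: diff_divide_distrib)
        also have "\<bar>(b - a) / c\<bar> = 1 / c * \<bar>a - b\<bar>"
          using c by (simp only: abs_divide abs_minus_commute[of b a]) simp
        finally show ?thesis .
      qed
      have "(\<lambda>z. max 0 (1 - G z / c)) \<in> bohr_ap ((1 / c)\<^sup>2 * e')"
        by (rule bohr_ap_lipschitz[OF G(1) lip]) (use bQ in \<open>simp add: Q_def[abs_def]\<close>)
      then have "Q \<in> bohr_ap (e2 / 4)"
        unfolding Q_def[abs_def] by (rule bohr_ap_mono) (use e'(4) c in \<open>simp add: power_divide field_simps\<close>)
      then have hQ: "m (\<lambda>z. h z * Q z) \<le> \<beta> / 4" using orth Q1(1) s\<beta> by (meson order_trans)
      have GQ: "m (\<lambda>z. G z * Q z) \<le> c / 4"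
      proof (rule m_le_const)
        show "bfun (\<lambda>z. G z * Q z)" by (intro bfun_mult bG bQ)
        show "G z * Q z \<le> c / 4" for z
        proof (cases "G z \<le> c")
          case True
          then have "Q z = 1 - G z / c" using c by (simp add: Q_def)
          moreover have "c / 4 - G z * (1 - G z / c) = (G z - c / 2)\<^sup>2 / c"
            using c by (simp add: power2_eq_square field_simps)
          ultimately have "c / 4 - G z * Q z = (G z - c / 2)\<^sup>2 / c" by simp
          then show ?thesis using c by (metis diff_ge_0_iff_ge divide_nonneg_pos zero_le_power2)
        next
          case False
          then have "Q z = 0" using c by (simp add: Q_def)
          then show ?thesis using c by simp
        qed
      qed
      have fQ: "m (\<lambda>z. f z * Q z) \<le> c / 4 + \<beta> / 4"
      proof -
        have "m (\<lambda>z. f z * Q z) = m (\<lambda>z. G z * Q z + h z * Q z)" by (simp add: h_def algebra_simps)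
        also have "\<dots> = m (\<lambda>z. G z * Q z) + m (\<lambda>z. h z * Q z)" by (rule m_add) (intro bfun_mult bG bQ bh)+
        finally show ?thesis using GQ hQ by linarith
      qed
      have f0Q: "m (\<lambda>z. f0 z * Q z) \<le> c / 4 + \<beta> / 4 + 2 * \<beta> / c"
      proof -
        have bQd: "bfun (\<lambda>z. Q (z + - p) - Q z)" by (intro bfun_diff bQ bfun_comp[OF bQ])
        have "m (\<lambda>z. f0 z * Q z) \<le> m (\<lambda>z. f (z + p) * Q z)"
        proof (rule m_mono)
          show "f0 z * Q z \<le> f (z + p) * Q z" for z by (rule mult_right_mono) (use f01 Q1 in auto)
        qed (intro bfun_mult bQ bf0 bfun_comp[OF bf])+
        also have "\<dots> = m (\<lambda>z. f z * Q (z + - p))"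
        proof -
          have "bfun (\<lambda>z. f (z + p) * Q z)" by (intro bfun_mult bQ bfun_comp[OF bf])
          from m_shift[OF this, of "- p"] show ?thesis by simp
        qed
        also have "\<dots> = m (\<lambda>z. f z * Q z + f z * (Q (z + - p) - Q z))" by (simp add: algebra_simps)
        also have "\<dots> = m (\<lambda>z. f z * Q z) + m (\<lambda>z. f z * (Q (z + - p) - Q z))"
          by (rule m_add) (intro bfun_mult bf bQ bQd)+
        also have "m (\<lambda>z. f z * (Q (z + - p) - Q z)) \<le> nrm (\<lambda>z. Q (z + - p) - Q z)"
          by (rule order_trans[OF abs_ge_self abs_m_mult_le[OF bQd f1]])
        also have "\<dots> \<le> nrm (\<lambda>z. 1 / c * (G (z + - p) - G z))"
        proof (rule nrm_mono)
          show "\<bar>Q (z + - p) - Q z\<bar> \<le> \<bar>1 / c * (G (z + - p) - G z)\<bar>" for z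
            using lip[of "G (z + - p)" "G z"] c by (simp add: Q_def abs_mult)
        qed (intro bfun_mult bfun_const bfun_diff bQd bG bGs bQ bfun_comp[OF bQ])+
        also have "nrm (\<lambda>z. 1 / c * (G (z + - p) - G z)) = 1 / c * nrm (\<lambda>z. G (z + - p) - G z)"
        proof -
          have "bfun (\<lambda>z. (G (z + - p) - G z)\<^sup>2)" by (intro bfun_power2 bfun_diff bG bGs)
          then have "m (\<lambda>z. (1 / c * (G (z + - p) - G z))\<^sup>2) = (1 / c)\<^sup>2 * m (\<lambda>z. (G (z + - p) - G z)\<^sup>2)"
            unfolding power_mult_distrib by (rule m_cmult)
          then show ?thesis unfolding nrm_def using c by (simp add: real_sqrt_mult real_sqrt_divide)
        qed
        also have "\<dots> \<le> 1 / c * (\<beta> + \<beta>)"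
          using c by (intro mult_left_mono transfer Pm p) auto
        also have "1 / c * (\<beta> + \<beta>) = 2 * \<beta> / c" by simp
        finally show ?thesis using fQ by linarith
      qed
      \<comment> \<open>Since \<open>G z\<close> is at least \<open>c * (1 - Q z)\<close>, its
        square is at least \<open>c\<^sup>2 * (1 - 2 * Q z)\<close>, which is linear in
        \<open>Q\<close>.\<close>
      have "c\<^sup>2 * (c - 2 * (c / 4 + \<beta> / 4 + 2 * \<beta> / c)) \<le> c\<^sup>2 * (m f0 - 2 * m (\<lambda>z. f0 z * Q z))"
        using f0Q cf0 by (intro mult_left_mono) auto
      also have "\<dots> = c\<^sup>2 * m (\<lambda>z. f0 z - 2 * (f0 z * Q z))"
        using m_diff[OF bf0 bfun_mult[OF bfun_const bfun_mult[OF bf0 bQ]], of 2] m_cmult[OF bfun_mult[OF bf0 bQ], of 2] by simp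
      also have "\<dots> = m (\<lambda>z. c\<^sup>2 * (f0 z - 2 * (f0 z * Q z)))"
        by (rule m_cmult[symmetric]) (intro bfun_diff bfun_mult bfun_const bf0 bQ)
      also have "\<dots> \<le> m (\<lambda>z. f0 z * (G z)\<^sup>2)"
      proof (rule m_mono)
        fix z
        have "c * (1 - Q z) \<le> G z" using G(2)[of z] c by (auto simp: Q_def field_simps max_def)
        then have "(c * (1 - Q z))\<^sup>2 \<le> (G z)\<^sup>2" using Q1(3)[of z] c by (intro power_mono) auto
        moreover have "c\<^sup>2 * (1 - 2 * Q z) \<le> (c * (1 - Q z))\<^sup>2"
          unfolding power_mult_distrib by (rule mult_left_mono) (simp_all add: power2_diff)
        ultimately have "c\<^sup>2 * (1 - 2 * Q z) \<le> (G z)\<^sup>2" by linarith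
        from mult_left_mono[OF this f01(2)[of z]]
        show "c\<^sup>2 * (f0 z - 2 * (f0 z * Q z)) \<le> f0 z * (G z)\<^sup>2" by (simp add: algebra_simps)
      qed (intro bfun_mult bfun_diff bfun_const bf0 bQ bfun_power2 bG)+
      finally have "c\<^sup>2 * (c - 2 * (c / 4 + \<beta> / 4 + 2 * \<beta> / c)) \<le> m (\<lambda>z. f0 z * (G z)\<^sup>2)" .
      moreover have "c\<^sup>2 * (c - 2 * (c / 4 + \<beta> / 4 + 2 * \<beta> / c)) = c ^ 3 / 2 - c\<^sup>2 * \<beta> / 2 - 4 * c * \<beta>"
        using c by (simp add: power2_eq_square power3_eq_cube field_simps)
      ultimately show ?thesis by simp
    qed
    have low: "c ^ 3 / 4 \<le> \<Theta>1 y" if "B y" for y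
    proof -
      define v where "v = zmul s y + x"
      have "nrm (\<lambda>z. F (z + - v) - F z) \<le> \<beta> + \<beta>"
      proof -
        have bFu: "bfun (\<lambda>z. F (z + - zmul s y) - F z)" by (intro bfun_diff bF bFs)
        have "nrm (\<lambda>z. F (z + - v) - F z) \<le> nrm (\<lambda>z. F (z + - v) - F (z + - x)) + nrm (\<lambda>z. F (z + - x) - F z)"
          by (rule nrm_diff_triangle[OF bFs bFs bF])
        also have "nrm (\<lambda>z. F (z + - v) - F (z + - x)) = nrm (\<lambda>z. F (z + - zmul s y) - F z)"
          using nrm_shift[OF bFu, of "- x"] by (simp add: v_def algebra_simps)
        finally show ?thesis using Pm[of "zmul s y"] Pm[OF x] that by (simp add: B_def)
      qed
      from transfer[OF this] have nv: "nrm (\<lambda>z. G (z + - v) - G z) \<le> 3 * \<beta>" by simp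
      have nr: "nrm (\<lambda>z. G (z + - zmul r y) - G z) \<le> 2 * \<beta>"
        using transfer[OF Pm[of "zmul r y"]] that by (simp add: B_def)
      have bd1: "bfun (\<lambda>z. G (z + - zmul r y) - G z)" and bd2: "bfun (\<lambda>z. G (z + - v) - G z)"
        by (intro bfun_diff bG bGs)+
      have bf0v: "bfun (\<lambda>z. f0 (z + v))" by (rule bfun_comp[OF bf0])
      have "\<Theta>1 y = m (\<lambda>z. f0 (z + v) * (G z)\<^sup>2 + (f0 (z + v) * G z) * (G (z + - zmul r y) - G z))"
        unfolding \<Theta>1_def v_def by (rule arg_cong[where f = m]) (auto simp: power2_eq_square algebra_simps)
      also have "\<dots> = m (\<lambda>z. f0 (z + v) * (G z)\<^sup>2) + m (\<lambda>z. (f0 (z + v) * G z) * (G (z + - zmul r y) - G z))"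
        by (rule m_add) (intro bfun_mult bf0v bG bd1 bfun_power2)+
      finally have \<Theta>1: "\<Theta>1 y = m (\<lambda>z. f0 (z + v) * (G z)\<^sup>2) + m (\<lambda>z. (f0 (z + v) * G z) * (G (z + - zmul r y) - G z))" .
      have "\<bar>m (\<lambda>z. (f0 (z + v) * G z) * (G (z + - zmul r y) - G z))\<bar> \<le> nrm (\<lambda>z. G (z + - zmul r y) - G z)"
        by (rule abs_m_mult_le[OF bd1]) (auto simp: abs_mult intro!: mult_le_one f01 G1)
      then have 1: "- (2 * \<beta>) \<le> m (\<lambda>z. (f0 (z + v) * G z) * (G (z + - zmul r y) - G z))" using nr by linarith
      have "bfun (\<lambda>z. f0 (z + v) * (G z)\<^sup>2)" by (intro bfun_mult bf0v bfun_power2 bG)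
      from m_shift[OF this, of "- v"]
      have "m (\<lambda>z. f0 (z + v) * (G z)\<^sup>2) = m (\<lambda>z. f0 z * (G (z + - v))\<^sup>2)" by simp
      \<comment> \<open>The difference of squares is factored so that the cofactor of the small
        difference has modulus at most 1.\<close>
      also have "\<dots> = m (\<lambda>z. f0 z * (G z)\<^sup>2 + 2 * ((f0 z * ((G (z + - v) + G z) / 2)) * (G (z + - v) - G z)))"
        by (rule arg_cong[where f = m]) (auto simp: power2_eq_square field_simps)
      also have "\<dots> = m (\<lambda>z. f0 z * (G z)\<^sup>2) + m (\<lambda>z. 2 * ((f0 z * ((G (z + - v) + G z) / 2)) * (G (z + - v) - G z)))"
        by (rule m_add) (intro bfun_mult bfun_const bf0 bfun_power2 bG bd2 bfun_divide bfun_add bGs)+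
      also have "m (\<lambda>z. 2 * ((f0 z * ((G (z + - v) + G z) / 2)) * (G (z + - v) - G z)))
         = 2 * m (\<lambda>z. (f0 z * ((G (z + - v) + G z) / 2)) * (G (z + - v) - G z))"
        by (rule m_cmult) (intro bfun_mult bf0 bG bd2 bfun_divide bfun_add bGs)
      finally have 2: "m (\<lambda>z. f0 (z + v) * (G z)\<^sup>2) = m (\<lambda>z. f0 z * (G z)\<^sup>2)
         + 2 * m (\<lambda>z. (f0 z * ((G (z + - v) + G z) / 2)) * (G (z + - v) - G z))" .
      have "\<bar>m (\<lambda>z. (f0 z * ((G (z + - v) + G z) / 2)) * (G (z + - v) - G z))\<bar> \<le> nrm (\<lambda>z. G (z + - v) - G z)"
      proof (rule abs_m_mult_le[OF bd2])
        fix z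
        have "\<bar>(G (z + - v) + G z) / 2\<bar> \<le> 1" using G1[of "z + - v"] G1[of z] by (simp add: abs_le_iff)
        then show "\<bar>f0 z * ((G (z + - v) + G z) / 2)\<bar> \<le> 1"
          using f01(1)[of z] by (subst abs_mult) (intro mult_le_one, auto)
      qed
      then have 3: "- (3 * \<beta>) \<le> m (\<lambda>z. (f0 z * ((G (z + - v) + G z) / 2)) * (G (z + - v) - G z))" using nv by linarith
      have c2: "c\<^sup>2 * \<beta> \<le> \<beta>" "c * \<beta> \<le> \<beta>" using c \<beta> by (auto intro!: mult_left_le_one_le power_le_one)
      have "c ^ 3 / 2 - \<beta> / 2 - 4 * \<beta> - 6 * \<beta> - 2 * \<beta> \<le> \<Theta>1 y"
        using \<Theta>1 1 2 3 f0G c2 by linarith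
      moreover have "c ^ 3 = 96 * \<beta>" by (simp add: \<beta>_def)
      ultimately show ?thesis using \<beta> by linarith
    qed
    have "b * (c ^ 3 / 4) \<le> m \<Theta>1"
    proof -
      have bB: "bfun (\<lambda>y. of_bool (B y))" by (rule bfunI[of _ 1]) auto
      have "b * (c ^ 3 / 4) = m (\<lambda>y. (c ^ 3 / 4) * of_bool (B y))"
        using m_cmult[OF bB, of "c ^ 3 / 4"] by (simp add: b_def mult.commute)
      also have "\<dots> \<le> m \<Theta>1"
      proof (rule m_mono[OF _ b1])
        show "bfun (\<lambda>y. (c ^ 3 / 4) * of_bool (B y))" by (intro bfun_mult bfun_const bB)
        show "c ^ 3 / 4 * of_bool (B y) \<le> \<Theta>1 y" for y
        proof (cases "B y")
          case True
          then show ?thesis using low by simp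
        next
          case False
          have "0 \<le> \<Theta>1 y" unfolding \<Theta>1_def
          proof (rule m_nonneg)
            show "0 \<le> f0 (z + zmul s y + x) * (G (z - zmul r y) * G z)" for z
              by (intro mult_nonneg_nonneg f01 G)
          qed (intro bfun_mult bfun_comp[OF bf0] bfun_comp[OF bG] bG)
          then show ?thesis using False by simp
        qed
      qed
      finally show ?thesis .
    qed
    moreover have "m (\<lambda>y. m (\<lambda>z. f0 (z + zmul s y + x) * (f (z - zmul r y) * f z))) = m \<Theta>1 + (m \<Theta>2 + m \<Theta>3)"
      unfolding split m_add[OF b1 bfun_add[OF b2 b3]] m_add[OF b2 b3] ..
    moreover have "2 * \<epsilon> < b * (c ^ 3 / 4)" using b c by (simp add: \<epsilon>_def)
    ultimately show "0 < m (\<lambda>y. m (\<lambda>z. f0 (z + zmul s y + x) * (f (z - zmul r y) * f z)))"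
      using err2 err3 by linarith
  qed
qed

end

subsection \<open>Solutions with distinct entries\<close>

text \<open>Infinitely many translates of the fibre are pairwise disjoint, and all have the same
  mean.\<close>

lemma (in mean) m_fibre_zmul_eq_0:
  assumes "infinite (mult_set r :: 'a set)"
  shows "m (\<lambda>y. of_bool (zmul r y = g)) = 0"
proof (rule ccontr)
  define \<mu> where "\<mu> = m (\<lambda>y. of_bool (zmul r y = g))"
  have b: "bfun (\<lambda>y. of_bool (zmul r (y + v) = g))" for v by (rule bfunI[of _ 1]) auto
  have b0: "bfun (\<lambda>y. of_bool (zmul r y = g))" by (rule bfunI[of _ 1]) auto
  assume "m (\<lambda>y. of_bool (zmul r y = g)) \<noteq> 0"
  moreover have "0 \<le> \<mu>" unfolding \<mu>_def by (rule m_nonneg[OF b0]) simp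
  ultimately have \<mu>: "\<mu> > 0" by (simp add: \<mu>_def)
  obtain w :: "nat \<Rightarrow> 'a" where w: "inj w" "range w \<subseteq> mult_set r"
    using infinite_countable_subset[OF assms] by blast
  have "\<exists>v. w i = zmul r v" for i using w(2) by (auto simp: mult_set_def)
  then obtain v where v: "\<And>i. w i = zmul r (v i)" by metis
  have "real n * \<mu> \<le> 1" for n
  proof -
    have "real n * \<mu> = (\<Sum>i<n. m (\<lambda>y. of_bool (zmul r (y + v i) = g)))"
      by (simp add: m_shift[OF b0] \<mu>_def)
    also have "\<dots> = m (\<lambda>y. \<Sum>i<n. of_bool (zmul r (y + v i) = g))" by (rule m_sum[symmetric]) (rule b)
    also have "\<dots> \<le> 1"
    proof (rule m_le_const)
      show "bfun (\<lambda>y. \<Sum>i<n. of_bool (zmul r (y + v i) = g))" by (rule bfun_sum) (rule b)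
      fix y
      define I where "I = {i. i < n \<and> zmul r (y + v i) = g}"
      have "card I \<le> 1"
      proof (rule ccontr)
        assume "\<not> card I \<le> 1"
        then obtain i j where "i \<in> I" "j \<in> I" "i \<noteq> j"
          by (metis card_le_Suc0_iff_eq card.infinite One_nat_def zero_le_one)
        then have "w i = w j" by (auto simp: I_def v zmul_add_right dest: sym)
        then show False using w(1) \<open>i \<noteq> j\<close> by (auto dest: injD)
      qed
      moreover have "(\<Sum>i<n. of_bool (zmul r (y + v i) = g)) = real (card I)"
        unfolding of_bool_def I_def by (simp add: sum.If_cases Int_def)
      ultimately show "(\<Sum>i<n. of_bool (zmul r (y + v i) = g)) \<le> (1 :: real)" by simp
    qed
    finally show ?thesis .
  qed
  moreover obtain n where "1 < real n * \<mu>" using reals_Archimedean3[OF \<mu>] by blast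
  ultimately show False by (meson not_le)
qed

text \<open>Among \<open>N\<close> translates of \<open>A\<close>, at least \<open>k\<close> overlap
  on a set of definite mean, and there are at most \<open>2 ^ N\<close> choices of which. It matters
  that \<open>c\<close> is independent of \<open>S\<close>: the set \<open>S\<close> is later built
  from a neighbourhood that depends on \<open>c\<close>.\<close>

lemma (in mean) pigeonhole_translates:
  fixes A :: "'a set" and k :: nat and f :: "'a \<Rightarrow> real"
  defines "f \<equiv> \<lambda>z. of_bool (z \<in> A)"
  assumes pos: "0 < m f" and k: "k > 0"
  shows "\<exists>c>0. c \<le> 1 \<and> (\<forall>S. infinite S \<longrightarrow>
    (\<exists>q. inj_on q {..<k} \<and> q ` {..<k} \<subseteq> S \<and> c \<le> m (\<lambda>z. \<Prod>i<k. f (z + q i))))"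
proof -
  define \<delta> where "\<delta> = m f"
  have f01: "0 \<le> f z" "f z \<le> 1" for z by (auto simp: f_def)
  have bf: "bfun f" by (rule bfunI[of _ 1]) (auto simp: f_def)
  have \<delta>: "0 < \<delta>" "\<delta> \<le> 1" using pos m_le_const[OF bf f01(2)] by (auto simp: \<delta>_def)
  obtain N where N: "2 * real k < real N * \<delta>" using reals_Archimedean3[OF \<delta>(1)] by blast
  have N0: "0 < N" using N by (cases N) auto
  \<comment> \<open>The normalised excess of the count over \<open>k\<close> has mean above
    \<open>\<delta> / 2\<close>, shared among at most \<open>2 ^ N\<close> index sets.\<close>
  define c where "c = \<delta> / 2 / 2 ^ N"
  have "(1 :: real) \<le> 2 ^ N" by simp
  then have c: "0 < c" "c \<le> 1" using \<delta> by (auto simp: c_def divide_le_eq simp del: one_le_power)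
  have main: "\<exists>q. inj_on q {..<k} \<and> q ` {..<k} \<subseteq> S \<and> c \<le> m (\<lambda>z. \<Prod>i<k. f (z + q i))"
    if S: "infinite S" for S
  proof -
    obtain e :: "nat \<Rightarrow> 'a" where e: "inj e" "range e \<subseteq> S" using infinite_countable_subset[OF S] by blast
    define \<I> where "\<I> = {I. I \<subseteq> {..<N} \<and> card I = k}"
    have f\<I>: "finite \<I>" unfolding \<I>_def by (rule finite_subset[of _ "Pow {..<N}"]) auto
    have c\<I>: "card \<I> \<le> 2 ^ N"
      using card_mono[of "Pow {..<N}" \<I>] by (auto simp: \<I>_def card_Pow)
    have bp: "bfun (\<lambda>z. \<Prod>i\<in>I. f (z + e i))" for I by (rule bfun_prod) (rule bfun_comp[OF bf])
    define \<Phi> where "\<Phi> z = (\<Sum>i<N. f (z + e i))" for z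
    have b\<Phi>: "bfun \<Phi>" unfolding \<Phi>_def[abs_def] by (rule bfun_sum) (rule bfun_comp[OF bf])
    have pw: "inverse (real N) * (\<Phi> z - real k) \<le> (\<Sum>I\<in>\<I>. \<Prod>i\<in>I. f (z + e i))" for z
    proof (cases "real k \<le> \<Phi> z")
      case True
      define M where "M = {i. i < N \<and> z + e i \<in> A}"
      have "\<Phi> z = real (card M)"
        unfolding \<Phi>_def f_def of_bool_def M_def by (simp add: sum.If_cases Int_def)
      then have "k \<le> card M" using True by simp
      then obtain I where I: "I \<subseteq> M" "card I = k" by (meson obtain_subset_with_card_n)
      then have I\<I>: "I \<in> \<I>" by (auto simp: \<I>_def M_def)
      have "(\<Prod>i\<in>I. f (z + e i)) = 1" using I(1) by (intro prod.neutral) (auto simp: M_def f_def)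
      moreover have "(\<Prod>i\<in>I. f (z + e i)) \<le> (\<Sum>I\<in>\<I>. \<Prod>i\<in>I. f (z + e i))"
        using I\<I> f\<I> f01 by (intro member_le_sum) (auto intro!: prod_nonneg)
      moreover have "\<Phi> z \<le> real N"
      proof -
        have "\<Phi> z \<le> (\<Sum>i<N. 1)" unfolding \<Phi>_def by (intro sum_mono f01)
        then show ?thesis by simp
      qed
      moreover have "inverse (real N) * (\<Phi> z - real k) \<le> inverse (real N) * real N"
        using \<open>\<Phi> z \<le> real N\<close> by (intro mult_left_mono) auto
      ultimately show ?thesis using N0 by simp
    next
      case False
      then have "inverse (real N) * (\<Phi> z - real k) \<le> 0" by (intro mult_nonneg_nonpos) auto
      also have "0 \<le> (\<Sum>I\<in>\<I>. \<Prod>i\<in>I. f (z + e i))" by (intro sum_nonneg prod_nonneg) (simp add: f01)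
      finally show ?thesis .
    qed
    have m\<Phi>: "m \<Phi> = real N * \<delta>"
    proof -
      have "m \<Phi> = (\<Sum>i<N. m (\<lambda>z. f (z + e i)))"
        unfolding \<Phi>_def[abs_def] by (rule m_sum) (rule bfun_comp[OF bf])
      then show ?thesis by (simp add: m_shift[OF bf] \<delta>_def)
    qed
    have "inverse (real N) * (real N * \<delta> - real k) = m (\<lambda>z. inverse (real N) * (\<Phi> z - real k))"
    proof -
      have "m (\<lambda>z. inverse (real N) * (\<Phi> z - real k)) = inverse (real N) * m (\<lambda>z. \<Phi> z - real k)"
        by (rule m_cmult) (intro bfun_diff b\<Phi> bfun_const)
      also have "m (\<lambda>z. \<Phi> z - real k) = m \<Phi> - real k" using m_diff[OF b\<Phi> bfun_const, of "real k"] by simp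
      finally show ?thesis by (simp add: m\<Phi>)
    qed
    also have "\<dots> \<le> m (\<lambda>z. \<Sum>I\<in>\<I>. \<Prod>i\<in>I. f (z + e i))"
      by (rule m_mono[OF _ _ pw]) (intro bfun_mult bfun_const bfun_diff b\<Phi> bfun_sum bp)+
    also have "\<dots> = (\<Sum>I\<in>\<I>. m (\<lambda>z. \<Prod>i\<in>I. f (z + e i)))" by (rule m_sum) (rule bp)
    finally have le: "inverse (real N) * (real N * \<delta> - real k) \<le> (\<Sum>I\<in>\<I>. m (\<lambda>z. \<Prod>i\<in>I. f (z + e i)))" .
    have half: "\<delta> / 2 < inverse (real N) * (real N * \<delta> - real k)"
      using N N0 by (simp add: field_simps)
    have "\<exists>I\<in>\<I>. c \<le> m (\<lambda>z. \<Prod>i\<in>I. f (z + e i))"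
    proof (rule ccontr)
      assume "\<not> ?thesis"
      then have "(\<Sum>I\<in>\<I>. m (\<lambda>z. \<Prod>i\<in>I. f (z + e i))) \<le> (\<Sum>I\<in>\<I>. c)" by (intro sum_mono) auto
      also have "\<dots> \<le> 2 ^ N * c" using c\<I> c(1) by (simp add: mult_right_mono)
      also have "\<dots> = \<delta> / 2" by (simp add: c_def)
      finally show False using le half by linarith
    qed
    then obtain I where I: "I \<in> \<I>" "c \<le> m (\<lambda>z. \<Prod>i\<in>I. f (z + e i))" by blast
    have "finite I" "card I = k" using I(1) finite_subset by (auto simp: \<I>_def)
    then obtain g where g: "bij_betw g {..<k} I"
      using ex_bij_betw_nat_finite[of I] by (auto simp: atLeast0LessThan)
    have "(\<Prod>i<k. f (z + e (g i))) = (\<Prod>i\<in>I. f (z + e i))" for z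
      by (rule prod.reindex_bij_betw[OF g, of "\<lambda>i. f (z + e i)"])
    then have "c \<le> m (\<lambda>z. \<Prod>i<k. f (z + (e \<circ> g) i))" using I(2) by simp
    moreover have "inj_on (e \<circ> g) {..<k}"
      using g e(1) by (intro comp_inj_on) (auto simp: bij_betw_def intro: inj_on_subset)
    moreover have "(e \<circ> g) ` {..<k} \<subseteq> S" using e(2) by auto
    ultimately show ?thesis by blast
  qed
  show ?thesis using c main by blast
qed

text \<open>Continuity of integer combinations at 0; the sign fits the correction term
  \<open>x0\<close> of the main argument.\<close>

lemma eventually_bohr_lin_comb:
  fixes k :: nat and c :: "nat \<Rightarrow> int"
  assumes "eventually P bohr_filter"
  shows "\<exists>Q. eventually Q bohr_filter \<and> (\<forall>q. (\<forall>i<k. Q (q i)) \<longrightarrow> P (- (\<Sum>i<k. zmul (c i) (q i))))"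
  using assms
proof (induction k arbitrary: P)
  case 0
  then show ?case using eventually_bohr_0[of P] by (intro exI[of _ "\<lambda>_. True"]) auto
next
  case (Suc k)
  obtain R where R: "eventually R bohr_filter" "\<And>x y. R x \<Longrightarrow> R y \<Longrightarrow> P (x + y)"
    using eventually_bohr_add[OF Suc.prems] by metis
  obtain Q where Q: "eventually Q bohr_filter" "\<forall>q. (\<forall>i<k. Q (q i)) \<longrightarrow> R (- (\<Sum>i<k. zmul (c i) (q i)))"
    using Suc.IH[OF R(1)] by blast
  have "eventually (\<lambda>x. R (zmul (- c k) x)) bohr_filter"
    using filterlim_zmul_bohr[of "- c k"] R(1) by (auto simp: filterlim_iff)
  with Q(1) have "eventually (\<lambda>x. Q x \<and> R (zmul (- c k) x)) bohr_filter" by (rule eventually_conj)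
  moreover have "P (- (\<Sum>i<Suc k. zmul (c i) (q i)))" if q: "\<forall>i<Suc k. Q (q i) \<and> R (zmul (- c k) (q i))" for q
  proof -
    have "P (- (\<Sum>i<k. zmul (c i) (q i)) + zmul (- c k) (q k))"
      using q Q(2) by (intro R(2)) auto
    then show ?thesis by (simp add: zmul_minus_left)
  qed
  ultimately show ?case by blast
qed

text \<open>The order of choices is decisive: the bound \<open>c0\<close>, the neighbourhood
  \<open>P\<close>, the elements \<open>q i\<close> with their correction \<open>x0\<close>, and
  last the target \<open>zmul r w'\<close>, for which \<open>w' + x0\<close> is an admissible
  \<open>x\<close>.\<close>

lemma (in ergodic_mean) eventually_lin_comb_set:
  fixes A :: "'a set" and c :: "nat \<Rightarrow> int"
  assumes inf: "infinite (UNIV :: 'a set)" and A: "0 < m (\<lambda>x. of_bool (x \<in> A))" and d: "d \<ge> 3"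
    and fin: "\<And>i. i < d \<Longrightarrow> finite_index (mult_set (c i) :: 'a set)"
    and fin': "finite_index (mult_set (c (d - 2) + c (d - 1)) :: 'a set)"
    and zero: "\<And>g :: 'a. zmul (\<Sum>i<d. c i) g = 0"
  shows "eventually (\<lambda>w. w \<in> lin_comb_set d c A) bohr_filter"
proof -
  define k where "k = d - 2"
  \<comment> \<open>\<open>d \<ge> 3\<close> leaves at least one translate, through which
    \<open>f0\<close> is bounded by a translate of \<open>f\<close>.\<close>
  have d_eq: "d = Suc (Suc k)" and k: "k > 0" using d by (auto simp: k_def)
  \<comment> \<open>Indices start at 0, so the last two coefficients are \<open>c k\<close> and
    \<open>c (Suc k)\<close>. As \<open>r + s + t\<close> kills the group, \<open>r\<close> and
    \<open>r + s\<close> act as \<open>- (s + t)\<close> and \<open>- t\<close>, which gives them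
    images of finite index.\<close>
  define r s t where "r = (\<Sum>i<k. c i)" and "s = c k" and "t = c (Suc k)"
  have rst: "zmul r g + (zmul s g + zmul t g) = 0" for g :: 'a
    using zero[of g] by (simp add: d_eq r_def s_def t_def zmul_add_left add.assoc)
  have st: "zmul (s + t) g = zmul (- r) g" for g :: 'a
    using rst[of g] by (simp add: zmul_add_left zmul_minus_left eq_neg_iff_add_eq_0 add.commute)
  have rs: "zmul (r + s) g = zmul (- t) g" for g :: 'a
    using rst[of g] by (simp add: zmul_add_left zmul_minus_left eq_neg_iff_add_eq_0 add.assoc)
  have fin_s: "finite_index (mult_set s :: 'a set)" using fin[of k] by (simp add: s_def d_eq)
  have "mult_set (s + t) = (mult_set (- r) :: 'a set)" 
    unfolding mult_set_def by (rule arg_cong[where f = range], rule ext, rule st)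
  then have fin_r: "finite_index (mult_set r :: 'a set)"
    using fin' by (simp add: mult_set_uminus s_def t_def d_eq)
  have "mult_set (r + s) = (mult_set (- t) :: 'a set)" 
    unfolding mult_set_def by (rule arg_cong[where f = range], rule ext, rule rs)
  then have fin_rs: "finite_index (mult_set (r + s) :: 'a set)"
    using fin[of "Suc k"] by (simp add: mult_set_uminus t_def d_eq)
  have r0: "r \<noteq> 0"
  proof
    assume "r = 0"
    then have "mult_set r = {0 :: 'a}" by (auto simp: mult_set_def)
    then show False using infinite_mult_set[OF fin_r inf] by simp
  qed
  define f :: "'a \<Rightarrow> real" where "f z = of_bool (z \<in> A)" for z
  have f01: "0 \<le> f z" "f z \<le> 1" for z by (auto simp: f_def)
  have bf: "bfun f" by (rule bfunI[of _ 1]) (auto simp: f_def)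
  have "\<exists>c>0. c \<le> 1 \<and> (\<forall>S. infinite S \<longrightarrow>
    (\<exists>q. inj_on q {..<k} \<and> q ` {..<k} \<subseteq> S \<and> c \<le> m (\<lambda>z. \<Prod>i<k. f (z + q i))))"
    unfolding f_def by (rule pigeonhole_translates[OF A k])
  then obtain c0 where c0: "0 < c0" "c0 \<le> 1" and pig: "\<forall>S. infinite S \<longrightarrow>
    (\<exists>q. inj_on q {..<k} \<and> q ` {..<k} \<subseteq> S \<and> c0 \<le> m (\<lambda>z. \<Prod>i<k. f (z + q i)))" by blast
  have "\<exists>P. eventually P bohr_filter \<and> (\<forall>f0 p x. P p \<longrightarrow> P x \<longrightarrow> (\<forall>z. 0 \<le> f0 z \<and> f0 z \<le> f (z + p)) \<longrightarrow> c0 \<le> m f0 \<longrightarrow>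
     0 < m (\<lambda>y. m (\<lambda>z. f0 (z + zmul s y + x) * (f (z - zmul r y) * f z))))"
    by (rule correlation_positive[OF f01 c0 fin_r fin_s fin_rs])
  then obtain P where evP: "eventually P bohr_filter"
    and P: "\<forall>f0 p x. P p \<longrightarrow> P x \<longrightarrow> (\<forall>z. 0 \<le> f0 z \<and> f0 z \<le> f (z + p)) \<longrightarrow> c0 \<le> m f0 \<longrightarrow>
     0 < m (\<lambda>y. m (\<lambda>z. f0 (z + zmul s y + x) * (f (z - zmul r y) * f z)))" by blast
  obtain P1 where P1: "eventually P1 bohr_filter" "\<And>x y. P1 x \<Longrightarrow> P1 y \<Longrightarrow> P (x + y)"
    using eventually_bohr_add[OF evP] by metis
  obtain P2 where P2: "eventually P2 bohr_filter"
    "\<forall>q. (\<forall>i<k. P2 (q i)) \<longrightarrow> P1 (- (\<Sum>i<k. zmul (c i) (q i)))"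
    using eventually_bohr_lin_comb[OF P1(1), of k c] by blast
  define Q where "Q q \<longleftrightarrow> P2 q \<and> P (zmul r q)" for q
  have evQ: "eventually Q bohr_filter"
    unfolding Q_def[abs_def] using filterlim_zmul_bohr[of r] evP P2(1)
    by (intro eventually_conj) (auto simp: filterlim_iff)
  have b_of_bool: "bfun (\<lambda>y. of_bool (R y))" for R :: "'a \<Rightarrow> bool" by (rule bfunI[of _ 1]) auto
  define S where "S = zmul r ` {q. Q q}"
  \<comment> \<open>A Bohr set has positive mean, whereas finitely many fibres of
    \<open>zmul r\<close> have mean 0.\<close>
  have "infinite S"
  proof
    assume fS: "finite S"
    have "m (\<lambda>y. of_bool (Q y)) \<le> m (\<lambda>y. \<Sum>g\<in>S. of_bool (zmul r y = g))"
    proof (rule m_mono[OF b_of_bool bfun_sum[OF b_of_bool]])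
      fix y
      show "of_bool (Q y) \<le> (\<Sum>g\<in>S. of_bool (zmul r y = g) :: real)"
      proof (cases "Q y")
        case True
        then have "zmul r y \<in> S" by (auto simp: S_def)
        then have "of_bool (zmul r y = zmul r y) \<le> (\<Sum>g\<in>S. of_bool (zmul r y = g) :: real)"
          by (intro member_le_sum fS) auto
        then show ?thesis by simp
      qed (simp add: sum_nonneg)
    qed
    also have "\<dots> = (\<Sum>g\<in>S. m (\<lambda>y. of_bool (zmul r y = g)))" by (rule m_sum) (rule b_of_bool)
    also have "\<dots> = 0" by (simp add: m_fibre_zmul_eq_0[OF infinite_mult_set[OF fin_r inf]])
    finally show False using m_eventually_bohr[OF evQ] by linarith
  qed
  then obtain p where p: "inj_on p {..<k}" "p ` {..<k} \<subseteq> S" "c0 \<le> m (\<lambda>z. \<Prod>i<k. f (z + p i))"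
    using pig by blast
  have "\<exists>q. p i = zmul r q \<and> Q q" if "i < k" for i using p(2) that by (auto simp: S_def)
  then obtain q where q: "\<And>i. i < k \<Longrightarrow> p i = zmul r (q i) \<and> Q (q i)" by metis
  define x0 where "x0 = - (\<Sum>i<k. zmul (c i) (q i))"
  have x0: "P1 x0" using P2(2) q by (auto simp: x0_def Q_def)
  define f0 where "f0 z = (\<Prod>i<k. f (z + p i))" for z
  have f0_le: "0 \<le> f0 z" "f0 z \<le> f (z + p 0)" for z
  proof -
    show "0 \<le> f0 z" unfolding f0_def by (intro prod_nonneg) (simp add: f01)
    have "f0 z = f (z + p 0) * (\<Prod>i\<in>{..<k} - {0}. f (z + p i))"
      unfolding f0_def using k by (intro prod.remove) auto
    also have "\<dots> \<le> f (z + p 0) * 1"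
      by (intro mult_left_mono prod_le_1 f01) (simp add: f01)
    finally show "f0 z \<le> f (z + p 0)" by simp
  qed
  have Pp0: "P (p 0)" using q[OF k] by (auto simp: Q_def)
  have solve: "zmul r w' \<in> lin_comb_set d c A" if w': "P1 w'" for w'
  proof -
    define x where "x = w' + x0"
    have "P x" unfolding x_def by (rule P1(2)[OF w' x0])
    define \<Theta> where "\<Theta> y = m (\<lambda>z. f0 (z + zmul s y + x) * (f (z - zmul r y) * f z))" for y
    have "\<forall>z. 0 \<le> f0 z \<and> f0 z \<le> f (z + p 0)" "c0 \<le> m f0"
      using f0_le p(3) by (simp_all add: f0_def[abs_def])
    then have \<Theta>pos: "0 < m \<Theta>"
      unfolding \<Theta>_def[abs_def]
      by (rule P[THEN spec, THEN spec, THEN spec, THEN mp, THEN mp, THEN mp, THEN mp, OF Pp0 \<open>P x\<close>])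
    have f0_1: "\<bar>f0 z\<bar> \<le> 1" and f1: "\<bar>f z\<bar> \<le> 1" for z using f0_le[of z] f01[of z] f01[of "z + p 0"] by auto
    have \<Theta>1: "\<bar>\<Theta> y\<bar> \<le> 1" for y
      unfolding \<Theta>_def by (rule m_abs_le) (auto simp: abs_mult intro!: mult_le_one f0_1 f1)
    have b\<Theta>: "bfun \<Theta>" by (rule bfunI[OF \<Theta>1])
    \<comment> \<open>\<open>bad\<close> counts the coincidences among the entries of the solution attached to \<open>y\<close>.\<close>
    define bad :: "'a \<Rightarrow> real" where "bad y = of_bool (zmul r y = 0) + (\<Sum>i<k. of_bool (zmul s y = - (x + p i)) + of_bool (zmul (r + s) y = - (x + p i)))"
      for y
    have bbad: "bfun bad"
      unfolding bad_def[abs_def] by (intro bfun_add bfun_sum b_of_bool)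
    have "m bad = 0"
    proof -
      have "m bad = m (\<lambda>y. of_bool (zmul r y = 0)) +
        m (\<lambda>y. \<Sum>i<k. of_bool (zmul s y = - (x + p i)) + of_bool (zmul (r + s) y = - (x + p i)))"
        unfolding bad_def[abs_def] by (rule m_add) (intro bfun_add bfun_sum b_of_bool)+
      also have "m (\<lambda>y. \<Sum>i<k. of_bool (zmul s y = - (x + p i)) + of_bool (zmul (r + s) y = - (x + p i)))
        = (\<Sum>i<k. m (\<lambda>y. of_bool (zmul s y = - (x + p i)) + of_bool (zmul (r + s) y = - (x + p i))))"
        by (rule m_sum) (intro bfun_add b_of_bool)
      also have "\<dots> = (\<Sum>i<k. 0)"
        using m_add[OF b_of_bool b_of_bool]
        by (simp add: m_fibre_zmul_eq_0[OF infinite_mult_set[OF fin_s inf]]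
            m_fibre_zmul_eq_0[OF infinite_mult_set[OF fin_rs inf]])
      finally show ?thesis by (simp add: m_fibre_zmul_eq_0[OF infinite_mult_set[OF fin_r inf]])
    qed
    have "\<exists>y. 0 < \<Theta> y \<and> bad y = 0"
    proof (rule ccontr)
      assume no: "\<not> ?thesis"
      have "m \<Theta> \<le> m bad"
      proof (rule m_mono[OF b\<Theta> bbad])
        fix y
        show "\<Theta> y \<le> bad y"
        proof (cases "bad y = 0")
          case True
          then show ?thesis using no by force
        next
          case False
          \<comment> \<open>\<open>bad y\<close> is a natural number: if nonzero it is at least 1
            and dominates \<open>\<Theta> y\<close>.\<close>
          define n :: nat where "n = of_bool (zmul r y = 0) +
            (\<Sum>i<k. of_bool (zmul s y = - (x + p i)) + of_bool (zmul (r + s) y = - (x + p i)))"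
          have n: "bad y = real n" by (simp add: bad_def n_def)
          then have "n \<noteq> 0" using False by auto
          then have "1 \<le> bad y" unfolding n by simp
          then show ?thesis using \<Theta>1[of y] by linarith
        qed
      qed
      then show False using \<Theta>pos \<open>m bad = 0\<close> by simp
    qed
    then obtain y where y: "0 < \<Theta> y" "bad y = 0" by blast
    have "\<exists>z. f0 (z + zmul s y + x) * (f (z - zmul r y) * f z) \<noteq> 0"
    proof (rule ccontr)
      assume "\<not> ?thesis"
      then have "\<Theta> y = m (\<lambda>_. 0)" unfolding \<Theta>_def by (intro arg_cong[where f = m]) auto
      then show False using y(1) by simp
    qed
    then obtain z where z: "f0 (z + zmul s y + x) \<noteq> 0" "f (z - zmul r y) \<noteq> 0" "f z \<noteq> 0" by auto
    have zA: "z + zmul s y + x + p i \<in> A" if "i < k" for i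
      using z(1) that by (auto simp: f0_def f_def)
    have zA': "z - zmul r y \<in> A" "z \<in> A" using z(2,3) by (auto simp: f_def split: if_splits)
    have sum0: "(\<Sum>i<k. of_bool (zmul s y = - (x + p i)) + of_bool (zmul (r + s) y = - (x + p i)) :: real) = 0"
      and ry: "zmul r y \<noteq> 0"
    proof -
      have "0 \<le> (\<Sum>i<k. of_bool (zmul s y = - (x + p i)) + of_bool (zmul (r + s) y = - (x + p i)) :: real)"
        by (intro sum_nonneg) auto
      moreover have "0 \<le> (of_bool (zmul r y = 0) :: real)" by simp
      moreover have "of_bool (zmul r y = 0) + (\<Sum>i<k. of_bool (zmul s y = - (x + p i)) + of_bool (zmul (r + s) y = - (x + p i)) :: real) = 0"
        using y(2) by (simp only: bad_def)
      ultimately have ss: "(\<Sum>i<k. of_bool (zmul s y = - (x + p i)) + of_bool (zmul (r + s) y = - (x + p i)) :: real) = 0"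
        "(of_bool (zmul r y = 0) :: real) = 0" by linarith+
      show "(\<Sum>i<k. of_bool (zmul s y = - (x + p i)) + of_bool (zmul (r + s) y = - (x + p i)) :: real) = 0"
        by (rule ss(1))
      show "zmul r y \<noteq> 0" using ss(2) by (auto simp: of_bool_def)
    qed
    have "of_bool (zmul s y = - (x + p i)) + of_bool (zmul (r + s) y = - (x + p i)) = (0 :: real)" if "i < k" for i
    proof -
      have "\<forall>i\<in>{..<k}. of_bool (zmul s y = - (x + p i)) + of_bool (zmul (r + s) y = - (x + p i)) = (0 :: real)"
        using sum0 by (subst (asm) sum_nonneg_eq_0_iff) auto
      then show ?thesis using that by blast
    qed
    then have sy: "zmul s y \<noteq> - (x + p i)" "zmul (r + s) y \<noteq> - (x + p i)" if "i < k" for i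
      using that by (fastforce simp: of_bool_def split: if_splits)+
    define a where "a i = (if i < k then z + zmul s y + x + p i else if i = k then z - zmul r y else z)" for i
    have "inj_on a {..<d}"
    proof -
      have ne1: "z + zmul s y + x + p i \<noteq> z" if "i < k" for i
      proof
        assume "z + zmul s y + x + p i = z"
        then have "zmul s y + (x + p i) = 0" by (simp add: add.assoc)
        then show False using sy(1)[OF that] eq_neg_iff_add_eq_0 by blast
      qed
      have ne2: "z + zmul s y + x + p i \<noteq> z - zmul r y" if "i < k" for i
      proof
        assume eq: "z + zmul s y + x + p i = z - zmul r y"
        have "zmul (r + s) y + (x + p i) = (z + zmul s y + x + p i) - (z - zmul r y)"
          by (simp add: zmul_add_left algebra_simps)
        then have "zmul (r + s) y + (x + p i) = 0" by (simp only: eq diff_self)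
        then show False using sy(2)[OF that] eq_neg_iff_add_eq_0 by blast
      qed
      have ne3: "z - zmul r y \<noteq> z" using ry by simp
      have inj_p: "i = j" if "i < k" "j < k" "p i = p j" for i j using p(1) that by (auto dest: inj_onD)
      show ?thesis
      proof (rule inj_onI)
        fix i j assume ij: "i \<in> {..<d}" "j \<in> {..<d}" "a i = a j"
        have "i < k \<or> i = k \<or> i = Suc k" "j < k \<or> j = k \<or> j = Suc k" using ij by (auto simp: d_eq)
        then show "i = j"
          using ij(3) ne1[of i] ne1[of j] ne2[of i] ne2[of j] ne3 inj_p[of i j]
          by (elim disjE) (simp_all add: a_def)
      qed
    qed
    moreover have "\<forall>i<d. a i \<in> A" using zA zA' by (auto simp: a_def)
    moreover have "(\<Sum>i<d. zmul (c i) (a i)) = zmul r w'"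
    proof -
      have "(\<Sum>i<k. zmul (c i) (a i)) = (\<Sum>i<k. zmul (c i) (z + zmul s y + x) + zmul r (zmul (c i) (q i)))"
        by (intro sum.cong refl) (simp add: a_def q zmul_add_right zmul_zmul mult.commute)
      also have "\<dots> = zmul r (z + zmul s y + x) + zmul r (\<Sum>i<k. zmul (c i) (q i))"
        by (simp add: sum.distrib zmul_sum_left zmul_sum_right r_def)
      also have "(\<Sum>i<k. zmul (c i) (q i)) = - x0" by (simp add: x0_def)
      finally have 1: "(\<Sum>i<k. zmul (c i) (a i)) = zmul r z + zmul (r * s) y + zmul r w'"
        by (simp add: x_def zmul_add_right zmul_minus_right zmul_zmul algebra_simps)
      have "(\<Sum>i<d. zmul (c i) (a i)) = (\<Sum>i<k. zmul (c i) (a i)) + zmul s (z - zmul r y) + zmul t z"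
        by (simp add: d_eq a_def s_def t_def)
      \<comment> \<open>The terms in \<open>y\<close> cancel, and the remaining multiples of
        \<open>z\<close> sum to 0.\<close>
      also have "\<dots> = (zmul r z + (zmul s z + zmul t z)) + zmul r w'"
        unfolding 1 by (simp add: zmul_diff_right zmul_zmul mult.commute algebra_simps)
      also have "\<dots> = zmul r w'" by (simp add: rst)
      finally show ?thesis .
    qed
    ultimately show ?thesis unfolding lin_comb_set_def by (intro UnI1 CollectI exI[of _ a] conjI) simp_all
  qed
  have "eventually (\<lambda>w. \<exists>x. w = zmul r x \<and> P1 x) bohr_filter"
    by (rule eventually_bohr_zmul_image[OF r0 fin_r P1(1)])
  then show ?thesis by (rule eventually_mono) (use solve in blast)
qed

theorem theorem1p2:
  fixes A :: "'a::{ab_group_add, countable} set"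
    and d :: nat and c :: "nat \<Rightarrow> int"
  assumes "d \<ge> 3"
    and "\<forall>i<d. finite_index (mult_set (c i) :: 'a set)"
    and "finite_index (mult_set (c (d - 2) + c (d - 1)) :: 'a set)"
    and "int (group_exponent TYPE('a)) dvd (\<Sum>i<d. c i)"
    and "upper_banach_density A > 0"
  shows "\<exists>B. bohr_nbhd_zero B \<and> B \<subseteq> lin_comb_set d c A"
proof (rule ex_bohr_nbhd_zero, cases "finite (UNIV :: 'a set)")
  \<comment> \<open>In a finite group non-empty fibres have positive mean, so coincidences cannot be
    avoided by the argument above. There {0} has finite index, hence is a Bohr neighbourhood, and 0
    belongs to \<open>lin_comb_set\<close> by definition.\<close>
  case True
  have "finite_index ({0} :: 'a set)"
  proof -
    have "finite (range (\<lambda>g :: 'a. (\<lambda>h. g + h) ` {0}))" using True by (rule finite_imageI)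
    moreover have "{(\<lambda>h. g + h) ` {0} | g :: 'a. True} = range (\<lambda>g. (\<lambda>h. g + h) ` {0})" by auto
    ultimately show ?thesis unfolding finite_index_def by simp
  qed
  then have "eventually (\<lambda>w. w \<in> {0 :: 'a}) bohr_filter" by (intro eventually_bohr_subgroup) auto
  then show "eventually (\<lambda>w. w \<in> lin_comb_set d c A) bohr_filter"
    by (rule eventually_mono) (auto simp: lin_comb_set_def)
next
  case False
  obtain m where m: "m \<in> inv_means" "0 < m (\<lambda>x. of_bool (x \<in> A))"
    and ext: "\<And>y z. y \<in> inv_means \<Longrightarrow> z \<in> inv_means \<Longrightarrow> (\<And>\<phi>. m \<phi> = (y \<phi> + z \<phi>) / 2) \<Longrightarrow> y = m"
    using extreme_inv_mean[OF assms(5)] by metis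
  interpret mean m by unfold_locales (rule m(1))
  interpret ergodic_mean m by unfold_locales (rule ergodic_if_extreme[OF ext])
  show "eventually (\<lambda>w. w \<in> lin_comb_set d c A) bohr_filter"
    by (rule eventually_lin_comb_set[OF False m(2) assms(1)])
      (use assms in \<open>auto intro: zmul_eq_0_if_group_exponent_dvd\<close>)
qed

end
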